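(* Let $\mathcal K$ be a 2-category and $n\ge0$ an integer. The 2-functor $E:\mathsf{Wdl}^{(n)}(\overline{\mathcal K})\to\mathsf{Mnd}(\overline{\mathcal K})^{\mathbf 2^{n+1}}$ described in the context is fully faithful (it is injective on 1-cells and on 2-cells, every 1-cell of $\mathsf{Mnd}(\overline{\mathcal K})^{\mathbf 2^{n+1}}$ between images of two 0-cells is the image of a 1-cell, and every 2-cell between images of two 1-cells is the image of a 2-cell).
   Context: Conventions. For 1-cells, $uw$ is the horizontal composite ($w$ first); for 2-cells $\alpha,\beta$, $\alpha\beta$ is their horizontal composite; a 1-cell next to a 2-cell means whiskering; $\alpha.\beta$ is vertical composition ($\beta$ first). A monad $(A,t)$ has multiplication $\mu:tt\to t$, unit $\eta:1_A\to t$; decorations of $t$ carry over to $\mu,\eta$. Local idempotent closure $\overline{\mathcal K}$: same 0-cells as $\mathcal K$; 1-cells $A\to B$ are pairs $(v,\bar v)$ with $v$ a 1-cell of $\mathcal K$ and $\bar v:v\to v$ an idempotent 2-cell; 2-cells $(v,\bar v)\to(v',\bar v')$ are 2-cells $\omega:v\to v'$ of $\mathcal K$ with $\bar v'.\omega=\omega=\omega.\bar v$; compositions induced from $\mathcal K$ (horizontal composite $(uw,\bar u\bar w)$), identity 2-cell of $(v,\bar v)$ is $\bar v$. A monad $(A,(t,\bar t))$ in $\overline{\mathcal K}$ satisfies in particular $\mu.t\eta=\mu.\eta t=\bar t$; we often write just $t$, and $v$ for $(v,\bar v)$. For $\mathcal L\in\{\mathcal K,\overline{\mathcal K}\}$,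 $\mathsf{Mnd}(\mathcal L)$: 0-cells monads in $\mathcal L$; 1-cells $(A,t)\to(A',t')$ are $(v,\psi)$, $\psi:t'v\to vt$, with $\psi.\mu'v=v\mu.\psi t.t'\psi$, $\psi.\eta'v=v\eta$; 2-cells $(v,\psi)\to(v',\psi')$ are $\omega:v\to v'$ with $\psi'.t'\omega=\omega t.\psi$; the composite of $(u,\chi)$ followed by $(v,\psi)$ is $(vu,v\chi.\psi u)$. Weak distributive law in $\mathcal L$: monads $(A,t),(A,s)$ and $\lambda:ts\to st$ with $\lambda.\mu s=s\mu.\lambda t.t\lambda$, $\lambda.t\mu=\mu t.s\lambda.\lambda s$, $\lambda.\eta s=\mu t.s\lambda.st\eta.s\eta$, $\lambda.t\eta=s\mu.\lambda t.\eta st.\eta t$; its idempotent is $\bar\lambda:=\mu t.s\lambda.st\eta$. $\mathsf{Wdl}(\mathcal L)$: 1-cells $\lambda\to\lambda'$ are $(v,\xi,\zeta)$ with $(v,\xi):(A,t)\to(A',t')$, $(v,\zeta):(A,s)\to(A',s')$ in $\mathsf{Mnd}(\mathcal L)$ and $v\lambda.\xi s.t'\zeta=v\bar\lambda.\zeta t.s'\xi.\lambda'v$. $\mathsf{Wdl}^{(n)}(\mathcal L)$: 0-cells are monads $(A,s_0),\dots,(A,s_n)$ in $\mathcal L$ with weak distributive laws $\lambda_{i,j}:s_js_i\to s_is_j$ ($i<j$) satisfying $\lambda_{i,j}s_k.s_j\lambda_{i,k}.\lambda_{j,k}s_i=s_i\lambda_{j,k}.\lambda_{i,k}s_j.s_k\lambda_{i,j}$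 ($i<j<k$); 1-cells are $v:A\to A'$ with $\xi_i:s'_iv\to vs_i$ such that each $(v,\xi_i)$ is in $\mathsf{Mnd}(\mathcal L)$ and $(v,\xi_i,\xi_j)$ is a 1-cell of $\mathsf{Wdl}(\mathcal L)$ for $i<j$; 2-cells are $\omega:v\to v'$ which are 2-cells $(v,\xi_i)\to(v',\xi'_i)$ in $\mathsf{Mnd}(\mathcal L)$ for all $i$. Iterated products. Fix a 0-cell $\{\lambda_{i,j}\}$ of $\mathsf{Wdl}^{(n)}(\overline{\mathcal K})$. For $i_0<\dots<i_m$ write $s_I=s_{i_0}\cdots s_{i_m}$; a "reordering composite" is any composite of whiskered $\lambda_{i,j}$'s of minimal length between given products (all such agree by Yang–Baxter). Define $\bar\lambda_I$: $\bar s_{i_0}$ if $m=0$; $\bar\lambda_{i_0i_1}$ if $m=1$; for $m\ge2$, $\bar\lambda_I=\overleftarrow\lambda_I.(\bar\lambda_{i_0\dots i_{m-1}}s_{i_m})$ where $\overleftarrow\lambda_I=s_{i_0}\cdots s_{i_{m-1}}\mu_{i_m}.R.\eta_{i_m}s_I$ and $R:s_{i_m}s_I\to s_Is_{i_m}$ is the reordering composite. The monad $(s_I,\bar\lambda_I)$ in $\overline{\mathcal K}$ has multiplication $\bar\lambda_I.\mu_{i_0}\cdots\mu_{i_m}.R_1$ with $R_1:s_Is_I\to s_{i_0}s_{i_0}\cdots s_{i_m}s_{i_m}$ reordering, and unit $\bar\lambda_I.R_2.\eta_{i_m}\cdots\eta_{i_0}$ with $R_2:s_{i_m}\cdots s_{i_0}\to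 s_I$ reordering; for $I=\emptyset$ it is the trivial monad $(1_A,1_{1_A})$. For a 1-cell $(v,\{\xi_i\})$ put $\xi_I=v\bar\lambda_I.\xi_{i_0}s_{i_1}\cdots s_{i_m}.\cdots.s'_{i_0}\cdots s'_{i_{m-1}}\xi_{i_m}:s'_Iv\to vs_I$, and $\xi_\emptyset=\bar v$. Cubes. Elements $\underline p\in\{0,1\}^{n+1}$ correspond to subsets $I_{\underline p}=\{i:p_i=1\}$; write $s_{\underline p},\bar\lambda_{\underline p},\xi_{\underline p}$ accordingly; $\underline p+i$ means setting $p_i$ from $0$ to $1$. For a 2-category $\mathcal M$, $\mathcal M^{\mathbf 2^{n+1}}$ has as 0-cells families of 0-cells $X_{\underline p}$ with 1-cells $f_{\underline p,i}:X_{\underline p+i}\to X_{\underline p}$ (whenever $p_i=0$) such that $f_{\underline p,i}f_{\underline p+i,j}=f_{\underline p,j}f_{\underline p+j,i}$; 1-cells are families $u_{\underline p}:X_{\underline p}\to X'_{\underline p}$ with $f'_{\underline p,i}u_{\underline p+i}=u_{\underline p}f_{\underline p,i}$; 2-cells are families $\omega_{\underline p}:u_{\underline p}\to\tilde u_{\underline p}$ with $f'_{\underline p,i}\omega_{\underline p+i}=\omega_{\underline p}f_{\underline p,i}$. The 2-functor $E$: a 0-cell goes to the cube with vertices $(A,(s_{\underline p},\bar\lambda_{\underline p}))$ and edges $((A,1_{1_A}),\varphi^i_{\underline p}):(A,s_{\underline p+i})\to(A,s_{\underline p})$, where $\varphi^i_{\underline p}=\bar\lambda_{\underline p+i}.(s_{I'}\eta_is_{I''}):s_{\underline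 p}\to s_{\underline p+i}$ with $I',I''$ the elements of $I_{\underline p}$ smaller, resp. larger, than $i$; a 1-cell $(v,\{\xi_i\})$ goes to the family $((v,\bar v),\xi_{\underline p})$; a 2-cell $\omega$ goes to the family constantly $\omega$. *)

theory Defs
  imports Main
begin

text \<open>A (strict) 2-category with carriers of 0-, 1- and 2-cells.
  cmp1 u w = uw (w first); hcmp a b = horizontal composite (b first);
  vcmp a b = a.b (b first).\<close>

record ('o,'a,'b) cat2 =
  ob :: "'o set"
  hom :: "'a set"
  cell :: "'b set"
  src1 :: "'a \<Rightarrow> 'o"
  tgt1 :: "'a \<Rightarrow> 'o"
  src2 :: "'b \<Rightarrow> 'a"
  tgt2 :: "'b \<Rightarrow> 'a"
  i1 :: "'o \<Rightarrow> 'a"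
  i2 :: "'a \<Rightarrow> 'b"
  cmp1 :: "'a \<Rightarrow> 'a \<Rightarrow> 'a"
  hcmp :: "'b \<Rightarrow> 'b \<Rightarrow> 'b"
  vcmp :: "'b \<Rightarrow> 'b \<Rightarrow> 'b"

definition two_category :: "('o,'a,'b) cat2 \<Rightarrow> bool" where
"two_category K \<longleftrightarrow>
  (\<forall>f\<in>hom K. src1 K f \<in> ob K \<and> tgt1 K f \<in> ob K) \<and>
  (\<forall>A\<in>ob K. i1 K A \<in> hom K \<and> src1 K (i1 K A) = A \<and> tgt1 K (i1 K A) = A) \<and>
  (\<forall>f\<in>hom K. \<forall>g\<in>hom K. src1 K f = tgt1 K g \<longrightarrow>
      cmp1 K f g \<in> hom K \<and> src1 K (cmp1 K f g) = src1 K g \<and> tgt1 K (cmp1 K f g) = tgt1 K f) \<and>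
  (\<forall>f\<in>hom K. \<forall>g\<in>hom K. \<forall>h\<in>hom K. src1 K f = tgt1 K g \<and> src1 K g = tgt1 K h \<longrightarrow>
      cmp1 K (cmp1 K f g) h = cmp1 K f (cmp1 K g h)) \<and>
  (\<forall>f\<in>hom K. cmp1 K (i1 K (tgt1 K f)) f = f \<and> cmp1 K f (i1 K (src1 K f)) = f) \<and>
  (\<forall>a\<in>cell K. src2 K a \<in> hom K \<and> tgt2 K a \<in> hom K \<and>
      src1 K (src2 K a) = src1 K (tgt2 K a) \<and> tgt1 K (src2 K a) = tgt1 K (tgt2 K a)) \<and>
  (\<forall>f\<in>hom K. i2 K f \<in> cell K \<and> src2 K (i2 K f) = f \<and> tgt2 K (i2 K f) = f) \<and>
  (\<forall>a\<in>cell K. \<forall>b\<in>cell K. src2 K a = tgt2 K b \<longrightarrow>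
      vcmp K a b \<in> cell K \<and> src2 K (vcmp K a b) = src2 K b \<and> tgt2 K (vcmp K a b) = tgt2 K a) \<and>
  (\<forall>a\<in>cell K. \<forall>b\<in>cell K. \<forall>c\<in>cell K. src2 K a = tgt2 K b \<and> src2 K b = tgt2 K c \<longrightarrow>
      vcmp K (vcmp K a b) c = vcmp K a (vcmp K b c)) \<and>
  (\<forall>a\<in>cell K. vcmp K (i2 K (tgt2 K a)) a = a \<and> vcmp K a (i2 K (src2 K a)) = a) \<and>
  (\<forall>a\<in>cell K. \<forall>b\<in>cell K. src1 K (src2 K a) = tgt1 K (src2 K b) \<longrightarrow>
      hcmp K a b \<in> cell K \<and> src2 K (hcmp K a b) = cmp1 K (src2 K a) (src2 K b) \<and>
      tgt2 K (hcmp K a b) = cmp1 K (tgt2 K a) (tgt2 K b)) \<and>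
  (\<forall>a\<in>cell K. \<forall>b\<in>cell K. \<forall>c\<in>cell K.
      src1 K (src2 K a) = tgt1 K (src2 K b) \<and> src1 K (src2 K b) = tgt1 K (src2 K c) \<longrightarrow>
      hcmp K (hcmp K a b) c = hcmp K a (hcmp K b c)) \<and>
  (\<forall>a\<in>cell K. hcmp K (i2 K (i1 K (tgt1 K (src2 K a)))) a = a \<and>
      hcmp K a (i2 K (i1 K (src1 K (src2 K a)))) = a) \<and>
  (\<forall>f\<in>hom K. \<forall>g\<in>hom K. src1 K f = tgt1 K g \<longrightarrow> hcmp K (i2 K f) (i2 K g) = i2 K (cmp1 K f g)) \<and>
  (\<forall>a\<in>cell K. \<forall>b\<in>cell K. \<forall>c\<in>cell K. \<forall>d\<in>cell K.
      src2 K a = tgt2 K b \<and> src2 K c = tgt2 K d \<and> src1 K (src2 K a) = tgt1 K (src2 K c) \<longrightarrow>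
      hcmp K (vcmp K a b) (vcmp K c d) = vcmp K (hcmp K a c) (hcmp K b d))"

definition idem :: "('o,'a,'b) cat2 \<Rightarrow> 'b \<Rightarrow> bool" where
"idem K e \<longleftrightarrow> e \<in> cell K \<and> src2 K e = tgt2 K e \<and> vcmp K e e = e"

text \<open>1-cells of the closure are pairs (v, vbar); a 2-cell (v,vbar) \<rightarrow> (v',vbar') is
  represented by the triple (omega, vbar, vbar') (source and target recorded).\<close>

definition lic :: "('o,'a,'b) cat2 \<Rightarrow> ('o, 'a \<times> 'b, 'b \<times> 'b \<times> 'b) cat2" where
"lic K = \<lparr> ob = ob K,
   hom = {(v,e). v \<in> hom K \<and> idem K e \<and> src2 K e = v},
   cell = {(w,e,e'). idem K e \<and> idem K e' \<and> w \<in> cell K \<and> src2 K w = src2 K e \<and>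
             tgt2 K w = src2 K e' \<and> vcmp K e' w = w \<and> vcmp K w e = w},
   src1 = (\<lambda>(v,e). src1 K v),
   tgt1 = (\<lambda>(v,e). tgt1 K v),
   src2 = (\<lambda>(w,e,e'). (src2 K e, e)),
   tgt2 = (\<lambda>(w,e,e'). (src2 K e', e')),
   i1 = (\<lambda>A. (i1 K A, i2 K (i1 K A))),
   i2 = (\<lambda>(v,e). (e,e,e)),
   cmp1 = (\<lambda>(u,e) (w,f). (cmp1 K u w, hcmp K e f)),
   hcmp = (\<lambda>(a,e,e') (b,f,f'). (hcmp K a b, hcmp K e f, hcmp K e' f')),
   vcmp = (\<lambda>(a,e,e') (b,f,f'). (vcmp K a b, f, e')) \<rparr>"

definition wl :: "('o,'a,'b) cat2 \<Rightarrow> 'a \<Rightarrow> 'b \<Rightarrow> 'b" where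
"wl L f a = hcmp L (i2 L f) a"
definition wr :: "('o,'a,'b) cat2 \<Rightarrow> 'b \<Rightarrow> 'a \<Rightarrow> 'b" where
"wr L a f = hcmp L a (i2 L f)"

fun mnd0 :: "('o,'a,'b) cat2 \<Rightarrow> 'o \<times> 'a \<times> 'b \<times> 'b \<Rightarrow> bool" where
"mnd0 L (A,t,m,u) \<longleftrightarrow> A \<in> ob L \<and> t \<in> hom L \<and> src1 L t = A \<and> tgt1 L t = A \<and>
   m \<in> cell L \<and> src2 L m = cmp1 L t t \<and> tgt2 L m = t \<and>
   u \<in> cell L \<and> src2 L u = i1 L A \<and> tgt2 L u = t \<and>
   vcmp L m (wr L m t) = vcmp L m (wl L t m) \<and>
   vcmp L m (wl L t u) = i2 L t \<and> vcmp L m (wr L u t) = i2 L t"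

fun mnd1 :: "('o,'a,'b) cat2 \<Rightarrow> 'o \<times> 'a \<times> 'b \<times> 'b \<Rightarrow> 'o \<times> 'a \<times> 'b \<times> 'b \<Rightarrow> 'a \<times> 'b \<Rightarrow> bool" where
"mnd1 L (A,t,m,u) (A',t',m',u') (v,p) \<longleftrightarrow>
   v \<in> hom L \<and> src1 L v = A \<and> tgt1 L v = A' \<and>
   p \<in> cell L \<and> src2 L p = cmp1 L t' v \<and> tgt2 L p = cmp1 L v t \<and>
   vcmp L p (wr L m' v) = vcmp L (wl L v m) (vcmp L (wr L p t) (wl L t' p)) \<and>
   vcmp L p (wr L u' v) = wl L v u"

fun mnd2 :: "('o,'a,'b) cat2 \<Rightarrow> 'o \<times> 'a \<times> 'b \<times> 'b \<Rightarrow> 'o \<times> 'a \<times> 'b \<times> 'b \<Rightarrow>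
             'a \<times> 'b \<Rightarrow> 'a \<times> 'b \<Rightarrow> 'b \<Rightarrow> bool" where
"mnd2 L (A,t,m,u) (A',t',m',u') (v,p) (v',p') w \<longleftrightarrow>
   w \<in> cell L \<and> src2 L w = v \<and> tgt2 L w = v' \<and>
   vcmp L p' (wl L t' w) = vcmp L (wr L w t) p"

fun mnd_comp :: "('o,'a,'b) cat2 \<Rightarrow> 'a \<times> 'b \<Rightarrow> 'a \<times> 'b \<Rightarrow> 'a \<times> 'b" where
"mnd_comp L (v,p) (u,c) = (cmp1 L v u, vcmp L (wl L v c) (wr L p u))"

fun wdl :: "('o,'a,'b) cat2 \<Rightarrow> 'o \<times> 'a \<times> 'b \<times> 'b \<Rightarrow> 'o \<times> 'a \<times> 'b \<times> 'b \<Rightarrow> 'b \<Rightarrow> bool" where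
"wdl L (A,t,mt,ut) (B,s,ms,us) l \<longleftrightarrow>
   mnd0 L (A,t,mt,ut) \<and> mnd0 L (B,s,ms,us) \<and> A = B \<and>
   l \<in> cell L \<and> src2 L l = cmp1 L t s \<and> tgt2 L l = cmp1 L s t \<and>
   vcmp L l (wr L mt s) = vcmp L (wl L s mt) (vcmp L (wr L l t) (wl L t l)) \<and>
   vcmp L l (wl L t ms) = vcmp L (wr L ms t) (vcmp L (wl L s l) (wr L l s)) \<and>
   vcmp L l (wr L ut s) =
     vcmp L (wr L ms t) (vcmp L (wl L s l) (vcmp L (wl L (cmp1 L s t) us) (wl L s ut))) \<and>
   vcmp L l (wl L t us) =
     vcmp L (wl L s mt) (vcmp L (wr L l t) (vcmp L (wr L ut (cmp1 L s t)) (wr L us t)))"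

fun wbar :: "('o,'a,'b) cat2 \<Rightarrow> 'o \<times> 'a \<times> 'b \<times> 'b \<Rightarrow> 'o \<times> 'a \<times> 'b \<times> 'b \<Rightarrow> 'b \<Rightarrow> 'b" where
"wbar L (A,t,mt,ut) (B,s,ms,us) l =
   vcmp L (wr L ms t) (vcmp L (wl L s l) (wl L (cmp1 L s t) us))"

fun wdl1 :: "('o,'a,'b) cat2 \<Rightarrow> 'o \<times> 'a \<times> 'b \<times> 'b \<Rightarrow> 'o \<times> 'a \<times> 'b \<times> 'b \<Rightarrow> 'b \<Rightarrow>
             'o \<times> 'a \<times> 'b \<times> 'b \<Rightarrow> 'o \<times> 'a \<times> 'b \<times> 'b \<Rightarrow> 'b \<Rightarrow> 'a \<Rightarrow> 'b \<Rightarrow> 'b \<Rightarrow> bool" where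
"wdl1 L (A,t,mt,ut) (B,s,ms,us) l (A',t',mt',ut') (B',s',ms',us') l' v x z \<longleftrightarrow>
   mnd1 L (A,t,mt,ut) (A',t',mt',ut') (v,x) \<and> mnd1 L (B,s,ms,us) (B',s',ms',us') (v,z) \<and>
   vcmp L (wl L v l) (vcmp L (wr L x s) (wl L t' z)) =
   vcmp L (wl L v (wbar L (A,t,mt,ut) (B,s,ms,us) l))
     (vcmp L (wr L z t) (vcmp L (wl L s' x) (wr L l' v)))"

text \<open>0-cells: object A, monads (A, s_i, mu_i, eta_i) for i \<le> n, and laws
  lambda_{i,j} = wlam i j : s_j s_i \<rightarrow> s_i s_j for i < j \<le> n.\<close>
record ('o,'a,'b) wdlobj =
  wA :: 'o
  ws :: "nat \<Rightarrow> 'a"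
  wmu :: "nat \<Rightarrow> 'b"
  weta :: "nat \<Rightarrow> 'b"
  wlam :: "nat \<Rightarrow> nat \<Rightarrow> 'b"

definition mndi :: "('o,'a,'b) wdlobj \<Rightarrow> nat \<Rightarrow> 'o \<times> 'a \<times> 'b \<times> 'b" where
"mndi X i = (wA X, ws X i, wmu X i, weta X i)"

definition wdln0 :: "('o,'a,'b) cat2 \<Rightarrow> nat \<Rightarrow> ('o,'a,'b) wdlobj \<Rightarrow> bool" where
"wdln0 L n X \<longleftrightarrow>
   (\<forall>i\<le>n. mnd0 L (mndi X i)) \<and>
   (\<forall>i j. i < j \<and> j \<le> n \<longrightarrow> wdl L (mndi X j) (mndi X i) (wlam X i j)) \<and>
   (\<forall>i j k. i < j \<and> j < k \<and> k \<le> n \<longrightarrow>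
      vcmp L (wr L (wlam X i j) (ws X k))
        (vcmp L (wl L (ws X j) (wlam X i k)) (wr L (wlam X j k) (ws X i))) =
      vcmp L (wl L (ws X i) (wlam X j k))
        (vcmp L (wr L (wlam X i k) (ws X j)) (wl L (ws X k) (wlam X i j))))"

definition wdln1 :: "('o,'a,'b) cat2 \<Rightarrow> nat \<Rightarrow> ('o,'a,'b) wdlobj \<Rightarrow> ('o,'a,'b) wdlobj \<Rightarrow>
                     'a \<times> 'b list \<Rightarrow> bool" where
"wdln1 L n X Y F \<longleftrightarrow> (case F of (v, xs) \<Rightarrow>
   length xs = n + 1 \<and> v \<in> hom L \<and> src1 L v = wA X \<and> tgt1 L v = wA Y \<and>
   (\<forall>i\<le>n. mnd1 L (mndi X i) (mndi Y i) (v, xs ! i)) \<and>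
   (\<forall>i j. i < j \<and> j \<le> n \<longrightarrow>
      wdl1 L (mndi X j) (mndi X i) (wlam X i j) (mndi Y j) (mndi Y i) (wlam Y i j)
        v (xs ! j) (xs ! i)))"

definition wdln2 :: "('o,'a,'b) cat2 \<Rightarrow> nat \<Rightarrow> ('o,'a,'b) wdlobj \<Rightarrow> ('o,'a,'b) wdlobj \<Rightarrow>
                     'a \<times> 'b list \<Rightarrow> 'a \<times> 'b list \<Rightarrow> 'b \<Rightarrow> bool" where
"wdln2 L n X Y F G w \<longleftrightarrow> (case F of (v, xs) \<Rightarrow> case G of (v', ys) \<Rightarrow>
   (\<forall>i\<le>n. mnd2 L (mndi X i) (mndi Y i) (v, xs ! i) (v', ys ! i) w))"

fun prodw :: "('o,'a,'b) cat2 \<Rightarrow> ('o,'a,'b) wdlobj \<Rightarrow> nat list \<Rightarrow> 'a" where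
"prodw L X [] = i1 L (wA X)"
| "prodw L X [i] = ws X i"
| "prodw L X (i # j # w) = cmp1 L (ws X i) (prodw L X (j # w))"

definition wlw :: "('o,'a,'b) cat2 \<Rightarrow> ('o,'a,'b) wdlobj \<Rightarrow> nat list \<Rightarrow> 'b \<Rightarrow> 'b" where
"wlw L X w a = (if w = [] then a else wl L (prodw L X w) a)"
definition wrw :: "('o,'a,'b) cat2 \<Rightarrow> ('o,'a,'b) wdlobj \<Rightarrow> 'b \<Rightarrow> nat list \<Rightarrow> 'b" where
"wrw L X a w = (if w = [] then a else wr L a (prodw L X w))"

text \<open>Reordering composites (a fixed minimal-length choice, insertion sort):
  ins_cell x w : s_x s_w \<rightarrow> s_(insort x w) for sorted w;
  sort_cell w : s_w \<rightarrow> s_(sort w).\<close>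
fun ins_cell :: "('o,'a,'b) cat2 \<Rightarrow> ('o,'a,'b) wdlobj \<Rightarrow> nat \<Rightarrow> nat list \<Rightarrow> 'b" where
"ins_cell L X x [] = i2 L (ws X x)"
| "ins_cell L X x (y # w) =
    (if x \<le> y then i2 L (prodw L X (x # y # w))
     else vcmp L (wlw L X [y] (ins_cell L X x w)) (wrw L X (wlam X y x) w))"

fun sort_cell :: "('o,'a,'b) cat2 \<Rightarrow> ('o,'a,'b) wdlobj \<Rightarrow> nat list \<Rightarrow> 'b" where
"sort_cell L X [] = i2 L (i1 L (wA X))"
| "sort_cell L X (x # w) = vcmp L (ins_cell L X x (sort w)) (wlw L X [x] (sort_cell L X w))"

fun hprod :: "('o,'a,'b) cat2 \<Rightarrow> ('o,'a,'b) wdlobj \<Rightarrow> 'b list \<Rightarrow> 'b" where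
"hprod L X [] = i2 L (i1 L (wA X))"
| "hprod L X [a] = a"
| "hprod L X (a # b # w) = hcmp L a (hprod L X (b # w))"

text \<open>leftarrow-lambda_I for a strictly increasing list I of length \<ge> 2.\<close>
definition larrow :: "('o,'a,'b) cat2 \<Rightarrow> ('o,'a,'b) wdlobj \<Rightarrow> nat list \<Rightarrow> 'b" where
"larrow L X I = (let m = last I in
    vcmp L (wlw L X (butlast I) (wmu X m))
      (vcmp L (ins_cell L X m I) (wr L (weta X m) (prodw L X I))))"

fun lbar_r :: "('o,'a,'b) cat2 \<Rightarrow> ('o,'a,'b) wdlobj \<Rightarrow> nat list \<Rightarrow> 'b" where
"lbar_r L X [] = i2 L (i1 L (wA X))"
| "lbar_r L X [i] = i2 L (ws X i)"
| "lbar_r L X [j, i] = wbar L (mndi X j) (mndi X i) (wlam X i j)"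
| "lbar_r L X (k # j # i # w) =
     vcmp L (larrow L X (rev (k # j # i # w))) (wrw L X (lbar_r L X (j # i # w)) [k])"

definition lbar :: "('o,'a,'b) cat2 \<Rightarrow> ('o,'a,'b) wdlobj \<Rightarrow> nat list \<Rightarrow> 'b" where
"lbar L X I = lbar_r L X (rev I)"

definition mult_raw :: "('o,'a,'b) cat2 \<Rightarrow> ('o,'a,'b) wdlobj \<Rightarrow> nat list \<Rightarrow> 'b" where
"mult_raw L X I = (if I = [] then i2 L (i1 L (wA X)) else
    vcmp L (lbar L X I) (vcmp L (hprod L X (map (wmu X) I)) (sort_cell L X (I @ I))))"

definition unit_raw :: "('o,'a,'b) cat2 \<Rightarrow> ('o,'a,'b) wdlobj \<Rightarrow> nat list \<Rightarrow> 'b" where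
"unit_raw L X I = (if I = [] then i2 L (i1 L (wA X)) else
    vcmp L (lbar L X I) (vcmp L (sort_cell L X (rev I)) (hprod L X (map (weta X) (rev I)))))"

fun xichain :: "('o,'a,'b) cat2 \<Rightarrow> ('o,'a,'b) wdlobj \<Rightarrow> ('o,'a,'b) wdlobj \<Rightarrow> 'a \<Rightarrow>
                'b list \<Rightarrow> nat list \<Rightarrow> 'b" where
"xichain L X Y v xs [] = i2 L v"
| "xichain L X Y v xs [i] = xs ! i"
| "xichain L X Y v xs (i # j # w) =
     vcmp L (wrw L X (xs ! i) (j # w)) (wlw L Y [i] (xichain L X Y v xs (j # w)))"

text \<open>Vertices are indexed by subsets I of {0..n}, listed increasingly.
  The vertex monad is (A, (s_I, lambda-bar_I)) in the closure of K.\<close>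

type_synonym ('o,'a,'b) lobj = "('o, 'a \<times> 'b, 'b \<times> 'b \<times> 'b) wdlobj"

definition vert :: "('o,'a,'b) cat2 \<Rightarrow> ('o,'a,'b) lobj \<Rightarrow> nat set \<Rightarrow>
                    'o \<times> ('a \<times> 'b) \<times> ('b \<times> 'b \<times> 'b) \<times> ('b \<times> 'b \<times> 'b)" where
"vert K X I = (let L = lic K; Il = sorted_list_of_set I;
     Lb = fst (lbar L X Il); P = fst (prodw L X Il) in
   (wA X, (P, Lb), (fst (mult_raw L X Il), hcmp K Lb Lb, Lb),
    (fst (unit_raw L X Il), i2 K (i1 K (wA X)), Lb)))"

text \<open>phi^i_I : s_I \<rightarrow> s_(I+i), as a 2-cell s_I 1_A \<rightarrow> 1_A s_(I+i) of the closure.\<close>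
definition phi :: "('o,'a,'b) cat2 \<Rightarrow> ('o,'a,'b) lobj \<Rightarrow> nat set \<Rightarrow> nat \<Rightarrow> 'b \<times> 'b \<times> 'b" where
"phi K X I i = (let L = lic K; Il = sorted_list_of_set I; J = sorted_list_of_set (insert i I);
     raw = vcmp L (lbar L X J)
             (wlw L X (filter (\<lambda>j. j < i) Il) (wrw L X (weta X i) (filter (\<lambda>j. i < j) Il))) in
   (fst raw, hcmp K (fst (lbar L X Il)) (i2 K (i1 K (wA X))),
             hcmp K (i2 K (i1 K (wA X))) (fst (lbar L X J))))"

text \<open>Edge 1-cell ((A,1_{1_A}), phi^i_I) : (A, s_(I+i)) \<rightarrow> (A, s_I) in Mnd.\<close>
definition edge :: "('o,'a,'b) cat2 \<Rightarrow> ('o,'a,'b) lobj \<Rightarrow> nat set \<Rightarrow> nat \<Rightarrow>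
                    ('a \<times> 'b) \<times> ('b \<times> 'b \<times> 'b)" where
"edge K X I i = (i1 (lic K) (wA X), phi K X I i)"

definition xiI :: "('o,'a,'b) cat2 \<Rightarrow> ('o,'a,'b) lobj \<Rightarrow> ('o,'a,'b) lobj \<Rightarrow>
                   ('a \<times> 'b) \<times> ('b \<times> 'b \<times> 'b) list \<Rightarrow> nat list \<Rightarrow> 'b \<times> 'b \<times> 'b" where
"xiI K X Y F Il = (case F of (v, xs) \<Rightarrow> let L = lic K;
     raw = (if Il = [] then i2 L v else vcmp L (wl L v (lbar L X Il)) (xichain L X Y v xs Il)) in
   (fst raw, hcmp K (fst (lbar L Y Il)) (snd v), hcmp K (snd v) (fst (lbar L X Il))))"

definition E1 :: "('o,'a,'b) cat2 \<Rightarrow> ('o,'a,'b) lobj \<Rightarrow> ('o,'a,'b) lobj \<Rightarrow>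
                  ('a \<times> 'b) \<times> ('b \<times> 'b \<times> 'b) list \<Rightarrow> nat set \<Rightarrow> ('a \<times> 'b) \<times> ('b \<times> 'b \<times> 'b)" where
"E1 K X Y F I = (fst F, xiI K X Y F (sorted_list_of_set I))"

definition E2 :: "'c \<Rightarrow> nat set \<Rightarrow> 'c" where
"E2 w I = w"

definition cube1 :: "('o,'a,'b) cat2 \<Rightarrow> nat \<Rightarrow> ('o,'a,'b) lobj \<Rightarrow> ('o,'a,'b) lobj \<Rightarrow>
                     (nat set \<Rightarrow> ('a \<times> 'b) \<times> ('b \<times> 'b \<times> 'b)) \<Rightarrow> bool" where
"cube1 K n X Y u \<longleftrightarrow>
   (\<forall>I. I \<subseteq> {..n} \<longrightarrow> mnd1 (lic K) (vert K X I) (vert K Y I) (u I)) \<and>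
   (\<forall>I i. I \<subseteq> {..n} \<and> i \<le> n \<and> i \<notin> I \<longrightarrow>
      mnd_comp (lic K) (edge K Y I i) (u (insert i I)) = mnd_comp (lic K) (u I) (edge K X I i))"

definition cube2 :: "('o,'a,'b) cat2 \<Rightarrow> nat \<Rightarrow> ('o,'a,'b) lobj \<Rightarrow> ('o,'a,'b) lobj \<Rightarrow>
                     (nat set \<Rightarrow> ('a \<times> 'b) \<times> ('b \<times> 'b \<times> 'b)) \<Rightarrow>
                     (nat set \<Rightarrow> ('a \<times> 'b) \<times> ('b \<times> 'b \<times> 'b)) \<Rightarrow>
                     (nat set \<Rightarrow> 'b \<times> 'b \<times> 'b) \<Rightarrow> bool" where
"cube2 K n X Y u u' w \<longleftrightarrow>
   (\<forall>I. I \<subseteq> {..n} \<longrightarrow> mnd2 (lic K) (vert K X I) (vert K Y I) (u I) (u' I) (w I)) \<and>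
   (\<forall>I i. I \<subseteq> {..n} \<and> i \<le> n \<and> i \<notin> I \<longrightarrow>
      hcmp (lic K) (i2 (lic K) (i1 (lic K) (wA Y))) (w (insert i I)) =
      hcmp (lic K) (w I) (i2 (lic K) (i1 (lic K) (wA X))))"

end

theory Submission
  imports Defs
begin

text \<open>
Everything happens in the 2-category \<open>L = lic K\<close>, with the idempotents \<open>lbar J\<close> written out. For
\<open>x \<in> J\<close> let \<open>act x J : s_x s_J \<rightarrow> s_J\<close> move \<open>x\<close> to its place in \<open>J\<close> by the laws \<open>\<lambda>\<close> and multiply there.
These are associative (non-unital) actions, compatible through \<open>\<lambda>\<close>, so the idempotents
\<open>e_x = act x J . \<eta>_x\<close> satisfy \<open>e_y e_x = e_x e_y e_x = e_y e_x e_y\<close> for \<open>x < y\<close>. Hence \<open>lbar J\<close>, the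
decreasing product of all \<open>e_x\<close>, absorbs every \<open>e_x\<close> on both sides.

The multiplication of the product monad on \<open>s_J\<close> is \<open>lbar J\<close> after the iterated action. Composed with
the edge inclusions of \<open>s_i\<close> and \<open>s_I\<close> into \<open>s_J\<close> for \<open>J = i # I\<close> it gives \<open>lbar J\<close>; composed with those
of \<open>s_y\<close> and \<open>s_x\<close> (in this order) for \<open>J = [x,y]\<close> it gives \<open>\<lambda>\<close>. If a family \<open>\<psi>_J\<close> of monad morphisms
commutes with the edges, the first identity determines \<open>\<psi>_J\<close> from \<open>\<psi>_i\<close> and \<open>\<psi>_I\<close>, which is the
formula for \<open>\<xi>_J\<close>, and the second is the compatibility of \<open>\<psi>_x\<close> and \<open>\<psi>_y\<close> with \<open>\<lambda>\<close>.
\<close>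

section \<open>2-categories and the local idempotent closure\<close>

text \<open>Idempotents occur on two levels. A 1-cell of \<open>lic K\<close> already carries one,
  and \<open>lbar J\<close> is a further idempotent on the product 1-cell of \<open>lic K\<close>,
  in general not its identity. The vertex monad lives on the 1-cell whose identity 2-cell is
  \<open>lbar J\<close>. So a component of a cube morphism and the same 2-cell of \<open>K\<close>
  read between the plain products have different sources and targets, and its multiplication law has
  \<open>lbar J\<close> where a law between plain products would have identities. Each argument
  therefore needs absorption laws that make these \<open>lbar J\<close> disappear.

  The relations between the \<open>e_x\<close> reflect the weakness of the unit laws: \<lambda>
  applied to a unit of one monad also creates a unit of the other, and the extra unit turns into an
  extra idempotent.

  An edge inserts a single letter, whereas the first identity needs the inclusion of
  \<open>s_i\<close> into a long product. It is built from edges that each insert a letter larger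
  than all present ones. Such a letter is placed at the end, so the composite is
  \<open>lbar J\<close> after bare units in increasing order, without any reordering.\<close>

locale two_cat =
  fixes K :: "('o,'a,'b) cat2"
  assumes two_cat: "two_category K"
begin

lemma src1_ob: "f \<in> hom K \<Longrightarrow> src1 K f \<in> ob K"
  and tgt1_ob: "f \<in> hom K \<Longrightarrow> tgt1 K f \<in> ob K"
  and i1_hom: "A \<in> ob K \<Longrightarrow> i1 K A \<in> hom K"
  and src1_i1: "A \<in> ob K \<Longrightarrow> src1 K (i1 K A) = A"
  and tgt1_i1: "A \<in> ob K \<Longrightarrow> tgt1 K (i1 K A) = A"
  using two_cat unfolding two_category_def by simp_all

lemma cmp1_hom: "f \<in> hom K \<Longrightarrow> g \<in> hom K \<Longrightarrow> src1 K f = tgt1 K g \<Longrightarrow> cmp1 K f g \<in> hom K"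
  and src1_cmp1: "f \<in> hom K \<Longrightarrow> g \<in> hom K \<Longrightarrow> src1 K f = tgt1 K g \<Longrightarrow> src1 K (cmp1 K f g) = src1 K g"
  and tgt1_cmp1: "f \<in> hom K \<Longrightarrow> g \<in> hom K \<Longrightarrow> src1 K f = tgt1 K g \<Longrightarrow> tgt1 K (cmp1 K f g) = tgt1 K f"
  using two_cat unfolding two_category_def by simp_all

lemma cmp1_assoc: "f \<in> hom K \<Longrightarrow> g \<in> hom K \<Longrightarrow> h \<in> hom K \<Longrightarrow> src1 K f = tgt1 K g \<Longrightarrow>
    src1 K g = tgt1 K h \<Longrightarrow> cmp1 K (cmp1 K f g) h = cmp1 K f (cmp1 K g h)"
  and cmp1_i1_left: "f \<in> hom K \<Longrightarrow> A = tgt1 K f \<Longrightarrow> cmp1 K (i1 K A) f = f"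
  and cmp1_i1_right: "f \<in> hom K \<Longrightarrow> A = src1 K f \<Longrightarrow> cmp1 K f (i1 K A) = f"
  using two_cat unfolding two_category_def by simp_all

lemma src2_hom: "a \<in> cell K \<Longrightarrow> src2 K a \<in> hom K"
  and tgt2_hom: "a \<in> cell K \<Longrightarrow> tgt2 K a \<in> hom K"
  and src1_tgt2: "a \<in> cell K \<Longrightarrow> src1 K (tgt2 K a) = src1 K (src2 K a)"
  and tgt1_tgt2: "a \<in> cell K \<Longrightarrow> tgt1 K (tgt2 K a) = tgt1 K (src2 K a)"
  and i2_cell: "f \<in> hom K \<Longrightarrow> i2 K f \<in> cell K"
  and src2_i2: "f \<in> hom K \<Longrightarrow> src2 K (i2 K f) = f"
  and tgt2_i2: "f \<in> hom K \<Longrightarrow> tgt2 K (i2 K f) = f"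
  using two_cat unfolding two_category_def by simp_all

lemma vcmp_cell: "a \<in> cell K \<Longrightarrow> b \<in> cell K \<Longrightarrow> src2 K a = tgt2 K b \<Longrightarrow> vcmp K a b \<in> cell K"
  and src2_vcmp: "a \<in> cell K \<Longrightarrow> b \<in> cell K \<Longrightarrow> src2 K a = tgt2 K b \<Longrightarrow> src2 K (vcmp K a b) = src2 K b"
  and tgt2_vcmp: "a \<in> cell K \<Longrightarrow> b \<in> cell K \<Longrightarrow> src2 K a = tgt2 K b \<Longrightarrow> tgt2 K (vcmp K a b) = tgt2 K a"
  using two_cat unfolding two_category_def by simp_all

lemma vcmp_assoc: "a \<in> cell K \<Longrightarrow> b \<in> cell K \<Longrightarrow> c \<in> cell K \<Longrightarrow> src2 K a = tgt2 K b \<Longrightarrow>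
    src2 K b = tgt2 K c \<Longrightarrow> vcmp K (vcmp K a b) c = vcmp K a (vcmp K b c)"
  and vcmp_i2_left: "a \<in> cell K \<Longrightarrow> f = tgt2 K a \<Longrightarrow> vcmp K (i2 K f) a = a"
  and vcmp_i2_right: "a \<in> cell K \<Longrightarrow> f = src2 K a \<Longrightarrow> vcmp K a (i2 K f) = a"
  using two_cat unfolding two_category_def by simp_all

lemma hcmp_cell: "a \<in> cell K \<Longrightarrow> b \<in> cell K \<Longrightarrow> src1 K (src2 K a) = tgt1 K (src2 K b) \<Longrightarrow>
    hcmp K a b \<in> cell K"
  and src2_hcmp: "a \<in> cell K \<Longrightarrow> b \<in> cell K \<Longrightarrow> src1 K (src2 K a) = tgt1 K (src2 K b) \<Longrightarrow>
    src2 K (hcmp K a b) = cmp1 K (src2 K a) (src2 K b)"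
  and tgt2_hcmp: "a \<in> cell K \<Longrightarrow> b \<in> cell K \<Longrightarrow> src1 K (src2 K a) = tgt1 K (src2 K b) \<Longrightarrow>
    tgt2 K (hcmp K a b) = cmp1 K (tgt2 K a) (tgt2 K b)"
  using two_cat unfolding two_category_def by simp_all

lemma hcmp_assoc: "a \<in> cell K \<Longrightarrow> b \<in> cell K \<Longrightarrow> c \<in> cell K \<Longrightarrow>
    src1 K (src2 K a) = tgt1 K (src2 K b) \<Longrightarrow> src1 K (src2 K b) = tgt1 K (src2 K c) \<Longrightarrow>
    hcmp K (hcmp K a b) c = hcmp K a (hcmp K b c)"
  and hcmp_i2: "f \<in> hom K \<Longrightarrow> g \<in> hom K \<Longrightarrow> src1 K f = tgt1 K g \<Longrightarrow>
    hcmp K (i2 K f) (i2 K g) = i2 K (cmp1 K f g)"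
  and exchange: "a \<in> cell K \<Longrightarrow> b \<in> cell K \<Longrightarrow> c \<in> cell K \<Longrightarrow> d \<in> cell K \<Longrightarrow>
    src2 K a = tgt2 K b \<Longrightarrow> src2 K c = tgt2 K d \<Longrightarrow> src1 K (src2 K a) = tgt1 K (src2 K c) \<Longrightarrow>
    hcmp K (vcmp K a b) (vcmp K c d) = vcmp K (hcmp K a c) (hcmp K b d)"
  using two_cat unfolding two_category_def by simp_all

lemma hcmp_i1_left: "a \<in> cell K \<Longrightarrow> A = tgt1 K (src2 K a) \<Longrightarrow> hcmp K (i2 K (i1 K A)) a = a"
  using two_cat unfolding two_category_def by blast

lemma hcmp_i1_right: "a \<in> cell K \<Longrightarrow> A = src1 K (src2 K a) \<Longrightarrow> hcmp K a (i2 K (i1 K A)) = a"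
  using two_cat unfolding two_category_def by blast

lemmas cells = src1_ob tgt1_ob i1_hom src1_i1 tgt1_i1 cmp1_hom src1_cmp1 tgt1_cmp1 src2_hom tgt2_hom
  src1_tgt2 tgt1_tgt2 i2_cell src2_i2 tgt2_i2 vcmp_cell src2_vcmp tgt2_vcmp hcmp_cell src2_hcmp tgt2_hcmp

lemma idem_iff: "idem K e \<longleftrightarrow> e \<in> cell K \<and> tgt2 K e = src2 K e \<and> vcmp K e e = e"
  by (auto simp: idem_def)

lemmas lic_simps = lic_def idem_iff cells cmp1_assoc cmp1_i1_left cmp1_i1_right vcmp_i2_left vcmp_i2_right
  hcmp_i1_left hcmp_i1_right hcmp_i2 hcmp_assoc

lemma two_category_lic: "two_category (lic K)"
  unfolding two_category_def
  apply (intro conjI)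
  subgoal by (clarsimp simp: lic_simps)
  subgoal by (clarsimp simp: lic_simps)
  subgoal by (clarsimp simp: lic_simps exchange[symmetric])
  subgoal by (clarsimp simp: lic_simps)
  subgoal by (clarsimp simp: lic_simps)
  subgoal by (clarsimp simp: lic_simps, metis src1_tgt2 tgt1_tgt2)
  subgoal by (clarsimp simp: lic_simps)
  subgoal by (clarsimp simp: lic_simps, metis vcmp_assoc)
  subgoal by (clarsimp simp: lic_simps vcmp_assoc)
  subgoal by (clarsimp simp: lic_simps)
  subgoal
    apply (clarsimp simp: lic_def idem_iff)
    subgoal for a e e' b d d'
      using src1_tgt2[of a] tgt1_tgt2[of b] by (simp add: cells exchange[symmetric])
    done
  subgoal
    apply (clarsimp simp: lic_def idem_iff)
    subgoal for a e e' b d d' c g g'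
      using src1_tgt2[of a] tgt1_tgt2[of b] src1_tgt2[of b] tgt1_tgt2[of c] by (simp add: hcmp_assoc)
    done
  subgoal
    apply (clarsimp simp: lic_def idem_iff)
    subgoal for a e e'
      using src1_tgt2[of a] tgt1_tgt2[of a] by (simp add: hcmp_i1_left hcmp_i1_right)
    done
  subgoal by (clarsimp simp: lic_simps)
  subgoal by (clarsimp simp: lic_simps exchange[symmetric])
  done

end

section \<open>Weak distributive laws on words\<close>

text \<open>Cells between words of monad indices; \<open>W p f q\<close> whiskers \<open>f\<close>
  by the word \<open>p\<close> on the left and \<open>q\<close> on the right. Associativity and
  functoriality of whiskering carry no typing hypotheses, so \<open>normal\<close> flattens any
  diagram to a chain of whiskered generators without side conditions. Types are required only for
  unit laws, empty whiskering and interchange.\<close>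

locale word_calculus =
  fixes n :: nat
    and ty :: "'c \<Rightarrow> nat list \<Rightarrow> nat list \<Rightarrow> bool"
    and comp :: "'c \<Rightarrow> 'c \<Rightarrow> 'c" (infixr "\<bullet>" 55)
    and W :: "nat list \<Rightarrow> 'c \<Rightarrow> nat list \<Rightarrow> 'c"
    and Id :: "nat list \<Rightarrow> 'c"
  assumes assoc: "(f \<bullet> g) \<bullet> h = f \<bullet> (g \<bullet> h)"
    and W_comp: "W p (f \<bullet> g) q = W p f q \<bullet> W p g q"
    and W_W: "W p (W p' f q') q = W (p @ p') f (q' @ q)"
    and W_Id: "W p (Id a) q = Id (p @ a @ q)"
    and W_Nil: "ty f a b \<Longrightarrow> W [] f [] = f"
    and ty_comp: "ty f b c \<Longrightarrow> ty g a b \<Longrightarrow> ty (f \<bullet> g) a c"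
    and ty_W: "ty f a b \<Longrightarrow> set p \<subseteq> {..n} \<Longrightarrow> set q \<subseteq> {..n} \<Longrightarrow> ty (W p f q) (p @ a @ q) (p @ b @ q)"
    and ty_Id: "set a \<subseteq> {..n} \<Longrightarrow> ty (Id a) a a"
    and Id_left: "ty f a b \<Longrightarrow> Id b \<bullet> f = f"
    and Id_right: "ty f a b \<Longrightarrow> f \<bullet> Id a = f"
    and interchange: "ty f a b \<Longrightarrow> ty g c d \<Longrightarrow>
      W p f (q @ d @ r) \<bullet> W (p @ a @ q) g r = W (p @ b @ q) g r \<bullet> W p f (q @ c @ r)"
begin

lemmas normal = assoc W_comp W_W

text \<open>Composites are nested to the right, so an equation between initial segments of a chain
  can be used for rewriting only together with the remaining factors \<open>r\<close>.\<close>

lemma tail: "f = g \<Longrightarrow> f \<bullet> r = g \<bullet> r"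
  by simp

lemma whisker_tail: "f = g \<Longrightarrow> W p f q \<bullet> r = W p g q \<bullet> r"
  by simp

lemma whisker: "f = g \<Longrightarrow> W p f q = W p g q"
  by simp

lemma ty_compI: "ty f b c \<Longrightarrow> ty g a b' \<Longrightarrow> b = b' \<Longrightarrow> ty (f \<bullet> g) a c"
  by (simp add: ty_comp)

lemma ty_WI: "ty f a b \<Longrightarrow> set p \<subseteq> {..n} \<Longrightarrow> set q \<subseteq> {..n} \<Longrightarrow> u = p @ a @ q \<Longrightarrow> w = p @ b @ q
    \<Longrightarrow> ty (W p f q) u w"
  by (simp add: ty_W)

end

locale wdl_calculus = word_calculus +
  fixes mu :: "nat \<Rightarrow> 'a" and eta :: "nat \<Rightarrow> 'a" and lam :: "nat \<Rightarrow> nat \<Rightarrow> 'a"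
  assumes ty_mu: "x \<le> n \<Longrightarrow> ty (mu x) [x,x] [x]"
    and ty_eta: "x \<le> n \<Longrightarrow> ty (eta x) [] [x]"
    and ty_lam: "x < y \<Longrightarrow> y \<le> n \<Longrightarrow> ty (lam x y) [y,x] [x,y]"
    and mu_assoc: "x \<le> n \<Longrightarrow> mu x \<bullet> W [] (mu x) [x] = mu x \<bullet> W [x] (mu x) []"
    and mu_eta_right: "x \<le> n \<Longrightarrow> mu x \<bullet> W [x] (eta x) [] = Id [x]"
    and mu_eta_left: "x \<le> n \<Longrightarrow> mu x \<bullet> W [] (eta x) [x] = Id [x]"
    and lam_mu_left: "x < y \<Longrightarrow> y \<le> n \<Longrightarrow>
      lam x y \<bullet> W [] (mu y) [x] = W [x] (mu y) [] \<bullet> W [] (lam x y) [y] \<bullet> W [y] (lam x y) []"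
    and lam_mu_right: "x < y \<Longrightarrow> y \<le> n \<Longrightarrow>
      lam x y \<bullet> W [y] (mu x) [] = W [] (mu x) [y] \<bullet> W [x] (lam x y) [] \<bullet> W [] (lam x y) [x]"
    and lam_eta_left: "x < y \<Longrightarrow> y \<le> n \<Longrightarrow> lam x y \<bullet> W [] (eta y) [x] =
      W [] (mu x) [y] \<bullet> W [x] (lam x y) [] \<bullet> W [x,y] (eta x) [] \<bullet> W [x] (eta y) []"
    and lam_eta_right: "x < y \<Longrightarrow> y \<le> n \<Longrightarrow> lam x y \<bullet> W [y] (eta x) [] =
      W [x] (mu y) [] \<bullet> W [] (lam x y) [y] \<bullet> W [] (eta y) [x,y] \<bullet> W [] (eta x) [y]"
    and yang_baxter: "x < y \<Longrightarrow> y < z \<Longrightarrow> z \<le> n \<Longrightarrow>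
      W [] (lam x y) [z] \<bullet> W [y] (lam x z) [] \<bullet> W [] (lam y z) [x] =
      W [x] (lam y z) [] \<bullet> W [] (lam x z) [y] \<bullet> W [z] (lam x y) []"
begin

section \<open>Actions of a single letter on an increasing word\<close>

definition inc :: "nat list \<Rightarrow> bool" where
  "inc J \<longleftrightarrow> sorted_wrt (<) J \<and> set J \<subseteq> {..n}"

lemma inc_Cons: "inc (y # J) \<longleftrightarrow> y \<le> n \<and> (\<forall>x\<in>set J. y < x) \<and> inc J"
  by (auto simp: inc_def)

lemma inc_append: "inc (J @ J') \<longleftrightarrow> inc J \<and> inc J' \<and> (\<forall>x\<in>set J. \<forall>y\<in>set J'. x < y)"
  by (auto simp: inc_def sorted_wrt_append)

lemma incD: "inc J \<Longrightarrow> x \<in> set J \<Longrightarrow> x \<le> n"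
  by (auto simp: inc_def)

lemma inc_set: "inc J \<Longrightarrow> set J \<subseteq> {..n}"
  by (simp add: inc_def)

text \<open>The value at \<open>[]\<close> is a default: for \<open>x\<close> in an increasing
  \<open>J\<close> the recursion crosses the letters smaller than \<open>x\<close> and stops at
  \<open>x\<close>.\<close>

primrec act :: "nat \<Rightarrow> nat list \<Rightarrow> 'a" where
  "act x [] = Id [x]"
| "act x (y # J) = (if x = y then W [] (mu x) J else W [y] (act x J) [] \<bullet> W [] (lam y x) J)"

lemma ty_act: "inc J \<Longrightarrow> x \<in> set J \<Longrightarrow> ty (act x J) (x # J) J"
proof (induction J)
  case (Cons y J)
  show ?case
  proof (cases "x = y")
    case True
    with Cons.prems ty_W[OF ty_mu, of x "[]" J] show ?thesis
      by (auto simp: inc_Cons inc_set)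
  next
    case False
    with Cons.prems have "x \<in> set J" "y < x" "x \<le> n" "inc J" "y \<le> n"
      by (auto simp: inc_Cons incD)
    then show ?thesis using False Cons.IH
      by (auto intro!: ty_compI ty_WI ty_lam intro: incD)
  qed
qed simp

text \<open>By \<open>lam_mu_left\<close>, two copies of \<open>x\<close> cross a smaller letter in
  the same way as their product; at the letter \<open>x\<close> itself the claim is associativity of
  \<open>mu x\<close>.\<close>

lemma act_mu:
  "inc J \<Longrightarrow> x \<in> set J \<Longrightarrow> act x J \<bullet> W [x] (act x J) [] = act x J \<bullet> W [] (mu x) J"
proof (induction J)
  case (Cons y J)
  show ?case
  proof (cases "x = y")
    case True
    with Cons.prems have "x \<le> n" by (simp add: inc_Cons)
    from whisker[OF mu_assoc[OF this], of "[]" J] True show ?thesis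
      by (simp add: normal)
  next
    case False
    with Cons.prems have x: "x \<in> set J" "y < x" "x \<le> n" "inc J" "y \<le> n"
      by (auto simp: inc_Cons incD)
    have "act x (y # J) \<bullet> W [x] (act x (y # J)) [] =
        W [y] (act x J) [] \<bullet> W [] (lam y x) J \<bullet> W [x,y] (act x J) [] \<bullet> W [x] (lam y x) J"
      using False by (simp add: normal)
    also have "\<dots> = W [y] (act x J) [] \<bullet> W [y,x] (act x J) [] \<bullet> W [] (lam y x) (x # J) \<bullet> W [x] (lam y x) J"
      using interchange[OF ty_lam ty_act, of y x J x "[]" "[]" "[]", THEN tail] x
      by (simp add: normal)
    also have "\<dots> = W [y] (act x J) [] \<bullet> W [y] (mu x) J \<bullet> W [] (lam y x) (x # J) \<bullet> W [x] (lam y x) J"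
      using whisker_tail[OF Cons.IH[OF x(4,1)], of "[y]" "[]"] by (simp add: normal)
    also have "\<dots> = act x (y # J) \<bullet> W [] (mu x) (y # J)"
      using whisker[OF lam_mu_left[OF x(2,3)], of "[]" J] False by (simp add: normal)
    finally show ?thesis .
  qed
qed simp

text \<open>Letters smaller than both \<open>x\<close> and \<open>y\<close> are crossed by
  Yang-Baxter. The recursion ends at the letter \<open>x\<close>, where \<open>y\<close> has to
  cross a product \<open>mu x\<close>, which is \<open>lam_mu_right\<close>.\<close>

lemma act_comm:
  "inc J \<Longrightarrow> x \<in> set J \<Longrightarrow> y \<in> set J \<Longrightarrow> x < y \<Longrightarrow>
   act y J \<bullet> W [y] (act x J) [] = act x J \<bullet> W [x] (act y J) [] \<bullet> W [] (lam x y) J"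
proof (induction J)
  case (Cons z J)
  show ?case
  proof (cases "x = z")
    case True
    with Cons.prems have y: "y \<in> set J" "y \<le> n" "inc J" "z \<le> n" "z < y" "x \<le> n" "y \<noteq> z" "y \<noteq> x"
      by (auto simp: inc_Cons incD)
    have "act y (z # J) \<bullet> W [y] (act x (z # J)) [] =
        W [x] (act y J) [] \<bullet> W [] (lam x y) J \<bullet> W [y] (mu x) J"
      using y True by (simp add: normal)
    also have "\<dots> = W [x] (act y J) [] \<bullet> W [] (mu x) (y # J) \<bullet> W [x] (lam x y) J \<bullet> W [] (lam x y) (x # J)"
      using whisker[OF lam_mu_right[OF _ y(2), of x], of "[]" J] Cons.prems by (simp add: normal)
    also have "\<dots> = W [] (mu x) J \<bullet> W [x,x] (act y J) [] \<bullet> W [x] (lam x y) J \<bullet> W [] (lam x y) (x # J)"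
      using interchange[OF ty_mu ty_act, of x J y "[]" "[]" "[]", THEN tail] y by (simp add: normal)
    finally show ?thesis using True y by (simp add: normal)
  next
    case False
    with Cons.prems have x: "x \<in> set J" "y \<in> set J" "y \<le> n" "x \<le> n" "inc J" "z \<le> n" "z < y" "z < x"
      "y \<noteq> z" "x \<noteq> z"
      by (auto simp: inc_Cons incD)
    have "act y (z # J) \<bullet> W [y] (act x (z # J)) [] =
        W [z] (act y J) [] \<bullet> W [] (lam z y) J \<bullet> W [y,z] (act x J) [] \<bullet> W [y] (lam z x) J"
      using x by (simp add: normal)
    also have "\<dots> = W [z] (act y J) [] \<bullet> W [z,y] (act x J) [] \<bullet> W [] (lam z y) (x # J) \<bullet> W [y] (lam z x) J"
      using interchange[OF ty_lam ty_act, of z y J x "[]" "[]" "[]", THEN tail] x by (simp add: normal)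
    also have "\<dots> = W [z] (act x J) [] \<bullet> W [z,x] (act y J) [] \<bullet>
        W [z] (lam x y) J \<bullet> W [] (lam z y) (x # J) \<bullet> W [y] (lam z x) J"
      using whisker_tail[OF Cons.IH[OF x(5,1,2)], of "[z]" "[]"] Cons.prems by (simp add: normal)
    also have "\<dots> = W [z] (act x J) [] \<bullet> W [z,x] (act y J) [] \<bullet>
        W [] (lam z x) (y # J) \<bullet> W [x] (lam z y) J \<bullet> W [] (lam x y) (z # J)"
      using whisker[OF yang_baxter[of z x y], of "[]" J] x Cons.prems by (simp add: normal)
    also have "\<dots> = W [z] (act x J) [] \<bullet> W [] (lam z x) J \<bullet> W [x,z] (act y J) [] \<bullet>
        W [x] (lam z y) J \<bullet> W [] (lam x y) (z # J)"
      using interchange[OF ty_lam ty_act, of z x J y "[]" "[]" "[]", THEN tail] x by (simp add: normal)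
    finally show ?thesis using x by (simp add: normal)
  qed
qed simp

section \<open>Idempotents obtained by acting with a unit\<close>

definition e :: "nat \<Rightarrow> nat list \<Rightarrow> 'a" where
  "e x J = act x J \<bullet> W [] (eta x) J"

lemma ty_e: "inc J \<Longrightarrow> x \<in> set J \<Longrightarrow> ty (e x J) J J"
  unfolding e_def
  by (rule ty_compI[OF ty_act ty_WI[OF ty_eta]]) (auto simp: inc_set incD)

lemma eta_act:
  assumes "x \<le> n" "ty f a b"
  shows "W [] (eta x) b \<bullet> f = W [x] f [] \<bullet> W [] (eta x) a"
  using interchange[OF ty_eta assms(2), of x "[]" "[]" "[]"] assms W_Nil[OF assms(2)] by simp

lemma e_act_self:
  assumes "inc J" "x \<in> set J"
  shows "e x J \<bullet> act x J = act x J"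
proof -
  have x: "x \<le> n" using assms by (rule incD)
  have "e x J \<bullet> act x J = act x J \<bullet> W [x] (act x J) [] \<bullet> W [] (eta x) (x # J)"
    using eta_act[OF x ty_act[OF assms]] by (simp add: e_def normal)
  also have "\<dots> = act x J \<bullet> W [] (mu x) J \<bullet> W [] (eta x) (x # J)"
    using act_mu[OF assms, THEN tail] by (simp add: normal)
  also have "\<dots> = act x J \<bullet> Id (x # J)"
    using whisker[OF mu_eta_left[OF x], of "[]" J] by (simp add: normal W_Id)
  finally show ?thesis using Id_right[OF ty_act[OF assms]] by simp
qed

lemma act_e_self:
  assumes "inc J" "x \<in> set J"
  shows "act x J \<bullet> W [x] (e x J) [] = act x J"
proof -
  have x: "x \<le> n" using assms by (rule incD)
  have "act x J \<bullet> W [x] (e x J) [] = act x J \<bullet> W [] (mu x) J \<bullet> W [x] (eta x) J"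
    using act_mu[OF assms, THEN tail] by (simp add: e_def normal)
  also have "\<dots> = act x J \<bullet> Id (x # J)"
    using whisker[OF mu_eta_right[OF x], of "[]" J] by (simp add: normal W_Id)
  finally show ?thesis using Id_right[OF ty_act[OF assms]] by simp
qed

lemma e_idem: "inc J \<Longrightarrow> x \<in> set J \<Longrightarrow> e x J \<bullet> e x J = e x J"
  using e_act_self[THEN tail, of J x "W [] (eta x) J"] by (simp add: e_def normal)

text \<open>After \<open>act_comm\<close>, the unit of \<open>y\<close> sits directly before
  \<open>lam x y\<close>, where \<open>lam_eta_left\<close> replaces it by units of both
  \<open>y\<close> and \<open>x\<close>. The new unit of \<open>x\<close> becomes the additional
  \<open>e x J\<close>, and the multiplication created with it splits into two actions of
  \<open>x\<close>, by \<open>act_mu\<close>.\<close>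

lemma e_act:
  assumes J: "inc J" "x \<in> set J" "y \<in> set J" and less: "x < y"
  shows "e y J \<bullet> act x J = act x J \<bullet> W [x] (e y J \<bullet> e x J) []"
proof -
  note n = incD[OF J(1) J(2)] incD[OF J(1) J(3)]
  note ty = ty_act[OF J(1) J(2)] ty_act[OF J(1) J(3)] ty_e[OF J(1) J(2)]
  note comm = act_comm[OF J less]
  let ?r = "W [x,y] (eta x) J \<bullet> W [x] (eta y) J"
  have "e y J \<bullet> act x J = act y J \<bullet> W [y] (act x J) [] \<bullet> W [] (eta y) (x # J)"
    using eta_act[OF n(2) ty(1)] by (simp add: e_def normal)
  also have "\<dots> = act x J \<bullet> W [x] (act y J) [] \<bullet> W [] (lam x y) J \<bullet> W [] (eta y) (x # J)"
    using comm[THEN tail] by (simp add: normal)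
  also have "\<dots> = act x J \<bullet> W [x] (act y J) [] \<bullet> W [] (mu x) (y # J) \<bullet> W [x] (lam x y) J \<bullet> ?r"
    using whisker[OF lam_eta_left[OF less n(2)], of "[]" J] by (simp add: normal)
  also have "\<dots> = act x J \<bullet> W [] (mu x) J \<bullet> W [x,x] (act y J) [] \<bullet> W [x] (lam x y) J \<bullet> ?r"
    using interchange[OF ty_mu[OF n(1)] ty(2), of "[]" "[]" "[]", THEN tail] by (simp add: normal)
  also have "\<dots> = act x J \<bullet> W [x] (act x J) [] \<bullet> W [x,x] (act y J) [] \<bullet> W [x] (lam x y) J \<bullet> ?r"
    using act_mu[OF J(1,2), THEN tail] by (simp add: normal)
  also have "\<dots> = act x J \<bullet> W [x] (act y J) [] \<bullet> W [x,y] (act x J) [] \<bullet> ?r"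
    using whisker_tail[OF comm, of "[x]" "[]"] by (simp add: normal)
  also have "\<dots> = act x J \<bullet> W [x] (act y J) [] \<bullet> W [x,y] (e x J) [] \<bullet> W [x] (eta y) J"
    by (simp add: e_def normal)
  also have "\<dots> = act x J \<bullet> W [x] (act y J) [] \<bullet> W [x] (eta y) J \<bullet> W [x] (e x J) []"
    using whisker[OF eta_act[OF n(2) ty(3)], of "[x]" "[]"] by (simp add: normal)
  finally show ?thesis by (simp add: e_def normal)
qed

text \<open>The counterpart of \<open>e_act\<close>, with \<open>lam_eta_right\<close>: the unit of
  \<open>x\<close> meets \<open>lam x y\<close> and creates a unit of \<open>y\<close>, which
  becomes the additional \<open>e y J\<close> on the outside.\<close>

lemma act_e:
  assumes J: "inc J" "x \<in> set J" "y \<in> set J" and less: "x < y"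
  shows "act y J \<bullet> W [y] (e x J) [] = e y J \<bullet> e x J \<bullet> act y J"
proof -
  note n = incD[OF J(1) J(2)] incD[OF J(1) J(3)]
  note ty = ty_act[OF J(1) J(2)] ty_act[OF J(1) J(3)] ty_e[OF J(1) J(2)]
  note comm = act_comm[OF J less]
  let ?r = "W [] (eta y) (x # y # J) \<bullet> W [] (eta x) (y # J)"
  have ty': "ty (act x J \<bullet> W [x] (act y J) []) (x # y # J) J"
    by (rule ty_compI[OF ty(1) ty_WI[OF ty(2)]]) (use n in auto)
  have "act y J \<bullet> W [y] (e x J) [] = act x J \<bullet> W [x] (act y J) [] \<bullet> W [] (lam x y) J \<bullet> W [y] (eta x) J"
    using comm[THEN tail] by (simp add: e_def normal)
  also have "\<dots> = act x J \<bullet> W [x] (act y J) [] \<bullet> W [x] (mu y) J \<bullet> W [] (lam x y) (y # J) \<bullet> ?r"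
    using whisker[OF lam_eta_right[OF less n(2)], of "[]" J] by (simp add: normal)
  also have "\<dots> = act x J \<bullet> W [x] (act y J) [] \<bullet> W [x,y] (act y J) [] \<bullet> W [] (lam x y) (y # J) \<bullet> ?r"
    using whisker_tail[OF act_mu[OF J(1,3)], of "[x]" "[]"] by (simp add: normal)
  also have "\<dots> = act x J \<bullet> W [x] (act y J) [] \<bullet> W [] (lam x y) J \<bullet> W [y,x] (act y J) [] \<bullet> ?r"
    using interchange[OF ty_lam[OF less n(2)] ty(2), of "[]" "[]" "[]", THEN tail] by (simp add: normal)
  also have "\<dots> = act y J \<bullet> W [y] (act x J) [] \<bullet> W [y,x] (act y J) [] \<bullet> ?r"
    using comm[THEN tail] by (simp add: normal)
  also have "\<dots> = act y J \<bullet> W [] (eta y) J \<bullet> act x J \<bullet> W [x] (act y J) [] \<bullet> W [] (eta x) (y # J)"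
    using eta_act[OF n(2) ty', THEN tail] by (simp add: normal)
  also have "\<dots> = act y J \<bullet> W [] (eta y) J \<bullet> act x J \<bullet> W [] (eta x) J \<bullet> act y J"
    using eta_act[OF n(1) ty(2)] by simp
  finally show ?thesis by (simp add: e_def normal)
qed

text \<open>Compose \<open>e_act\<close> with the unit of \<open>x\<close>, respectively
  \<open>act_e\<close> with the unit of \<open>y\<close>; by \<open>eta_act\<close> the actions turn
  into idempotents.\<close>

lemma e_e_less:
  assumes J: "inc J" "x \<in> set J" "y \<in> set J" and less: "x < y"
  shows "e x J \<bullet> e y J \<bullet> e x J = e y J \<bullet> e x J" and "e y J \<bullet> e x J \<bullet> e y J = e y J \<bullet> e x J"
proof -
  note n = incD[OF J(1) J(2)] incD[OF J(1) J(3)]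
  note ty = ty_e[OF J(1) J(2)] ty_e[OF J(1) J(3)]
  have "e x J \<bullet> e y J \<bullet> e x J = act x J \<bullet> W [x] (e y J \<bullet> e x J) [] \<bullet> W [] (eta x) J"
    using eta_act[OF n(1) ty_comp[OF ty(2,1)]] by (simp add: e_def[of x J, THEN tail] assoc)
  also have "\<dots> = e y J \<bullet> act x J \<bullet> W [] (eta x) J"
    using e_act[OF assms, THEN tail] by (simp add: assoc)
  finally show "e x J \<bullet> e y J \<bullet> e x J = e y J \<bullet> e x J"
    by (simp add: e_def[of x])
  have "e y J \<bullet> e x J \<bullet> e y J = (e y J \<bullet> e x J \<bullet> act y J) \<bullet> W [] (eta y) J"
    by (simp add: e_def[of y] assoc)
  also have "\<dots> = act y J \<bullet> W [y] (e x J) [] \<bullet> W [] (eta y) J"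
    using act_e[OF assms, symmetric] by (simp add: assoc)
  also have "\<dots> = e y J \<bullet> e x J"
    using eta_act[OF n(2) ty(1)] by (simp add: e_def[of y] assoc)
  finally show "e y J \<bullet> e x J \<bullet> e y J = e y J \<bullet> e x J" .
qed

section \<open>The product idempotent\<close>

definition ep :: "nat list \<Rightarrow> nat list \<Rightarrow> 'a" where
  "ep J us = foldr (\<lambda>x f. e x J \<bullet> f) us (Id J)"

lemma ep_simps [simp]: "ep J [] = Id J" "ep J (x # us) = e x J \<bullet> ep J us"
  by (simp_all add: ep_def)

lemma ty_ep: "inc J \<Longrightarrow> set us \<subseteq> set J \<Longrightarrow> ty (ep J us) J J"
  by (induction us) (simp_all add: ty_Id inc_set ty_comp[OF ty_e])

definition P :: "nat list \<Rightarrow> 'a" where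
  "P J = ep J (rev J)"

lemma ty_P: "inc J \<Longrightarrow> ty (P J) J J"
  by (simp add: P_def ty_ep)

text \<open>The recursion stops at \<open>z\<close>, so whatever stands to the right of
  \<open>z\<close> is only whiskered.\<close>

lemma act_snoc: "z \<in> set J \<Longrightarrow> act z (J @ [k]) = W [] (act z J) [k]"
  by (induction J) (auto simp: normal)

lemma e_snoc: "z \<in> set J \<Longrightarrow> e z (J @ [k]) = W [] (e z J) [k]"
  by (simp add: e_def act_snoc normal)

lemma ep_snoc: "set us \<subseteq> set J \<Longrightarrow> ep (J @ [k]) us = W [] (ep J us) [k]"
  by (induction us) (simp_all add: normal W_Id e_snoc)

text \<open>The shape of the recursion of \<open>lbar_r\<close>, which takes off the largest letter;
  this is why the product in \<open>P\<close> is decreasing.\<close>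

lemma P_snoc: "P (J @ [k]) = e k (J @ [k]) \<bullet> W [] (P J) [k]"
  by (simp add: P_def ep_snoc)

text \<open>Since \<open>e k J\<close> absorbs a second copy of itself behind any
  \<open>e z J\<close> with \<open>z < k\<close>, such a copy may be created in front of the
  remaining product. The induction hypothesis then removes the last factor, after which the
  auxiliary copy is absorbed again.\<close>

lemma e_ep_e:
  assumes "inc J" "k \<in> set J" "set us \<subseteq> set J" "\<forall>z\<in>set us. z < k"
  shows "e k J \<bullet> ep J us \<bullet> e k J = e k J \<bullet> ep J us"
  using assms(3,4)
proof (induction us)
  case Nil
  then show ?case
    using Id_left[OF ty_e[OF assms(1,2)]] Id_right[OF ty_e[OF assms(1,2)]] e_idem[OF assms(1,2)] by simp
next
  case (Cons z us)
  then have z: "z \<in> set J" "z < k" by auto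
  note k = e_e_less(2)[OF assms(1) z(1) assms(2) z(2), THEN tail]
  have "e k J \<bullet> e z J \<bullet> ep J us \<bullet> e k J = e k J \<bullet> e z J \<bullet> e k J \<bullet> ep J us \<bullet> e k J"
    using k[of "ep J us \<bullet> e k J"] by (simp add: assoc)
  also have "\<dots> = e k J \<bullet> e z J \<bullet> e k J \<bullet> ep J us"
    using Cons by simp
  also have "\<dots> = e k J \<bullet> e z J \<bullet> ep J us"
    using k by (simp add: assoc)
  finally show ?case by (simp add: assoc)
qed

text \<open>The relations \<open>e_e_less\<close> and \<open>e_idem\<close> are those of the Kiselman semigroup, whose zero is the
  product of all generators in decreasing order.\<close>

lemma P_absorb:
  "inc J \<Longrightarrow> z \<in> set J \<Longrightarrow> P J \<bullet> e z J = P J \<and> e z J \<bullet> P J = P J"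
proof (induction J rule: rev_induct)
  case (snoc k J)
  then have J: "inc J" and k: "k \<in> set (J @ [k])" "\<forall>z\<in>set J. z < k" by (auto simp: inc_append)
  have Pk: "W [] (P J) [k] = ep (J @ [k]) (rev J)"
    by (simp add: P_def ep_snoc)
  show ?case
  proof (cases "z \<in> set J")
    case True
    note IH = snoc.IH[OF J True]
    have "P (J @ [k]) \<bullet> e z (J @ [k]) = P (J @ [k])"
      using whisker[OF IH[THEN conjunct1], of "[]" "[k]"] True by (simp add: P_snoc e_snoc normal)
    \<comment> \<open>The induction hypothesis lets a factor \<open>e z\<close> be split off from
      the whiskered \<open>P J\<close>, so that \<open>e z\<close> before \<open>e k\<close> meets a
      second \<open>e z\<close> behind it and the first relation of \<open>e_e_less\<close>
      applies.\<close>
    moreover have "e z (J @ [k]) \<bullet> W [] (P J) [k] = W [] (P J) [k]"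
      using whisker[OF IH[THEN conjunct2], of "[]" "[k]"] True by (simp add: e_snoc normal)
    then have "e z (J @ [k]) \<bullet> P (J @ [k]) = P (J @ [k])"
      using e_e_less(1)[OF snoc.prems(1) snoc.prems(2) k(1), THEN tail, of "W [] (P J) [k]"] True k(2)
      by (simp add: P_snoc assoc)
    ultimately show ?thesis by simp
  next
    case False
    then have "z = k" using snoc.prems by simp
    have "P (J @ [k]) \<bullet> e k (J @ [k]) = P (J @ [k])"
      using e_ep_e[OF snoc.prems(1) k(1), of "rev J"] k(2) by (auto simp: P_snoc Pk assoc)
    moreover have "e k (J @ [k]) \<bullet> P (J @ [k]) = P (J @ [k])"
      using e_idem[OF snoc.prems(1) k(1), THEN tail] by (simp add: P_snoc assoc)
    ultimately show ?thesis using \<open>z = k\<close> by simp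
  qed
qed simp

lemma P_e: "inc J \<Longrightarrow> z \<in> set J \<Longrightarrow> P J \<bullet> e z J = P J"
  and e_P: "inc J \<Longrightarrow> z \<in> set J \<Longrightarrow> e z J \<bullet> P J = P J"
  using P_absorb by blast+

lemma ep_absorb:
  assumes "ty f J b" "\<And>z. z \<in> set us \<Longrightarrow> f \<bullet> e z J = f"
  shows "f \<bullet> ep J us = f"
  using assms(2) by (induction us) (simp_all add: Id_right[OF assms(1)] assoc[symmetric])

lemma P_idem: "inc J \<Longrightarrow> P J \<bullet> P J = P J"
  using ep_absorb[OF ty_P P_e, of J "rev J"] by (simp add: P_def[of J])

lemma e_first: "inc (i # I) \<Longrightarrow> e i (i # I) = Id (i # I)"
  using whisker[OF mu_eta_left[of i], of "[]" I] by (simp add: e_def inc_Cons normal W_Id)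

text \<open>The first letter acts without crossing anything, so its own idempotent is an identity
  and the extra factor in \<open>e_act\<close> disappears.\<close>

lemma e_act_first:
  assumes "inc (i # I)" "y \<in> set (i # I)"
  shows "e y (i # I) \<bullet> act i (i # I) = act i (i # I) \<bullet> W [i] (e y (i # I)) []"
proof (cases "y = i")
  case True
  then show ?thesis
    using Id_left[OF ty_act[OF assms(1), of i]] Id_right[OF ty_act[OF assms(1), of i]]
    by (simp add: e_first[OF assms(1)] W_Id)
next
  case False
  then have "i < y" using assms by (auto simp: inc_Cons)
  then show ?thesis
    using e_act[OF assms(1) _ assms(2), of i] Id_right[OF ty_e[OF assms]] e_first[OF assms(1)] by simp
qed

lemma P_act_first:
  assumes "inc (i # I)"
  shows "P (i # I) \<bullet> act i (i # I) = act i (i # I) \<bullet> W [i] (P (i # I)) []"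
proof -
  let ?J = "i # I"
  have "ep ?J us \<bullet> act i ?J = act i ?J \<bullet> W [i] (ep ?J us) []" if "set us \<subseteq> set ?J" for us
    using that
  proof (induction us)
    case Nil
    then show ?case
      using Id_left[OF ty_act[OF assms, of i]] Id_right[OF ty_act[OF assms, of i]] by (simp add: W_Id)
  next
    case (Cons y us)
    then have "ep ?J (y # us) \<bullet> act i ?J = e y ?J \<bullet> act i ?J \<bullet> W [i] (ep ?J us) []"
      by (simp only: ep_simps assoc set_simps insert_subset)
    also have "\<dots> = act i ?J \<bullet> W [i] (ep ?J (y # us)) []"
      using e_act_first[OF assms, of y, THEN tail] Cons.prems by (simp add: normal del: act.simps)
    finally show ?case .
  qed
  then show ?thesis by (simp add: P_def del: act.simps)
qed

text \<open>The left side is the idempotent \<open>wbar\<close> of the law, the right side is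
  \<open>e y [x,y]\<close>. Expanding \<open>lam x y\<close> on the unit of \<open>x\<close> by
  \<open>lam_eta_right\<close> yields an expression with both units, and \<open>lam_eta_left\<close>
  contracts it to the other form.\<close>

lemma lambda_bar_left_right:
  assumes "x < y" "y \<le> n"
  shows "W [] (mu x) [y] \<bullet> W [x] (lam x y) [] \<bullet> W [x,y] (eta x) [] =
    W [x] (mu y) [] \<bullet> W [] (lam x y) [y] \<bullet> W [] (eta y) [x,y]"
proof -
  have x: "x \<le> n" using assms by simp
  have "W [] (mu x) [y] \<bullet> W [x] (lam x y) [] \<bullet> W [x,y] (eta x) [] =
    W [] (mu x) [y] \<bullet> W [x,x] (mu y) [] \<bullet> W [x] (lam x y) [y] \<bullet> W [x] (eta y) [x,y] \<bullet> W [x] (eta x) [y]"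
    using whisker[OF lam_eta_right[OF assms], of "[x]" "[]"] by (simp add: normal)
  also have "\<dots> = W [x] (mu y) [] \<bullet> W [] (mu x) [y,y] \<bullet> W [x] (lam x y) [y] \<bullet> W [x] (eta y) [x,y] \<bullet> W [x] (eta x) [y]"
    using interchange[OF ty_mu[OF x] ty_mu[OF assms(2)], of "[]" "[]" "[]", THEN tail] by (simp add: normal)
  also have "\<dots> = W [x] (mu y) [] \<bullet> W [] (mu x) [y,y] \<bullet> W [x] (lam x y) [y] \<bullet> W [x,y] (eta x) [y] \<bullet> W [x] (eta y) [y]"
    using interchange[OF ty_eta[OF assms(2)] ty_eta[OF x], of "[x]" "[]" "[y]"] by simp
  also have "\<dots> = W [x] (mu y) [] \<bullet> W [] (lam x y) [y] \<bullet> W [] (eta y) [x,y]"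
    using whisker[OF lam_eta_left[OF assms], of "[]" "[y]"] by (simp add: normal)
  finally show ?thesis .
qed

text \<open>\<open>P (i # I)\<close> absorbs \<open>e x (i # I)\<close>, and this idempotent in turn
  absorbs the whiskered \<open>e x I\<close>. It is enough to treat one letter of \<open>I\<close>
  at a time.\<close>

lemma P_first:
  assumes "inc (i # I)"
  shows "P (i # I) \<bullet> W [i] (P I) [] = P (i # I)"
proof -
  let ?J = "i # I"
  have I: "inc I" "i \<le> n" using assms by (auto simp: inc_Cons)
  have step: "P ?J \<bullet> W [i] (e x I) [] = P ?J" if x: "x \<in> set I" for x
  proof -
    have xJ: "x \<in> set ?J" "i < x" "x \<le> n" "x \<noteq> i" using x assms by (auto simp: inc_Cons incD)
    note lbar = lambda_bar_left_right[OF xJ(2,3)]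
    have ty: "ty (W [i] (act x I) []) (i # x # I) ?J"
      using ty_W[OF ty_act[OF I(1) x], of "[i]" "[]"] I by simp
    have "e x ?J \<bullet> W [i] (act x I) [] =
       W [i] (act x I) [] \<bullet> W [] (lam i x) I \<bullet> W [x,i] (act x I) [] \<bullet> W [] (eta x) (i # x # I)"
      using eta_act[OF xJ(3) ty] xJ by (simp add: e_def normal)
    also have "\<dots> = W [i] (act x I) [] \<bullet> W [i,x] (act x I) [] \<bullet> W [] (lam i x) (x # I) \<bullet> W [] (eta x) (i # x # I)"
      using interchange[OF ty_lam[OF xJ(2,3)] ty_act[OF I(1) x], of "[]" "[]" "[]", THEN tail]
      by (simp add: normal)
    also have "\<dots> = W [i] (act x I) [] \<bullet> W [i] (mu x) I \<bullet> W [] (lam i x) (x # I) \<bullet> W [] (eta x) (i # x # I)"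
      using whisker_tail[OF act_mu[OF I(1) x], of "[i]" "[]"] by (simp add: normal)
    \<comment> \<open>Replacing the unit of \<open>x\<close> by a unit of \<open>i\<close> produces
      the right side of \<open>lam_eta_left\<close>, once the unit of \<open>x\<close> coming from
      \<open>e x I\<close> is attached.\<close>
    also have "\<dots> = W [i] (act x I) [] \<bullet> W [] (mu i) (x # I) \<bullet> W [i] (lam i x) I \<bullet> W [i,x] (eta i) I"
      using whisker[OF lbar, of "[]" I] by (simp add: normal)
    finally have bar: "e x ?J \<bullet> W [i] (act x I) [] = \<dots>" .
    have "P ?J \<bullet> W [i] (e x I) [] = P ?J \<bullet> e x ?J \<bullet> W [i] (act x I) [] \<bullet> W [i] (eta x) I"
      using P_e[OF assms xJ(1), THEN tail] by (simp add: e_def[of x I] normal)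
    also have "\<dots> = P ?J \<bullet> W [i] (act x I) [] \<bullet> W [] (mu i) (x # I) \<bullet> W [i] (lam i x) I \<bullet> W [i,x] (eta i) I \<bullet> W [i] (eta x) I"
      using bar[THEN tail] by (simp add: assoc)
    also have "\<dots> = P ?J \<bullet> e x ?J"
      using whisker[OF lam_eta_left[OF xJ(2,3)], of "[]" I] xJ by (simp add: e_def normal)
    finally show ?thesis using P_e[OF assms xJ(1)] by simp
  qed
  have "P ?J \<bullet> W [i] (ep I us) [] = P ?J" if "set us \<subseteq> set I" for us
    using that
  proof (induction us)
    case Nil
    then show ?case using Id_right[OF ty_P[OF assms]] by (simp add: W_Id)
  next
    case (Cons y us)
    then show ?case using step[of y, THEN tail] by (simp add: normal)
  qed
  then show ?thesis by (simp add: P_def[of I])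
qed

section \<open>Iterated actions and the multiplication of the product monad\<close>

primrec Act :: "nat list \<Rightarrow> nat list \<Rightarrow> 'a" where
  "Act J [] = Id J"
| "Act J (x # w) = act x J \<bullet> W [x] (Act J w) []"

lemma ty_Act: "inc J \<Longrightarrow> set w \<subseteq> set J \<Longrightarrow> ty (Act J w) (w @ J) J"
proof (induction w)
  case Nil
  then show ?case by (simp add: ty_Id inc_set)
next
  case (Cons x w)
  then show ?case by (auto intro!: ty_compI[OF ty_act ty_WI] incD)
qed

text \<open>A letter crossing a smaller one inside \<open>T\<close> corresponds to
  \<open>act_comm\<close> on \<open>J\<close>, and multiplication with its own copy to
  \<open>act_mu\<close>. Thus the iterated action is linear over every letter of
  \<open>T\<close>.\<close>

lemma Act_act:
  assumes J: "inc J"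
  shows "inc T \<Longrightarrow> set T \<subseteq> set J \<Longrightarrow> x \<in> set T \<Longrightarrow>
    Act J T \<bullet> W [] (act x T) J = act x J \<bullet> W [x] (Act J T) []"
proof (induction T)
  case (Cons y T)
  then have y: "y \<in> set J" "set T \<subseteq> set J" "x \<in> set J" "y \<le> n" "inc T" by (auto simp: inc_Cons)
  note ty = ty_Act[OF J y(2)]
  show ?case
  proof (cases "x = y")
    case True
    have "Act J (y # T) \<bullet> W [] (act x (y # T)) J = act x J \<bullet> W [] (mu x) J \<bullet> W [x,x] (Act J T) []"
      using interchange[OF ty_mu[OF y(4)] ty, of "[]" "[]" "[]"] True by (simp add: normal)
    also have "\<dots> = act x J \<bullet> W [x] (act x J) [] \<bullet> W [x,x] (Act J T) []"
      using act_mu[OF J y(3), THEN tail] by (simp add: normal)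
    finally show ?thesis using True by (simp add: normal)
  next
    case False
    then have x: "x \<in> set T" "y < x" "x \<le> n" using Cons.prems y by (auto simp: inc_Cons incD)
    have "Act J (y # T) \<bullet> W [] (act x (y # T)) J =
        act y J \<bullet> W [y] (Act J T) [] \<bullet> W [y] (act x T) J \<bullet> W [] (lam y x) (T @ J)"
      using False by (simp add: normal)
    also have "\<dots> = act y J \<bullet> W [y] (act x J) [] \<bullet> W [y,x] (Act J T) [] \<bullet> W [] (lam y x) (T @ J)"
      using whisker_tail[OF Cons.IH[OF y(5,2) x(1)], of "[y]" "[]"] by (simp add: normal)
    also have "\<dots> = act y J \<bullet> W [y] (act x J) [] \<bullet> W [] (lam y x) J \<bullet> W [x,y] (Act J T) []"
      using interchange[OF ty_lam[OF x(2,3)] ty, of "[]" "[]" "[]"] by simp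
    also have "\<dots> = act x J \<bullet> W [x] (act y J) [] \<bullet> W [x,y] (Act J T) []"
      using act_comm[OF J y(1,3) x(2), THEN tail] by (simp add: normal)
    finally show ?thesis by (simp add: normal)
  qed
qed simp

lemma Act_e:
  assumes J: "inc J" and x: "x \<in> set J"
  shows "Act J J \<bullet> W [] (e x J) J = e x J \<bullet> Act J J"
  using Act_act[OF J J _ x, THEN tail, of "W [] (eta x) (J @ J)"]
    eta_act[OF incD[OF J x] ty_Act[OF J order_refl]]
  by (simp add: e_def normal)

text \<open>Linearity moves the idempotents \<open>e x J\<close> one by one out of the left factor
  of a product; this removes the \<open>P J\<close> contained in the left inclusion of
  \<open>mult_first_rest\<close> and \<open>mult_swap\<close>.\<close>

lemma Act_P:
  assumes J: "inc J"
  shows "Act J J \<bullet> W [] (P J) J = P J \<bullet> Act J J"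
proof -
  have "Act J J \<bullet> W [] (ep J us) J = ep J us \<bullet> Act J J" if "set us \<subseteq> set J" for us
    using that
  proof (induction us)
    case Nil
    then show ?case using Id_left[OF ty_Act[OF J]] Id_right[OF ty_Act[OF J]] by (simp add: W_Id)
  next
    case (Cons x us)
    then show ?case using Act_e[OF J, of x, THEN tail] by (simp add: normal)
  qed
  then show ?thesis by (simp add: P_def)
qed

text \<open>The units are created in increasing order at once, unlike in \<open>unit_raw\<close>, so
  no \<lambda> occurs.\<close>

primrec Eta :: "nat list \<Rightarrow> 'a" where
  "Eta [] = Id []"
| "Eta (x # I) = W [x] (Eta I) [] \<bullet> W [] (eta x) []"

lemma ty_Eta: "set I \<subseteq> {..n} \<Longrightarrow> ty (Eta I) [] I"
proof (induction I)
  case (Cons x I)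
  then show ?case by (auto intro!: ty_compI[OF ty_WI ty_WI] ty_eta)
qed (simp add: ty_Id)

lemma Eta_snoc: "set I \<subseteq> {..n} \<Longrightarrow> k \<le> n \<Longrightarrow> Eta (I @ [k]) = W I (eta k) [] \<bullet> Eta I"
proof (induction I)
  case Nil
  then show ?case
    using Id_right[OF ty_eta] Id_left[OF ty_eta] W_Nil[OF ty_eta] by (simp add: W_Id)
qed (simp add: normal)

text \<open>A unit of \<open>x\<close> consumed by the action of \<open>x\<close> gives
  \<open>e x J\<close>, and \<open>b\<close> is fixed by all of these. The induction peels the units
  off from the left.\<close>

lemma Act_Eta:
  assumes J: "inc J" and b: "ty b c J" "\<And>x. x \<in> set J \<Longrightarrow> e x J \<bullet> b = b"
  shows "set I \<subseteq> set J \<Longrightarrow> Act J I \<bullet> W [] (Eta I) J \<bullet> b = b"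
proof (induction I)
  case Nil
  then show ?case using Id_left[OF b(1)] by (simp add: W_Id)
next
  case (Cons x I)
  then have x: "x \<in> set J" "x \<le> n" "set I \<subseteq> set J" "set I \<subseteq> {..n}"
    using incD[OF J] by auto
  have "ty (Act J I \<bullet> W [] (Eta I) J) J J"
    by (rule ty_compI[OF ty_Act[OF J x(3)] ty_WI[OF ty_Eta[OF x(4)]]]) (auto simp: inc_set[OF J])
  from eta_act[OF x(2) this, THEN tail, of b]
  have "Act J (x # I) \<bullet> W [] (Eta (x # I)) J \<bullet> b =
     act x J \<bullet> W [] (eta x) J \<bullet> Act J I \<bullet> W [] (Eta I) J \<bullet> b"
    by (simp add: normal)
  also have "\<dots> = e x J \<bullet> b" using Cons.IH[OF x(3)] by (simp add: e_def normal)
  finally show ?case using b(2)[OF x(1)] by simp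
qed

text \<open>\<open>P J \<bullet> Act J J\<close> is the multiplication of the product monad, applied here to the inclusions of
  its first factor and of the product of the others.\<close>

lemma mult_first_rest:
  assumes "inc (i # I)"
  defines "J \<equiv> i # I"
  shows "(P J \<bullet> Act J J) \<bullet> W [] (P J \<bullet> W [i] (Eta I) []) J \<bullet> W [i] (P J \<bullet> W [] (eta i) I) [] = P J"
proof -
  have J: "inc J" and i: "i \<le> n" and I: "set I \<subseteq> {..n}" "set I \<subseteq> set J"
    using assms by (auto simp: inc_Cons inc_set)
  let ?b = "P J \<bullet> W [] (eta i) I"
  have ty_b: "ty ?b I J"
    by (rule ty_compI[OF ty_P[OF J] ty_WI[OF ty_eta[OF i]]]) (use I J_def in auto)
  have b: "e x J \<bullet> ?b = ?b" if "x \<in> set J" for x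
    using e_P[OF J that, THEN tail] by (simp add: assoc)
  have "(P J \<bullet> Act J J) \<bullet> W [] (P J \<bullet> W [i] (Eta I) []) J \<bullet> W [i] ?b [] =
     P J \<bullet> P J \<bullet> Act J J \<bullet> W [i] (Eta I) J \<bullet> W [i] ?b []"
    using Act_P[OF J, THEN tail] by (simp add: normal)
  also have "\<dots> = P J \<bullet> Act J J \<bullet> W [i] (Eta I) J \<bullet> W [i] ?b []"
    using P_idem[OF J, THEN tail] by (simp add: assoc)
  also have "\<dots> = P J \<bullet> act i J \<bullet> W [i] ?b []"
  proof -
    have "Act J J = act i J \<bullet> W [i] (Act J I) []" by (simp add: J_def)
    then show ?thesis using whisker[OF Act_Eta[OF J ty_b b I(2)], of "[i]" "[]"] by (simp add: normal)
  qed
  \<comment> \<open>Since \<open>i\<close> is the first letter, the \<open>P J\<close> inside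
    \<open>?b\<close> can be moved out through the action of \<open>i\<close>; what remains is the
    right unit law of \<open>mu i\<close>.\<close>
  also have "\<dots> = P J \<bullet> P J \<bullet> act i J \<bullet> W [i] (eta i) I"
    using P_act_first[OF assms(1), THEN tail] by (simp add: normal J_def del: act.simps)
  also have "\<dots> = P J \<bullet> act i J \<bullet> W [i] (eta i) I"
    using P_idem[OF J, THEN tail] by (simp add: assoc)
  also have "\<dots> = P J \<bullet> Id J"
    using whisker[OF mu_eta_right[OF i], of "[]" I] by (simp add: J_def normal W_Id)
  finally show ?thesis using Id_right[OF ty_P[OF J]] by simp
qed

lemma P_pair:
  assumes "x < y" "y \<le> n"
  shows "P [x,y] = e y [x,y]"
proof -
  have J: "inc [x,y]" using assms by (simp add: inc_def)
  show ?thesis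
    using Id_right[OF ty_e[OF J, of y]] Id_left[OF ty_Id[OF inc_set[OF J]]]
    by (simp add: P_def e_first[OF J])
qed

text \<open>The unit of \<open>y\<close> in the idempotent moves to the front of
  \<open>lam x y\<close>; \<open>lam_mu_left\<close> merges the two crossings of \<open>y\<close>,
  and the left unit law cancels the product.\<close>

lemma P_lam:
  assumes "x < y" "y \<le> n"
  shows "P [x,y] \<bullet> lam x y = lam x y"
proof -
  have "P [x,y] \<bullet> lam x y = W [x] (mu y) [] \<bullet> W [] (lam x y) [y] \<bullet> W [] (eta y) [x,y] \<bullet> lam x y"
    using assms whisker[OF Id_left[OF ty_mu[OF assms(2)]]] by (simp add: P_pair e_def normal)
  also have "\<dots> = W [x] (mu y) [] \<bullet> W [] (lam x y) [y] \<bullet> W [y] (lam x y) [] \<bullet> W [] (eta y) [y,x]"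
    using eta_act[OF assms(2) ty_lam[OF assms]] by simp
  also have "\<dots> = lam x y \<bullet> W [] (mu y) [x] \<bullet> W [] (eta y) [y,x]"
    using lam_mu_left[OF assms, THEN tail] by (simp add: normal)
  also have "\<dots> = lam x y \<bullet> Id [y,x]"
    using whisker[OF mu_eta_left[OF assms(2)], of "[]" "[x]"] by (simp add: normal W_Id)
  finally show ?thesis using Id_right[OF ty_lam[OF assms]] by simp
qed

text \<open>The unit of \<open>x\<close> in the left inclusion becomes \<open>e x J\<close> and is
  absorbed by \<open>P J\<close>. The letter \<open>y\<close> has to cross the \<open>x\<close> of
  the right inclusion, which is \<open>lam x y\<close>, and is then multiplied with the unit of
  \<open>y\<close>. The remaining \<open>P J\<close> is absorbed by \<open>P_lam\<close>.\<close>

lemma mult_swap: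
  assumes "x < y" "y \<le> n"
  defines "J \<equiv> [x,y]"
  shows "(P J \<bullet> Act J J) \<bullet> W [] (P J \<bullet> W [] (eta x) [y]) J \<bullet> W [y] (P J \<bullet> W [x] (eta y) []) [] = lam x y"
proof -
  have J: "inc J" "x \<in> set J" "y \<in> set J" using assms by (auto simp: inc_def)
  have x: "x \<le> n" using assms by simp
  have PJ: "P J = e y J" using P_pair assms by simp
  have tyy: "ty (act y J) (y # J) J" by (rule ty_act[OF J(1,3)])
  let ?b = "P J \<bullet> W [x] (eta y) []"
  have Act: "Act J J = act x J \<bullet> W [x] (act y J) []"
    using Id_right[OF tyy] by (simp add: J_def W_Id normal[symmetric])
  have "(P J \<bullet> Act J J) \<bullet> W [] (P J \<bullet> W [] (eta x) [y]) J \<bullet> W [y] ?b [] =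
     P J \<bullet> P J \<bullet> Act J J \<bullet> W [] (eta x) (y # J) \<bullet> W [y] ?b []"
    using Act_P[OF J(1), THEN tail] by (simp add: normal)
  also have "\<dots> = P J \<bullet> act x J \<bullet> W [x] (act y J) [] \<bullet> W [] (eta x) (y # J) \<bullet> W [y] ?b []"
    using P_idem[OF J(1), THEN tail] by (simp add: Act assoc)
  also have "\<dots> = P J \<bullet> e x J \<bullet> act y J \<bullet> W [y] ?b []"
    using eta_act[OF x tyy, THEN tail] by (simp add: e_def assoc)
  also have "\<dots> = P J \<bullet> act y J \<bullet> W [y] (e y J) [] \<bullet> W [y,x] (eta y) []"
    using P_e[OF J(1,2), THEN tail] by (simp add: PJ normal)
  also have "\<dots> = P J \<bullet> act y J \<bullet> W [y,x] (eta y) []"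
    using act_e_self[OF J(1,3), THEN tail] by (simp add: assoc)
  also have "\<dots> = P J \<bullet> W [x] (mu y) [] \<bullet> W [] (lam x y) [y] \<bullet> W [y,x] (eta y) []"
    using assms by (simp add: normal)
  also have "\<dots> = P J \<bullet> W [x] (mu y) [] \<bullet> W [x,y] (eta y) [] \<bullet> lam x y"
    using interchange[OF ty_lam[OF assms(1,2)] ty_eta[OF assms(2)], of "[]" "[]" "[]"]
      W_Nil[OF ty_lam[OF assms(1,2)]] by simp
  also have "\<dots> = P J \<bullet> Id [x,y] \<bullet> lam x y"
    using whisker_tail[OF mu_eta_right[OF assms(2)], of "[x]" "[]"] by (simp add: normal W_Id)
  also have "\<dots> = lam x y"
    using Id_left[OF ty_lam[OF assms(1,2)]] P_lam[OF assms(1,2)] by (simp add: J_def)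
  finally show ?thesis .
qed

section \<open>Insertion sort and the iterated action\<close>

primrec ins :: "nat \<Rightarrow> nat list \<Rightarrow> 'a" where
  "ins x [] = Id [x]"
| "ins x (y # w) = (if x \<le> y then Id (x # y # w) else W [y] (ins x w) [] \<bullet> W [] (lam y x) w)"

primrec srt :: "nat list \<Rightarrow> 'a" where
  "srt [] = Id []"
| "srt (x # w) = ins x (sort w) \<bullet> W [x] (srt w) []"

primrec Mu :: "nat list \<Rightarrow> 'a" where
  "Mu [] = Id []"
| "Mu (x # T) = W [] (mu x) T \<bullet> W [x,x] (Mu T) []"

abbreviation dup :: "nat list \<Rightarrow> nat list" where
  "dup T \<equiv> concat (map (\<lambda>x. [x,x]) T)"

lemma ty_Mu: "set T \<subseteq> {..n} \<Longrightarrow> ty (Mu T) (dup T) T"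
proof (induction T)
  case (Cons x T)
  then show ?case by (auto intro!: ty_compI[OF ty_WI ty_WI] ty_mu)
qed (simp add: ty_Id)

text \<open>Insertion stops in front of an equal letter. Hence the new \<open>x\<close> lands beside
  the old one, where \<open>Mu\<close> multiplies them exactly as \<open>act\<close> does; the
  multiplications in \<open>T\<close> take place further right and slide past the crossings.\<close>

lemma Mu_ins:
  "inc (Q @ x # T) \<Longrightarrow>
   W Q (Mu (x # T)) [] \<bullet> ins x (Q @ x # dup T) = act x (Q @ x # T) \<bullet> W (x # Q @ [x]) (Mu T) []"
proof (induction Q)
  case Nil
  then have "set T \<subseteq> {..n}" "x \<le> n" by (auto simp: inc_set inc_Cons)
  then have "ty (Mu (x # T)) (x # x # dup T) (x # T)" using ty_Mu[of "x # T"] by simp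
  from W_Nil[OF this] Id_right[OF this] show ?case by simp
next
  case (Cons y Q)
  then have y: "inc (Q @ x # T)" "y < x" "x \<le> n" "set T \<subseteq> {..n}"
    by (auto simp: inc_append inc_Cons inc_set)
  have "W (y # Q) (Mu (x # T)) [] \<bullet> ins x ((y # Q) @ x # dup T) =
    W [y] (W Q (Mu (x # T)) [] \<bullet> ins x (Q @ x # dup T)) [] \<bullet> W [] (lam y x) (Q @ x # dup T)"
    using y by (simp add: normal)
  also have "\<dots> = W [y] (act x (Q @ x # T)) [] \<bullet> W (y # x # Q @ [x]) (Mu T) [] \<bullet> W [] (lam y x) (Q @ x # dup T)"
    by (simp only: Cons.IH[OF y(1)]) (simp add: normal)
  also have "\<dots> = W [y] (act x (Q @ x # T)) [] \<bullet> W [] (lam y x) (Q @ x # T) \<bullet> W (x # y # Q @ [x]) (Mu T) []"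
    using interchange[OF ty_lam[OF y(2,3)] ty_Mu[OF y(4)], of "[]" "Q @ [x]" "[]"] by simp
  finally show ?case using y by (simp add: assoc)
qed

lemma ins_act: "inc (Q @ [k]) \<Longrightarrow> W Q (mu k) [] \<bullet> ins k (Q @ [k]) = act k (Q @ [k])"
proof -
  assume Q: "inc (Q @ [k])"
  then have k: "k \<le> n" by (simp add: inc_append inc_Cons)
  have "mu k \<bullet> Id [k,k] = mu k" "W [] (mu k) [] = mu k" using W_Nil[OF ty_mu[OF k]] Id_right[OF ty_mu[OF k]] by auto
  then show ?thesis
    using Mu_ins[OF Q] Id_right[OF ty_act[OF Q, of k]] by (simp add: W_Id)
qed

lemma sort_dup: "inc (Q @ T) \<Longrightarrow> sort (T @ Q @ T) = Q @ dup T"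
proof (induction T arbitrary: Q)
  case Nil
  then show ?case by (simp add: inc_def strict_sorted_imp_sorted sorted_sort_id)
next
  case (Cons x T)
  have "insort x (Q @ x # R) = Q @ x # x # R" for R
    using Cons.prems by (induction Q) (auto simp: inc_append inc_Cons)
  then show ?case using Cons.IH[of "Q @ [x]"] Cons.prems by simp
qed

lemma srt_inc: "inc J \<Longrightarrow> srt J = Id J"
proof (induction J)
  case (Cons x J)
  then have J: "sort J = J" "inc J" "inc (x # J)"
    by (auto simp: inc_def strict_sorted_imp_sorted sorted_sort_id)
  have "ins x J = Id (x # J)"
    using J(3) by (cases J) (auto simp: inc_Cons)
  then show ?case
    using Cons.IH J Id_left[OF ty_Id[OF inc_set[OF J(3)]]] by (simp add: W_Id)
qed simp

text \<open>\<open>Q\<close> collects the letters of the second factor that lie before the current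
  one; they are crossed but not multiplied. The case \<open>Q = []\<close> identifies the
  multiplication used in \<open>mult_raw\<close> with the iterated action.\<close>

lemma Mu_srt: "inc (Q @ T) \<Longrightarrow> W Q (Mu T) [] \<bullet> srt (T @ Q @ T) = Act (Q @ T) T"
proof (induction T arbitrary: Q)
  case Nil
  then show ?case
    using Id_left[OF ty_Id[OF inc_set[of Q]]] by (simp add: srt_inc W_Id)
next
  case (Cons x T)
  let ?J = "Q @ x # T"
  have J: "inc ((Q @ [x]) @ T)" "inc ?J" using Cons.prems by simp_all
  have "W Q (Mu (x # T)) [] \<bullet> srt ((x # T) @ Q @ x # T) =
      W Q (Mu (x # T)) [] \<bullet> ins x (Q @ x # dup T) \<bullet> W [x] (srt (T @ Q @ x # T)) []"
    using sort_dup[OF J(1)] by simp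
  also have "\<dots> = act x ?J \<bullet> W [x] (W (Q @ [x]) (Mu T) [] \<bullet> srt (T @ Q @ x # T)) []"
    using Mu_ins[OF J(2), THEN tail] by (simp only: normal) simp
  also have "\<dots> = Act ?J (x # T)"
    using Cons.IH[OF J(1)] by simp
  finally show ?case .
qed

definition incl :: "nat \<Rightarrow> nat list \<Rightarrow> 'a" where
  "incl i I = P (i # I) \<bullet> W [i] (Eta I) []"

lemma ty_incl: "inc (i # I) \<Longrightarrow> ty (incl i I) [i] (i # I)"
  unfolding incl_def
  by (rule ty_compI[OF ty_P ty_WI[OF ty_Eta]]) (auto simp: inc_Cons incD)

lemma incl_Nil: "i \<le> n \<Longrightarrow> incl i [] = Id [i]"
  using e_first[of i "[]"] Id_right[OF ty_Id, of "[i]"] by (simp add: incl_def P_def inc_def W_Id)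

text \<open>The \<open>P (i # I)\<close> of the shorter inclusion slides past the new unit and is
  absorbed by the longer \<open>P\<close>, which contains it as its right factor by
  \<open>P_snoc\<close>. The new factor in parentheses is an edge, so statements about edges pass to
  \<open>incl\<close> by induction.\<close>

lemma incl_snoc:
  assumes "inc (i # I @ [k])"
  shows "incl i (I @ [k]) = (P (i # I @ [k]) \<bullet> W (i # I) (eta k) []) \<bullet> incl i I"
proof -
  let ?J = "i # I"
  have J: "inc ?J" "k \<le> n" "inc (?J @ [k])" "set I \<subseteq> {..n}" using assms by (auto simp: inc_append inc_Cons incD)
  have "(P (?J @ [k]) \<bullet> W ?J (eta k) []) \<bullet> incl i I = P (?J @ [k]) \<bullet> W ?J (eta k) [] \<bullet> P ?J \<bullet> W [i] (Eta I) []"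
    by (simp add: incl_def assoc)
  also have "\<dots> = P (?J @ [k]) \<bullet> W [] (P ?J) [k] \<bullet> W ?J (eta k) [] \<bullet> W [i] (Eta I) []"
    using interchange[OF ty_P[OF J(1)] ty_eta[OF J(2)], of "[]" "[]" "[]", THEN tail] W_Nil[OF ty_P[OF J(1)]]
    by (simp add: assoc)
  also have "\<dots> = P (?J @ [k]) \<bullet> W ?J (eta k) [] \<bullet> W [i] (Eta I) []"
    using whisker_tail[OF P_idem[OF J(1)], of "[]" "[k]"] P_snoc[of ?J k] by (simp add: normal)
  also have "\<dots> = incl i (I @ [k])"
    using Eta_snoc[OF J(4,2)] by (simp add: incl_def normal)
  finally show ?thesis by simp
qed

end

section \<open>Words of 1-cells in a 2-category\<close>

locale wdl_obj = two_cat L for L :: "('o,'a,'b) cat2" +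
  fixes n :: nat and X :: "('o,'a,'b) wdlobj"
  assumes wdln0: "wdln0 L n X"
begin

lemma mnd0_X: "i \<le> n \<Longrightarrow> mnd0 L (mndi X i)"
  and wdl_X: "i < j \<Longrightarrow> j \<le> n \<Longrightarrow> wdl L (mndi X j) (mndi X i) (wlam X i j)"
  using wdln0 by (simp_all add: wdln0_def)

lemma wA_ob: "wA X \<in> ob L"
  using mnd0_X[of 0] by (simp add: mndi_def)

lemma ws_hom: "i \<le> n \<Longrightarrow> ws X i \<in> hom L"
  and src1_ws: "i \<le> n \<Longrightarrow> src1 L (ws X i) = wA X"
  and tgt1_ws: "i \<le> n \<Longrightarrow> tgt1 L (ws X i) = wA X"
  using mnd0_X[of i] by (simp_all add: mndi_def)

abbreviation valid :: "nat list \<Rightarrow> bool" where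
  "valid w \<equiv> set w \<subseteq> {..n}"

abbreviation pr :: "nat list \<Rightarrow> 'a" where
  "pr w \<equiv> prodw L X w"

lemma pr_hom: "valid w \<Longrightarrow> pr w \<in> hom L \<and> src1 L (pr w) = wA X \<and> tgt1 L (pr w) = wA X"
  by (induction w rule: induct_list012) (simp_all add: cells ws_hom src1_ws tgt1_ws wA_ob)

lemmas pr_cells = pr_hom[THEN conjunct1] pr_hom[THEN conjunct2, THEN conjunct1]
  pr_hom[THEN conjunct2, THEN conjunct2]

lemma pr_Cons: "valid (i # w) \<Longrightarrow> pr (i # w) = cmp1 L (ws X i) (pr w)"
  by (cases w) (simp_all add: cmp1_i1_right ws_hom src1_ws)

lemma pr_append: "valid v \<Longrightarrow> valid w \<Longrightarrow> pr (v @ w) = cmp1 L (pr v) (pr w)"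
proof (induction v)
  case Nil
  then show ?case by (simp add: cmp1_i1_left pr_cells)
next
  case (Cons i v)
  then show ?case
    by (simp add: pr_Cons del: prodw.simps) (simp add: cmp1_assoc ws_hom src1_ws tgt1_ws pr_cells)
qed

definition ok :: "nat list \<Rightarrow> 'b \<Rightarrow> nat list \<Rightarrow> bool" where
  "ok a f b \<longleftrightarrow> valid a \<and> valid b \<and> f \<in> cell L \<and> src2 L f = pr a \<and> tgt2 L f = pr b"

text \<open>Adding \<open>None\<close> as a zero makes vertical composition and whiskering total, so that all their
  laws except the unit laws hold without typing hypotheses.\<close>

type_synonym 'c arrow = "(nat list \<times> 'c \<times> nat list) option"

definition ty :: "'b arrow \<Rightarrow> nat list \<Rightarrow> nat list \<Rightarrow> bool" where
  "ty F a b \<longleftrightarrow> (\<exists>f. F = Some (a, f, b) \<and> ok a f b)"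

fun comp :: "'b arrow \<Rightarrow> 'b arrow \<Rightarrow> 'b arrow" (infixr "\<bullet>" 55) where
  "Some (b, f, c) \<bullet> Some (a, g, b') = (if b = b' \<and> ok b f c \<and> ok a g b' then Some (a, vcmp L f g, c) else None)"
| "_ \<bullet> _ = None"

fun W :: "nat list \<Rightarrow> 'b arrow \<Rightarrow> nat list \<Rightarrow> 'b arrow" where
  "W p (Some (a, f, b)) q = (if ok a f b \<and> valid p \<and> valid q
     then Some (p @ a @ q, hcmp L (i2 L (pr p)) (hcmp L f (i2 L (pr q))), p @ b @ q) else None)"
| "W p None q = None"

definition Id :: "nat list \<Rightarrow> 'b arrow" where
  "Id w = (if valid w then Some (w, i2 L (pr w), w) else None)"

definition ce :: "'b arrow \<Rightarrow> 'b" where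
  "ce F = fst (snd (the F))"

lemmas cells' = cells pr_cells pr_append

lemma ok_vcmp: "ok b f c \<Longrightarrow> ok a g b \<Longrightarrow> ok a (vcmp L f g) c"
  by (simp add: ok_def cells)

lemma ok_hcmp: "ok a f b \<Longrightarrow> ok c g d \<Longrightarrow> ok (a @ c) (hcmp L f g) (b @ d)"
  by (simp add: ok_def cells')

lemma ok_i2: "valid a \<Longrightarrow> ok a (i2 L (pr a)) a"
  by (simp add: ok_def cells')

lemma ok_whisker: "ok a f b \<Longrightarrow> valid p \<Longrightarrow> valid q \<Longrightarrow>
    ok (p @ a @ q) (hcmp L (i2 L (pr p)) (hcmp L f (i2 L (pr q)))) (p @ b @ q)"
  by (intro ok_hcmp ok_i2)

lemma i2_append: "valid v \<Longrightarrow> valid w \<Longrightarrow> i2 L (pr (v @ w)) = hcmp L (i2 L (pr v)) (i2 L (pr w))"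
  by (simp add: cells' hcmp_i2)

lemma i2_idem: "f \<in> hom L \<Longrightarrow> vcmp L (i2 L f) (i2 L f) = i2 L f"
  by (simp add: cells vcmp_i2_left)

sublocale word_calculus n ty comp W Id
proof
  fix F G H :: "'b arrow" and p q r p' q' a b c d :: "nat list"
  show "(F \<bullet> G) \<bullet> H = F \<bullet> (G \<bullet> H)"
    by (cases F; cases G; cases H) (auto simp: ok_vcmp ok_def vcmp_assoc cells)
  show "W p (F \<bullet> G) q = W p F q \<bullet> W p G q"
  proof (cases "\<exists>b f c a g. F = Some (b, f, c) \<and> G = Some (a, g, b) \<and> ok b f c \<and> ok a g b \<and> valid p \<and> valid q")
    case True
    then show ?thesis
      by (auto simp: ok_vcmp ok_whisker)
        (simp add: ok_def exchange[symmetric] cells' i2_idem)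
  next
    case False
    then show ?thesis by (cases F; cases G) (auto split: if_splits)
  qed
  show "W p (W p' F q') q = W (p @ p') F (q' @ q)"
  proof (cases "\<exists>a f b. F = Some (a, f, b) \<and> ok a f b \<and> valid p \<and> valid q \<and> valid p' \<and> valid q'")
    case True
    then show ?thesis
      by (auto simp: ok_whisker i2_append) (simp add: ok_def hcmp_assoc cells')
  next
    case False
    then show ?thesis by (cases F) (auto split: if_splits)
  qed
  show "W p (Id a) q = Id (p @ a @ q)"
    by (auto simp: Id_def ok_i2 i2_append)
  show "ty F a b \<Longrightarrow> W [] F [] = F"
    by (auto simp: ty_def) (simp add: ok_def hcmp_i1_left hcmp_i1_right cells')
  show "ty F b c \<Longrightarrow> ty G a b \<Longrightarrow> ty (F \<bullet> G) a c"
    by (auto simp: ty_def ok_vcmp)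
  show "ty F a b \<Longrightarrow> valid p \<Longrightarrow> valid q \<Longrightarrow> ty (W p F q) (p @ a @ q) (p @ b @ q)"
    by (auto simp: ty_def ok_whisker)
  show "valid a \<Longrightarrow> ty (Id a) a a"
    by (auto simp: ty_def Id_def ok_i2)
  show "ty F a b \<Longrightarrow> Id b \<bullet> F = F"
    by (auto simp: ty_def Id_def ok_i2) (auto simp: ok_def vcmp_i2_left)
  show "ty F a b \<Longrightarrow> F \<bullet> Id a = F"
    by (auto simp: ty_def Id_def ok_i2) (auto simp: ok_def vcmp_i2_right)
  assume FG: "ty F a b" "ty G c d"
  show "W p F (q @ d @ r) \<bullet> W (p @ a @ q) G r = W (p @ b @ q) G r \<bullet> W p F (q @ c @ r)"
  proof (cases "valid p \<and> valid q \<and> valid r")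
    case True
    obtain f g where fg: "F = Some (a, f, b)" "ok a f b" "G = Some (c, g, d)" "ok c g d"
      using FG by (auto simp: ty_def)
    have v: "valid (q @ d @ r)" "valid (p @ a @ q)" "valid (p @ b @ q)" "valid (q @ c @ r)"
      using fg True by (auto simp: ok_def)
    have "vcmp L (hcmp L (i2 L (pr p)) (hcmp L f (i2 L (pr (q @ d @ r)))))
        (hcmp L (i2 L (pr (p @ a @ q))) (hcmp L g (i2 L (pr r)))) =
      hcmp L (i2 L (pr p)) (hcmp L f (hcmp L (i2 L (pr q)) (hcmp L g (i2 L (pr r)))))"
      using fg True
      by (simp add: ok_def i2_append hcmp_assoc cells pr_cells exchange[symmetric] i2_idem vcmp_i2_left vcmp_i2_right)
    moreover have "vcmp L (hcmp L (i2 L (pr (p @ b @ q))) (hcmp L g (i2 L (pr r))))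
        (hcmp L (i2 L (pr p)) (hcmp L f (i2 L (pr (q @ c @ r))))) =
      hcmp L (i2 L (pr p)) (hcmp L f (hcmp L (i2 L (pr q)) (hcmp L g (i2 L (pr r)))))"
      using fg True
      by (simp add: ok_def i2_append hcmp_assoc cells pr_cells exchange[symmetric] i2_idem vcmp_i2_left vcmp_i2_right)
    ultimately show ?thesis
      using fg True v ok_whisker[OF fg(2), of p "q @ d @ r"] ok_whisker[OF fg(2), of p "q @ c @ r"]
        ok_whisker[OF fg(4), of "p @ a @ q" r] ok_whisker[OF fg(4), of "p @ b @ q" r]
      by (simp del: set_append)
  next
    case False
    have "W p F (q @ d @ r) = None \<or> W (p @ a @ q) G r = None" "W p F (q @ c @ r) = None \<or> W (p @ b @ q) G r = None"
      using False FG by (auto simp: ty_def split: if_splits)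
    moreover have "None \<bullet> H = None" "H \<bullet> None = None" for H by (cases H; simp)+
    ultimately show ?thesis by metis
  qed
qed

lemma ty_eqI: "ty F a b \<Longrightarrow> ty G a b \<Longrightarrow> ce F = ce G \<Longrightarrow> F = G"
  by (auto simp: ty_def ce_def)

lemma ty_ok: "ty F a b \<Longrightarrow> ok a (ce F) b"
  by (auto simp: ty_def ce_def)

lemma ty_Some [simp]: "ty (Some (a, f, b)) a' b' \<longleftrightarrow> a = a' \<and> b = b' \<and> ok a f b"
  by (auto simp: ty_def)

lemma ce_Some [simp]: "ce (Some (a, f, b)) = f"
  by (simp add: ce_def)

text \<open>Ill-typed composites are \<open>None\<close>, so a typing of a whole chain already types
  all its factors. One typing proof per chain then suffices to push \<open>ce\<close>
  inside.\<close>

lemma ty_comp_cases: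
  assumes "ty (F \<bullet> G) a c"
  obtains b where "ty F b c" "ty G a b"
proof -
  have "\<exists>b. ty F b c \<and> ty G a b"
    using assms by (cases "(F, G)" rule: comp.cases) (auto simp: ty_def split: if_splits)
  then show ?thesis using that by blast
qed

lemma ce_comp: "ty (F \<bullet> G) a c \<Longrightarrow> ce (F \<bullet> G) = vcmp L (ce F) (ce G)"
  by (erule ty_comp_cases) (auto simp: ty_def)

lemma ce_comp3: "ty (F \<bullet> G \<bullet> H) a c \<Longrightarrow> ce (F \<bullet> G \<bullet> H) = vcmp L (ce F) (vcmp L (ce G) (ce H))"
  by (metis ce_comp ty_comp_cases)

lemma ce_comp4:
  "ty (F \<bullet> G \<bullet> H \<bullet> H') a c \<Longrightarrow> ce (F \<bullet> G \<bullet> H \<bullet> H') = vcmp L (ce F) (vcmp L (ce G) (vcmp L (ce H) (ce H')))"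
  by (metis ce_comp ty_comp_cases)

lemma ce_Id: "valid w \<Longrightarrow> ce (Id w) = i2 L (pr w)"
  by (simp add: Id_def)

lemma ce_W_hcmp:
  "ty F a b \<Longrightarrow> valid p \<Longrightarrow> valid q \<Longrightarrow> ce (W p F q) = hcmp L (i2 L (pr p)) (hcmp L (ce F) (i2 L (pr q)))"
  by (auto simp: ty_def)

text \<open>\<open>wlw\<close> and \<open>wrw\<close> omit whiskering by the empty word, while
  \<open>W\<close> whiskers by the identity 1-cell; the two agree by the identity laws of horizontal
  composition.\<close>

lemma ce_W:
  assumes "ty F a b" "valid p" "valid q"
  shows "ce (W p F q) = wlw L X p (wrw L X (ce F) q)"
proof -
  obtain f where "F = Some (a, f, b)" "ok a f b" using assms by (auto simp: ty_def)
  then show ?thesis using assms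
    by (auto simp: ok_def wlw_def wrw_def wl_def wr_def hcmp_i1_right hcmp_i1_left cells')
qed

definition mu :: "nat \<Rightarrow> 'b arrow" where
  "mu x = Some ([x,x], wmu X x, [x])"

definition eta :: "nat \<Rightarrow> 'b arrow" where
  "eta x = Some ([], weta X x, [x])"

definition lam :: "nat \<Rightarrow> nat \<Rightarrow> 'b arrow" where
  "lam x y = Some ([y,x], wlam X x y, [x,y])"

lemma ok_mu: "x \<le> n \<Longrightarrow> ok [x,x] (wmu X x) [x]"
  and ok_eta: "x \<le> n \<Longrightarrow> ok [] (weta X x) [x]"
  using mnd0_X[of x] by (simp_all add: mndi_def ok_def)

lemma ok_lam: "x < y \<Longrightarrow> y \<le> n \<Longrightarrow> ok [y,x] (wlam X x y) [x,y]"
  using wdl_X[of x y] by (simp add: mndi_def ok_def)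

lemma ty_mu': "x \<le> n \<Longrightarrow> ty (mu x) [x,x] [x]"
  and ty_eta': "x \<le> n \<Longrightarrow> ty (eta x) [] [x]"
  and ty_lam': "x < y \<Longrightarrow> y \<le> n \<Longrightarrow> ty (lam x y) [y,x] [x,y]"
  by (simp_all add: mu_def eta_def lam_def ok_mu ok_eta ok_lam)

lemma ce_gen [simp]: "ce (mu x) = wmu X x" "ce (eta x) = weta X x" "ce (lam x y) = wlam X x y"
  by (simp_all add: mu_def eta_def lam_def)

lemma ce_W_mu: "x \<le> n \<Longrightarrow> valid p \<Longrightarrow> valid q \<Longrightarrow> ce (W p (mu x) q) = wlw L X p (wrw L X (wmu X x) q)"
  and ce_W_eta: "x \<le> n \<Longrightarrow> valid p \<Longrightarrow> valid q \<Longrightarrow> ce (W p (eta x) q) = wlw L X p (wrw L X (weta X x) q)"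
  and ce_W_lam: "x < y \<Longrightarrow> y \<le> n \<Longrightarrow> valid p \<Longrightarrow> valid q \<Longrightarrow>
    ce (W p (lam x y) q) = wlw L X p (wrw L X (wlam X x y) q)"
  by (simp_all add: ce_W[OF ty_mu'] ce_W[OF ty_eta'] ce_W[OF ty_lam'])

lemma ce_eqI2:
  "ty (F \<bullet> G) a b \<Longrightarrow> ty (F' \<bullet> G') a b \<Longrightarrow> vcmp L (ce F) (ce G) = vcmp L (ce F') (ce G') \<Longrightarrow> F \<bullet> G = F' \<bullet> G'"
  by (rule ty_eqI) (auto simp: ce_comp)

lemmas ce_whisker = ce_W_mu ce_W_eta ce_W_lam wlw_def wrw_def

sublocale wdl_calculus n ty comp W Id mu eta lam
proof
  note [simp del] = W.simps comp.simps ty_Some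
  note typing = ty_compI ty_WI
  fix x y z :: nat
  {
    assume x: "x \<le> n"
    note m = mnd0_X[OF x, unfolded mndi_def mnd0.simps]
    show m_ty: "ty (mu x) [x,x] [x]" by (rule ty_mu'[OF x])
    show u_ty: "ty (eta x) [] [x]" by (rule ty_eta'[OF x])
    show "mu x \<bullet> W [] (mu x) [x] = mu x \<bullet> W [x] (mu x) []"
    proof (rule ce_eqI2)
      show "ty (mu x \<bullet> W [] (mu x) [x]) [x,x,x] [x]" "ty (mu x \<bullet> W [x] (mu x) []) [x,x,x] [x]"
        using x by (auto intro!: typing m_ty)
    qed (use m x in \<open>simp add: ce_whisker\<close>)
    have "ty (mu x \<bullet> W [x] (eta x) []) [x] [x]" "ty (mu x \<bullet> W [] (eta x) [x]) [x] [x]"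
      using x by (auto intro!: typing m_ty u_ty)
    note t = this
    show "mu x \<bullet> W [x] (eta x) [] = Id [x]"
      using m x by (intro ty_eqI[OF t(1) ty_Id]) (simp_all add: ce_comp[OF t(1)] ce_whisker ce_Id)
    show "mu x \<bullet> W [] (eta x) [x] = Id [x]"
      using m x by (intro ty_eqI[OF t(2) ty_Id]) (simp_all add: ce_comp[OF t(2)] ce_whisker ce_Id)
  }
  {
    assume xy: "x < y" "y \<le> n"
    then have x: "x \<le> n" by simp
    note m = wdl_X[OF xy, unfolded mndi_def wdl.simps]
    note w = ty_mu'[OF x] ty_mu'[OF xy(2)] ty_eta'[OF x] ty_eta'[OF xy(2)]
    show l_ty: "ty (lam x y) [y,x] [x,y]" by (rule ty_lam'[OF xy])
    have "ty (lam x y \<bullet> W [] (mu y) [x]) [y,y,x] [x,y]"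
      "ty (W [x] (mu y) [] \<bullet> W [] (lam x y) [y] \<bullet> W [y] (lam x y) []) [y,y,x] [x,y]"
      "ty (lam x y \<bullet> W [y] (mu x) []) [y,x,x] [x,y]"
      "ty (W [] (mu x) [y] \<bullet> W [x] (lam x y) [] \<bullet> W [] (lam x y) [x]) [y,x,x] [x,y]"
      "ty (lam x y \<bullet> W [] (eta y) [x]) [x] [x,y]"
      "ty (W [] (mu x) [y] \<bullet> W [x] (lam x y) [] \<bullet> W [x,y] (eta x) [] \<bullet> W [x] (eta y) []) [x] [x,y]"
      "ty (lam x y \<bullet> W [y] (eta x) []) [y] [x,y]"
      "ty (W [x] (mu y) [] \<bullet> W [] (lam x y) [y] \<bullet> W [] (eta y) [x,y] \<bullet> W [] (eta x) [y]) [y] [x,y]"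
      using x xy by (auto intro!: typing l_ty w)
    note t = this
    show "lam x y \<bullet> W [] (mu y) [x] = W [x] (mu y) [] \<bullet> W [] (lam x y) [y] \<bullet> W [y] (lam x y) []"
      using m x xy by (intro ty_eqI[OF t(1,2)]) (simp add: ce_comp[OF t(1)] ce_comp3[OF t(2)] ce_whisker)
    show "lam x y \<bullet> W [y] (mu x) [] = W [] (mu x) [y] \<bullet> W [x] (lam x y) [] \<bullet> W [] (lam x y) [x]"
      using m x xy by (intro ty_eqI[OF t(3,4)]) (simp add: ce_comp[OF t(3)] ce_comp3[OF t(4)] ce_whisker)
    show "lam x y \<bullet> W [] (eta y) [x] =
      W [] (mu x) [y] \<bullet> W [x] (lam x y) [] \<bullet> W [x,y] (eta x) [] \<bullet> W [x] (eta y) []"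
      using m x xy by (intro ty_eqI[OF t(5,6)]) (simp add: ce_comp[OF t(5)] ce_comp4[OF t(6)] ce_whisker)
    show "lam x y \<bullet> W [y] (eta x) [] =
      W [x] (mu y) [] \<bullet> W [] (lam x y) [y] \<bullet> W [] (eta y) [x,y] \<bullet> W [] (eta x) [y]"
      using m x xy by (intro ty_eqI[OF t(7,8)]) (simp add: ce_comp[OF t(7)] ce_comp4[OF t(8)] ce_whisker)
  }
  assume xyz: "x < y" "y < z" "z \<le> n"
  then have le: "x \<le> n" "y \<le> n" "x < z" by simp_all
  have t: "ty (W [] (lam x y) [z] \<bullet> W [y] (lam x z) [] \<bullet> W [] (lam y z) [x]) [z,y,x] [x,y,z]"
    "ty (W [x] (lam y z) [] \<bullet> W [] (lam x z) [y] \<bullet> W [z] (lam x y) []) [z,y,x] [x,y,z]"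
    using xyz le by (auto intro!: typing ty_lam')
  have "vcmp L (wr L (wlam X x y) (ws X z)) (vcmp L (wl L (ws X y) (wlam X x z)) (wr L (wlam X y z) (ws X x))) =
      vcmp L (wl L (ws X x) (wlam X y z)) (vcmp L (wr L (wlam X x z) (ws X y)) (wl L (ws X z) (wlam X x y)))"
    using wdln0 xyz by (simp add: wdln0_def)
  then show "W [] (lam x y) [z] \<bullet> W [y] (lam x z) [] \<bullet> W [] (lam y z) [x] =
      W [x] (lam y z) [] \<bullet> W [] (lam x z) [y] \<bullet> W [z] (lam x y) []"
    using xyz le by (intro ty_eqI[OF t]) (simp add: ce_comp3[OF t(1)] ce_comp3[OF t(2)] ce_whisker)
qed

end

context wdl_obj
begin

section \<open>Translation between the word calculus and the given cells\<close>

lemma ok_cell: "ok a f b \<Longrightarrow> f \<in> cell L \<and> src2 L f = pr a \<and> tgt2 L f = pr b"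
  by (simp add: ok_def)

lemma ins_ins_cell: "valid w \<Longrightarrow> x \<le> n \<Longrightarrow>
    ty (ins x w) (x # w) (insort x w) \<and> ce (ins x w) = ins_cell L X x w"
proof (induction w)
  case Nil
  then show ?case by (simp add: ty_Id ce_Id)
next
  case (Cons y w)
  show ?case
  proof (cases "x \<le> y")
    case True
    then show ?thesis using Cons.prems ty_Id[of "x # y # w"] by (simp add: ce_Id)
  next
    case False
    have IH: "ty (ins x w) (x # w) (insort x w)" "ce (ins x w) = ins_cell L X x w"
      using Cons by auto
    have "ty (ins x (y # w)) (x # y # w) (insort x (y # w))"
      using False Cons.prems by (auto intro!: ty_compI ty_WI[OF IH(1)] ty_WI[OF ty_lam])
    with False Cons.prems IH show ?thesis
      by (auto simp: ce_comp ce_W[OF IH(1)] ce_W_lam wlw_def wrw_def)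
  qed
qed

lemma srt_sort_cell: "valid w \<Longrightarrow> ty (srt w) w (sort w) \<and> ce (srt w) = sort_cell L X w"
proof (induction w)
  case Nil
  then show ?case by (simp add: ty_Id ce_Id)
next
  case (Cons x w)
  then have IH: "ty (srt w) w (sort w)" "ce (srt w) = sort_cell L X w" "valid w" "x \<le> n" "valid (sort w)"
    by auto
  note i = ins_ins_cell[OF IH(5,4)]
  have "ty (srt (x # w)) (x # w) (sort (x # w))"
    using IH i by (auto intro!: ty_compI[OF i[THEN conjunct1]] ty_WI[OF IH(1)])
  then show ?case using IH i by (auto simp: ce_comp ce_W[OF IH(1)] wrw_def)
qed

lemma ce_hcmp:
  assumes "ty F a b" "ty G c d"
  shows "ce (W [] F d \<bullet> W a G []) = hcmp L (ce F) (ce G)"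
    and "ty (W [] F d \<bullet> W a G []) (a @ c) (b @ d)"
proof -
  have o: "ok a (ce F) b" "ok c (ce G) d" using assms by (auto intro: ty_ok)
  then have v: "valid a" "valid b" "valid c" "valid d" by (auto simp: ok_def)
  show t: "ty (W [] F d \<bullet> W a G []) (a @ c) (b @ d)"
    by (rule ty_compI[OF ty_WI[OF assms(1)] ty_WI[OF assms(2)]]) (use v in auto)
  show "ce (W [] F d \<bullet> W a G []) = hcmp L (ce F) (ce G)"
    using o v
    by (simp add: ce_comp[OF t] ce_W_hcmp[OF assms(1)] ce_W_hcmp[OF assms(2)]
        exchange[symmetric] ok_def cells' vcmp_i2_left vcmp_i2_right hcmp_i1_left hcmp_i1_right)
qed

lemma Mu_hprod: "valid T \<Longrightarrow> ce (Mu T) = hprod L X (map (wmu X) T)"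
proof (induction T)
  case Nil
  then show ?case by (simp add: ce_Id)
next
  case (Cons x T)
  then have x: "valid T" "x \<le> n" by auto
  have o: "ok [x,x] (wmu X x) [x]" by (rule ok_mu[OF x(2)])
  have "ce (Mu (x # T)) = hcmp L (wmu X x) (hprod L X (map (wmu X) T))"
    using ce_hcmp(1)[OF ty_mu[OF x(2)] ty_Mu[OF x(1)]] Cons.IH[OF x(1)] by simp
  then show ?case
    using o by (cases T) (simp_all add: ok_def hcmp_i1_right cells' ws_hom x src1_ws tgt1_ws)
qed

text \<open>Induction from the right, since \<open>lbar_r\<close> works on the reversed word. Words
  of two letters are a separate case: there \<open>lbar_r\<close> uses \<open>wbar\<close>, and
  \<open>lambda_bar_left_right\<close> converts it. For longer words \<open>ins_act\<close> shows
  that \<open>larrow\<close> is the idempotent of the last letter.\<close>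

lemma ce_P: "inc J \<Longrightarrow> ce (P J) = lbar L X J"
proof (induction J rule: rev_induct)
  case Nil
  then show ?case by (simp add: P_def lbar_def ce_Id)
next
  case (snoc k J)
  then have J: "inc J" "k \<le> n" "valid J" "valid (J @ [k])" by (auto simp: inc_append inc_Cons incD)
  consider "J = []" | i where "J = [i]" | j i w where "rev J = j # i # w"
    by (metis rev.simps(1) rev_rev_ident rev_singleton_conv list.exhaust)
  then show ?case
  proof cases
    case 1
    then have "P (J @ [k]) = Id [k]"
      using e_first[of k "[]"] snoc.prems Id_right[OF ty_Id, of "[k]"] J by (simp add: P_def)
    then show ?thesis using 1 J by (simp add: lbar_def ce_Id)
  next
    case (2 i)
    then have ik: "i < k" "i \<le> n" using snoc.prems by (auto simp: inc_append inc_Cons)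
    have "P (J @ [k]) = W [] (mu i) [k] \<bullet> W [i] (lam i k) [] \<bullet> W [i,k] (eta i) []"
      unfolding lambda_bar_left_right[OF ik(1) J(2)]
      using 2 P_pair[OF ik(1) J(2)] ik by (simp add: e_def normal)
    moreover from this ty_P[OF snoc.prems]
    have t: "ty (W [] (mu i) [k] \<bullet> W [i] (lam i k) [] \<bullet> W [i,k] (eta i) []) (J @ [k]) (J @ [k])"
      by simp
    ultimately show ?thesis
      using 2 ik J ce_comp3[OF t] by (simp add: lbar_def mndi_def ce_whisker)
  next
    case (3 j i w)
    let ?J = "J @ [k]"
    have P: "P ?J = (W J (mu k) [] \<bullet> ins k ?J \<bullet> W [] (eta k) ?J) \<bullet> W [] (P J) [k]"
      using ins_act[OF snoc.prems, THEN tail] by (simp add: P_snoc e_def assoc)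
    have t: "ty (P ?J) ?J ?J" by (rule ty_P[OF snoc.prems])
    have t1: "ty (W J (mu k) [] \<bullet> ins k ?J \<bullet> W [] (eta k) ?J) ?J ?J"
      using ins_act[OF snoc.prems, THEN tail] ty_e[OF snoc.prems, of k] by (simp add: e_def assoc)
    have "ce (W J (mu k) [] \<bullet> ins k ?J \<bullet> W [] (eta k) ?J) = larrow L X ?J"
      using J ins_ins_cell[OF J(4,2)]
      by (simp add: ce_comp3[OF t1] larrow_def ce_W_mu ce_W_eta wrw_def) (simp add: wlw_def)
    moreover have "ce (W [] (P J) [k]) = wrw L X (lbar L X J) [k]"
      using snoc.IH[OF J(1)] J by (simp add: ce_W[OF ty_P[OF J(1)]] wlw_def)
    ultimately show ?thesis
      using ce_comp[OF t[unfolded P]] P 3 by (simp add: lbar_def)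
  qed
qed

lemma ce_mult: "inc J \<Longrightarrow> J \<noteq> [] \<Longrightarrow> ce (P J \<bullet> Act J J) = mult_raw L X J"
proof -
  assume J: "inc J" "J \<noteq> []"
  have v: "valid J" "valid (J @ J)" using J by (auto dest: incD)
  have tM: "ty (Mu J) (dup J) J" by (rule ty_Mu[OF v(1)])
  have A: "Act J J = Mu J \<bullet> srt (J @ J)"
    using Mu_srt[of "[]" J] J W_Nil[OF tM] by simp
  have "ty (P J \<bullet> Mu J \<bullet> srt (J @ J)) (J @ J) J"
    using ty_comp[OF ty_P[OF J(1)] ty_Act[OF J(1) order_refl]] A by simp
  from ce_comp3[OF this] show ?thesis
    using J A Mu_hprod[OF v(1)] srt_sort_cell[OF v(2)] by (simp add: mult_raw_def ce_P)
qed

lemma ok_lbar: "inc J \<Longrightarrow> ok J (lbar L X J) J"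
  using ty_ok[OF ty_P] ce_P by simp

lemma ok_mult: "inc J \<Longrightarrow> J \<noteq> [] \<Longrightarrow> ok (J @ J) (mult_raw L X J) J"
  using ty_ok[OF ty_comp[OF ty_P ty_Act[OF _ order_refl]], of J] ce_mult[of J] by simp

text \<open>The edge \<open>phi\<close> read as a cell of \<open>L\<close> between plain products;
  the two share their underlying 2-cell of \<open>K\<close>.\<close>

definition phr :: "nat list \<Rightarrow> nat \<Rightarrow> nat list \<Rightarrow> 'b" where
  "phr I i I' = vcmp L (lbar L X (I @ i # I')) (wlw L X I (wrw L X (weta X i) I'))"

lemma ce_phr:
  assumes "inc (I @ i # I')"
  shows "ce (P (I @ i # I') \<bullet> W I (eta i) I') = phr I i I'"
    and "ty (P (I @ i # I') \<bullet> W I (eta i) I') (I @ I') (I @ i # I')"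
proof -
  have v: "valid I" "valid I'" "i \<le> n" using assms by (auto simp: inc_append inc_Cons incD)
  show t: "ty (P (I @ i # I') \<bullet> W I (eta i) I') (I @ I') (I @ i # I')"
    by (rule ty_compI[OF ty_P[OF assms] ty_WI[OF ty_eta]]) (use v in auto)
  show "ce (P (I @ i # I') \<bullet> W I (eta i) I') = phr I i I'"
    using v assms by (simp add: ce_comp[OF t] ce_W_eta ce_P phr_def)
qed

lemma ok_phr: "inc (I @ i # I') \<Longrightarrow> ok (I @ I') (phr I i I') (I @ i # I')"
  using ty_ok[OF ce_phr(2)] ce_phr(1) by simp

lemma lbar_phr:
  assumes "inc (I @ i # I')"
  shows "vcmp L (lbar L X (I @ i # I')) (phr I i I') = phr I i I'"
  using ce_comp[OF ty_comp[OF ty_P[OF assms] ce_phr(2)[OF assms]]] P_idem[OF assms, THEN tail]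
    ce_P[OF assms] ce_phr(1)[OF assms] by (simp add: assoc)

lemma ok_incl: "inc (i # I) \<Longrightarrow> ok [i] (ce (incl i I)) (i # I)"
  by (rule ty_ok[OF ty_incl])

lemma lbar_incl:
  assumes "inc (i # I)"
  shows "vcmp L (lbar L X (i # I)) (ce (incl i I)) = ce (incl i I)"
  using ce_comp[OF ty_comp[OF ty_P[OF assms] ty_incl[OF assms]]] P_idem[OF assms, THEN tail]
    ce_P[OF assms] by (simp add: incl_def assoc)

lemma ce_incl_Nil: "i \<le> n \<Longrightarrow> ce (incl i []) = i2 L (ws X i)"
  by (simp add: incl_Nil ce_Id)

lemma ce_incl_snoc:
  assumes "inc (i # I @ [k])"
  shows "ce (incl i (I @ [k])) = vcmp L (phr (i # I) k []) (ce (incl i I))"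
proof -
  have J: "inc ((i # I) @ k # [])" using assms by simp
  have "ty (incl i (I @ [k])) [i] (i # I @ [k])" using assms by (intro ty_incl) simp
  from ce_comp[OF this[unfolded incl_snoc[OF assms]]] show ?thesis
    using incl_snoc[OF assms] ce_phr(1)[OF J] by simp
qed

lemma mult_incl_phr:
  assumes "inc (i # I)"
  shows "vcmp L (mult_raw L X (i # I)) (hcmp L (ce (incl i I)) (phr [] i I)) = lbar L X (i # I)"
proof -
  let ?J = "i # I"
  have J: "inc ([] @ i # I)" using assms by simp
  note h = ce_hcmp[OF ty_incl[OF assms] ce_phr(2)[OF J]]
  have t: "ty ((P ?J \<bullet> Act ?J ?J) \<bullet> W [] (incl i I) ?J \<bullet> W [i] (P ?J \<bullet> W [] (eta i) I) []) ?J ?J"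
    using ty_comp[OF ty_comp[OF ty_P[OF assms] ty_Act[OF assms order_refl]], of _ ?J] h(2) by simp
  from ce_comp[OF t] show ?thesis
    using mult_first_rest[OF assms] h(1) ce_mult[OF assms] ce_P[OF assms] ce_phr(1)[OF J]
    by (simp add: incl_def)
qed

lemma mult_phr_swap:
  assumes "x < y" "y \<le> n"
  shows "vcmp L (mult_raw L X [x,y]) (hcmp L (phr [] x [y]) (phr [x] y [])) = wlam X x y"
proof -
  let ?J = "[x,y]"
  have J: "inc ?J" "inc ([] @ x # [y])" "inc ([x] @ y # [])" using assms by (auto simp: inc_def)
  note h = ce_hcmp[OF ce_phr(2)[OF J(2)] ce_phr(2)[OF J(3)]]
  have t: "ty ((P ?J \<bullet> Act ?J ?J) \<bullet> W [] (P ?J \<bullet> W [] (eta x) [y]) ?J \<bullet> W [y] (P ?J \<bullet> W [x] (eta y) []) []) [y,x] ?J"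
    using ty_comp[OF ty_comp[OF ty_P[OF J(1)] ty_Act[OF J(1) order_refl]], of _ "[y,x]"] h(2) by simp
  from ce_comp[OF t] show ?thesis
    using mult_swap[OF assms] h(1) ce_mult[OF J(1)] ce_phr(1)[OF J(2)] ce_phr(1)[OF J(3)]
    by simp
qed

text \<open>Serves to drop the idempotents of shorter words that accumulate when the recursion for
  \<psi> is unfolded.\<close>

lemma lbar_first:
  assumes "inc (i # I)"
  shows "vcmp L (lbar L X (i # I)) (wl L (ws X i) (lbar L X I)) = lbar L X (i # I)"
proof -
  have I: "inc I" "i \<le> n" using assms by (auto simp: inc_Cons)
  have "ty (P (i # I) \<bullet> W [i] (P I) []) (i # I) (i # I)"
    using P_first[OF assms] ty_P[OF assms] by simp
  from ce_comp[OF this] show ?thesis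
    using P_first[OF assms] ce_P[OF assms] ce_P[OF I(1)] I
    by (simp add: ce_W[OF ty_P[OF I(1)]] wlw_def wrw_def)
qed

end

section \<open>Families of monad morphisms commuting with the edges\<close>

text \<open>\<psi> is moved past \<open>m'\<close> by its multiplication law and then past the two
  inclusions, the right one first. In that law \<open>l\<close> and \<open>l'\<close> stand where
  identities would be expected; they vanish because \<open>b\<close> and \<open>a'\<close> are fixed
  by them.\<close>

lemma (in two_cat) mult_transport:
  assumes h: "v \<in> hom K" "t \<in> hom K" "x \<in> hom K" "y \<in> hom K" "t' \<in> hom K" "x' \<in> hom K" "y' \<in> hom K"
    and o: "src1 K v = A" "tgt1 K v = B" "src1 K t = A" "tgt1 K t = A" "src1 K x = A" "tgt1 K x = A"
      "src1 K y = A" "tgt1 K y = A" "src1 K t' = B" "tgt1 K t' = B" "src1 K x' = B" "tgt1 K x' = B"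
      "src1 K y' = B" "tgt1 K y' = B"
    and psi: "\<psi> \<in> cell K" "src2 K \<psi> = cmp1 K t' v" "tgt2 K \<psi> = cmp1 K v t"
    and l: "l \<in> cell K" "src2 K l = t" "tgt2 K l = t" "l' \<in> cell K" "src2 K l' = t'" "tgt2 K l' = t'"
    and m: "m \<in> cell K" "src2 K m = cmp1 K t t" "tgt2 K m = t"
      "m' \<in> cell K" "src2 K m' = cmp1 K t' t'" "tgt2 K m' = t'"
    and a: "a \<in> cell K" "src2 K a = x" "tgt2 K a = t" "a' \<in> cell K" "src2 K a' = x'" "tgt2 K a' = t'"
    and b: "b \<in> cell K" "src2 K b = y" "tgt2 K b = t" "b' \<in> cell K" "src2 K b' = y'" "tgt2 K b' = t'"
    and alpha: "\<alpha> \<in> cell K" "src2 K \<alpha> = cmp1 K x' v" "tgt2 K \<alpha> = cmp1 K v x"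
    and beta: "\<beta> \<in> cell K" "src2 K \<beta> = cmp1 K y' v" "tgt2 K \<beta> = cmp1 K v y"
    and mult: "vcmp K \<psi> (wr K m' v) = vcmp K (wl K v m) (vcmp K (hcmp K \<psi> l) (hcmp K l' \<psi>))"
    and lb: "vcmp K l b = b" and la': "vcmp K l' a' = a'"
    and pa: "vcmp K \<psi> (wr K a' v) = vcmp K (wl K v a) \<alpha>"
    and pb: "vcmp K \<psi> (wr K b' v) = vcmp K (wl K v b) \<beta>"
  shows "vcmp K \<psi> (wr K (vcmp K m' (hcmp K a' b')) v) =
    vcmp K (wl K v (vcmp K m (hcmp K a b))) (vcmp K (wr K \<alpha> y) (wl K x' \<beta>))"
proof -
  note [simp] = h o psi l m a b alpha beta cells wl_def wr_def
  let ?v = "i2 K v"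
  have iv: "vcmp K ?v ?v = ?v" by (simp add: vcmp_i2_left)
  have "vcmp K \<psi> (wr K (vcmp K m' (hcmp K a' b')) v) =
      vcmp K \<psi> (vcmp K (hcmp K m' ?v) (hcmp K (hcmp K a' b') ?v))"
    using exchange[of m' "hcmp K a' b'" ?v ?v] iv by simp
  also have "\<dots> = vcmp K (vcmp K \<psi> (wr K m' v)) (hcmp K (hcmp K a' b') ?v)"
    by (simp add: vcmp_assoc)
  also have "\<dots> = vcmp K (wl K v m) (vcmp K (hcmp K \<psi> l) (vcmp K (hcmp K l' \<psi>) (hcmp K a' (hcmp K b' ?v))))"
    by (simp add: mult vcmp_assoc cmp1_assoc hcmp_assoc del: wl_def wr_def) (simp add: vcmp_assoc cmp1_assoc)
  also have "vcmp K (hcmp K l' \<psi>) (hcmp K a' (hcmp K b' ?v)) = hcmp K a' (vcmp K (hcmp K ?v b) \<beta>)"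
    using exchange[of l' a' \<psi> "hcmp K b' ?v"] la' pb by simp
  also have "\<dots> = vcmp K (hcmp K (hcmp K a' ?v) b) (hcmp K (i2 K x') \<beta>)"
    using exchange[of a' "i2 K x'" "hcmp K ?v b" \<beta>] by (simp add: vcmp_i2_right hcmp_assoc)
  also have "vcmp K (hcmp K \<psi> l) \<dots> = vcmp K (vcmp K (hcmp K \<psi> l) (hcmp K (hcmp K a' ?v) b)) (hcmp K (i2 K x') \<beta>)"
    by (simp add: vcmp_assoc cmp1_assoc)
  also have "vcmp K (hcmp K \<psi> l) (hcmp K (hcmp K a' ?v) b) = hcmp K (vcmp K (hcmp K ?v a) \<alpha>) b"
    using exchange[of \<psi> "hcmp K a' ?v" l b] lb pa by simp
  also have "\<dots> = vcmp K (hcmp K ?v (hcmp K a b)) (hcmp K \<alpha> (i2 K y))"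
    using exchange[of "hcmp K ?v a" \<alpha> b "i2 K y"] by (simp add: vcmp_i2_right hcmp_assoc)
  also have "vcmp K (wl K v m) (vcmp K \<dots> (hcmp K (i2 K x') \<beta>)) =
     vcmp K (vcmp K (hcmp K ?v m) (hcmp K ?v (hcmp K a b))) (vcmp K (wr K \<alpha> y) (wl K x' \<beta>))"
    by (simp add: vcmp_assoc cmp1_assoc)
  also have "vcmp K (hcmp K ?v m) (hcmp K ?v (hcmp K a b)) = wl K v (vcmp K m (hcmp K a b))"
    using exchange[of ?v ?v m "hcmp K a b"] iv by simp
  finally show ?thesis .
qed

lemma (in two_cat) square_comp:
  assumes h: "v \<in> hom K"
    and p: "p \<in> cell K" "src2 K p = cmp1 K x' v" "tgt2 K p = cmp1 K v x"
    and q: "q \<in> cell K" "src2 K q = cmp1 K y' v" "tgt2 K q = cmp1 K v y"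
    and r: "r \<in> cell K" "src2 K r = cmp1 K z' v" "tgt2 K r = cmp1 K v z"
    and a: "a \<in> cell K" "src2 K a = y" "tgt2 K a = x" "a' \<in> cell K" "src2 K a' = y'" "tgt2 K a' = x'"
    and b: "b \<in> cell K" "src2 K b = z" "tgt2 K b = y" "b' \<in> cell K" "src2 K b' = z'" "tgt2 K b' = y'"
    and o: "src1 K v = A" "tgt1 K v = B" "tgt1 K y = A" "src1 K y' = B" "tgt1 K z = A" "src1 K z' = B"
    and pa: "vcmp K p (wr K a' v) = vcmp K (wl K v a) q"
    and qb: "vcmp K q (wr K b' v) = vcmp K (wl K v b) r"
  shows "vcmp K p (wr K (vcmp K a' b') v) = vcmp K (wl K v (vcmp K a b)) r"
proof -
  have iv: "vcmp K (i2 K v) (i2 K v) = i2 K v" using h by (simp add: vcmp_i2_left cells)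
  note [simp] = h p q r a b o cells wl_def wr_def
  have "vcmp K p (wr K (vcmp K a' b') v) = vcmp K (vcmp K p (wr K a' v)) (wr K b' v)"
    using exchange[of a' b' "i2 K v" "i2 K v"] iv by (simp add: vcmp_assoc)
  also have "\<dots> = vcmp K (wl K v a) (vcmp K q (wr K b' v))"
    unfolding pa by (simp add: vcmp_assoc)
  also have "\<dots> = vcmp K (vcmp K (wl K v a) (wl K v b)) r"
    unfolding qb by (simp add: vcmp_assoc)
  also have "vcmp K (wl K v a) (wl K v b) = wl K v (vcmp K a b)"
    using exchange[of "i2 K v" "i2 K v" a b] iv by simp
  finally show ?thesis .
qed

text \<open>A 1-cell of the cube after changing sources and targets: \<psi> runs between plain
  products, so the idempotent that was part of the vertex is recorded by \<open>psi_lbar\<close> and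
  shows up explicitly in \<open>psi_mult\<close>.\<close>

locale wdl_mor = X: wdl_obj L n X + Y: wdl_obj L n Y
  for L :: "('o,'a,'b) cat2" and n :: nat and X Y :: "('o,'a,'b) wdlobj" +
  fixes v :: 'a and \<psi> :: "nat list \<Rightarrow> 'b"
  assumes v: "v \<in> hom L" "src1 L v = wA X" "tgt1 L v = wA Y"
    and psi_cell: "X.inc J \<Longrightarrow> \<psi> J \<in> cell L"
    and psi_src: "X.inc J \<Longrightarrow> src2 L (\<psi> J) = cmp1 L (prodw L Y J) v"
    and psi_tgt: "X.inc J \<Longrightarrow> tgt2 L (\<psi> J) = cmp1 L v (prodw L X J)"
    and psi_lbar: "X.inc J \<Longrightarrow> vcmp L (\<psi> J) (wr L (lbar L Y J) v) = \<psi> J"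
    and psi_mult: "X.inc J \<Longrightarrow> J \<noteq> [] \<Longrightarrow> vcmp L (\<psi> J) (wr L (mult_raw L Y J) v) =
      vcmp L (wl L v (mult_raw L X J)) (vcmp L (hcmp L (\<psi> J) (lbar L X J)) (hcmp L (lbar L Y J) (\<psi> J)))"
    and psi_phr: "X.inc (I @ i # I') \<Longrightarrow>
      vcmp L (\<psi> (I @ i # I')) (wr L (Y.phr I i I') v) = vcmp L (wl L v (X.phr I i I')) (\<psi> (I @ I'))"
begin

text \<open>The inclusion of the first factor is a chain of edges, by \<open>ce_incl_snoc\<close>;
  the corresponding squares are pasted by \<open>square_comp\<close>.\<close>

lemma psi_incl:
  "X.inc (i # I) \<Longrightarrow> vcmp L (\<psi> (i # I)) (wr L (Y.ce (Y.incl i I)) v) =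
     vcmp L (wl L v (X.ce (X.incl i I))) (\<psi> [i])"
proof (induction I rule: rev_induct)
  case Nil
  then have i: "i \<le> n" by (simp add: X.inc_Cons)
  have "vcmp L (\<psi> [i]) (i2 L (cmp1 L (ws Y i) v)) = \<psi> [i]" "vcmp L (i2 L (cmp1 L v (ws X i))) (\<psi> [i]) = \<psi> [i]"
    using psi_cell[OF Nil] psi_src[OF Nil] psi_tgt[OF Nil] by (simp_all add: X.vcmp_i2_right X.vcmp_i2_left)
  then show ?case
    using i v by (simp add: X.ce_incl_Nil Y.ce_incl_Nil wr_def wl_def X.hcmp_i2 X.ws_hom Y.ws_hom
        X.src1_ws Y.src1_ws X.tgt1_ws Y.tgt1_ws)
next
  case (snoc k I)
  let ?J = "i # I"
  have J: "X.inc ?J" "X.inc (?J @ [k])" "X.inc (?J @ k # [])" "X.inc (i # I @ [k])"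
    using snoc.prems by (auto simp: X.inc_append X.inc_Cons)
  have val: "set ?J \<subseteq> {..n}" "set (?J @ [k]) \<subseteq> {..n}" "set [i] \<subseteq> {..n}"
    using J by (auto dest: X.incD)
  note oks = X.ok_cell[OF X.ok_phr[OF J(3)]] Y.ok_cell[OF Y.ok_phr[OF J(3)]]
     X.ok_cell[OF X.ok_incl[OF J(1)]] Y.ok_cell[OF Y.ok_incl[OF J(1)]]
  have "X.inc [i]" using J by (simp add: X.inc_Cons X.inc_def)
  note psis = psi_cell[OF J(2)] psi_src[OF J(2)] psi_tgt[OF J(2)] psi_cell[OF J(1)] psi_src[OF J(1)] psi_tgt[OF J(1)]
    psi_cell[OF this] psi_src[OF this] psi_tgt[OF this]
  have "vcmp L (\<psi> (?J @ [k])) (wr L (vcmp L (Y.phr ?J k []) (Y.ce (Y.incl i I))) v) =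
      vcmp L (wl L v (vcmp L (X.phr ?J k []) (X.ce (X.incl i I)))) (\<psi> [i])"
  proof (rule X.square_comp[OF v(1) psis, where A = "wA X" and B = "wA Y"])
    show "vcmp L (\<psi> (?J @ [k])) (wr L (Y.phr ?J k []) v) = vcmp L (wl L v (X.phr ?J k [])) (\<psi> ?J)"
      using psi_phr[OF J(3)] by simp
    show "vcmp L (\<psi> ?J) (wr L (Y.ce (Y.incl i I)) v) = vcmp L (wl L v (X.ce (X.incl i I))) (\<psi> [i])"
      by (rule snoc.IH[OF J(1)])
  qed (use oks val v in \<open>simp_all add: X.pr_cells Y.pr_cells del: prodw.simps\<close>)
  then show ?case by (simp add: X.ce_incl_snoc[OF J(4)] Y.ce_incl_snoc[OF J(4)])
qed

lemma xichain_cell: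
  assumes xs: "\<And>i. i \<le> n \<Longrightarrow> xs ! i = \<psi> [i]" and J: "set J \<subseteq> {..n}"
  shows "xichain L X Y v xs J \<in> cell L \<and> src2 L (xichain L X Y v xs J) = cmp1 L (prodw L Y J) v \<and>
    tgt2 L (xichain L X Y v xs J) = cmp1 L v (prodw L X J)"
  using J
proof (induction J rule: induct_list012)
  case 1
  then show ?case using v by (simp add: X.cells X.cmp1_i1_left X.cmp1_i1_right)
next
  case (2 i)
  then have "X.inc [i]" by (simp add: X.inc_def)
  from psi_cell[OF this] psi_src[OF this] psi_tgt[OF this] 2 xs show ?case by simp
next
  case (3 i j w)
  let ?w = "j # w"
  have w: "set ?w \<subseteq> {..n}" "i \<le> n" "set [i] \<subseteq> {..n}" and inc: "X.inc [i]" using 3 by (auto simp: X.inc_def)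
  have c: "\<psi> [i] \<in> cell L" "src2 L (\<psi> [i]) = cmp1 L (ws Y i) v" "tgt2 L (\<psi> [i]) = cmp1 L v (ws X i)"
    using psi_cell[OF inc] psi_src[OF inc] psi_tgt[OF inc] by simp_all
  have IH: "xichain L X Y v xs ?w \<in> cell L" "src2 L (xichain L X Y v xs ?w) = cmp1 L (prodw L Y ?w) v"
    "tgt2 L (xichain L X Y v xs ?w) = cmp1 L v (prodw L X ?w)" using 3(2)[OF w(1)] by auto
  note s = X.ws_hom[OF w(2)] Y.ws_hom[OF w(2)] X.src1_ws[OF w(2)] Y.src1_ws[OF w(2)] X.tgt1_ws[OF w(2)] Y.tgt1_ws[OF w(2)]
    X.pr_cells[OF w(1)] Y.pr_cells[OF w(1)]
  show ?case
    using c IH s v xs[OF w(2)]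
    by (simp add: wrw_def wlw_def wl_def wr_def X.cells X.cmp1_assoc)
qed

text \<open>\<open>mult_transport\<close> for the inclusions of \<open>s_i\<close> and
  \<open>s_I\<close>. Their product is \<open>lbar\<close> on both sides by
  \<open>mult_incl_phr\<close>, and \<psi> absorbs the one on the side of \<open>Y\<close>.\<close>

lemma psi_step:
  assumes "X.inc (i # I)"
  shows "\<psi> (i # I) = vcmp L (wl L v (lbar L X (i # I)))
    (vcmp L (wr L (\<psi> [i]) (prodw L X I)) (wl L (ws Y i) (\<psi> I)))"
proof -
  let ?J = "i # I"
  have J: "X.inc ([] @ i # I)" "X.inc [i]" "X.inc I" using assms by (auto simp: X.inc_Cons X.inc_def)
  have val: "set ?J \<subseteq> {..n}" "set I \<subseteq> {..n}" "set [i] \<subseteq> {..n}" "i \<le> n"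
    using assms by (auto simp: X.inc_def)
  note oks = X.ok_cell[OF X.ok_lbar[OF assms]] Y.ok_cell[OF Y.ok_lbar[OF assms]]
    X.ok_cell[OF X.ok_mult[OF assms list.distinct(2)]] Y.ok_cell[OF Y.ok_mult[OF assms list.distinct(2)]]
    X.ok_cell[OF X.ok_incl[OF assms]] Y.ok_cell[OF Y.ok_incl[OF assms]]
    X.ok_cell[OF X.ok_phr[OF J(1)]] Y.ok_cell[OF Y.ok_phr[OF J(1)]]
  note psis = psi_cell[OF assms] psi_src[OF assms] psi_tgt[OF assms] psi_cell[OF J(2)] psi_src[OF J(2)] psi_tgt[OF J(2)]
    psi_cell[OF J(3)] psi_src[OF J(3)] psi_tgt[OF J(3)]
  have "vcmp L (\<psi> ?J) (wr L (vcmp L (mult_raw L Y ?J) (hcmp L (Y.ce (Y.incl i I)) (Y.phr [] i I))) v) =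
    vcmp L (wl L v (vcmp L (mult_raw L X ?J) (hcmp L (X.ce (X.incl i I)) (X.phr [] i I))))
      (vcmp L (wr L (\<psi> [i]) (prodw L X I)) (wl L (prodw L Y [i]) (\<psi> I)))"
  proof (rule X.mult_transport[where t = "prodw L X ?J" and t' = "prodw L Y ?J" and x = "prodw L X [i]"
        and A = "wA X" and B = "wA Y" and y' = "prodw L Y I" and l = "lbar L X ?J" and l' = "lbar L Y ?J"])
    show "vcmp L (\<psi> ?J) (wr L (mult_raw L Y ?J) v) =
      vcmp L (wl L v (mult_raw L X ?J)) (vcmp L (hcmp L (\<psi> ?J) (lbar L X ?J)) (hcmp L (lbar L Y ?J) (\<psi> ?J)))"
      by (rule psi_mult[OF assms]) simp
    show "vcmp L (lbar L X ?J) (X.phr [] i I) = X.phr [] i I"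
      using X.lbar_phr[OF J(1)] by simp
    show "vcmp L (lbar L Y ?J) (Y.ce (Y.incl i I)) = Y.ce (Y.incl i I)"
      by (rule Y.lbar_incl[OF assms])
    show "vcmp L (\<psi> ?J) (wr L (Y.ce (Y.incl i I)) v) = vcmp L (wl L v (X.ce (X.incl i I))) (\<psi> [i])"
      by (rule psi_incl[OF assms])
    show "vcmp L (\<psi> ?J) (wr L (Y.phr [] i I) v) = vcmp L (wl L v (X.phr [] i I)) (\<psi> I)"
      using psi_phr[OF J(1)] by simp
  qed (use oks psis val v in \<open>simp_all add: X.pr_cells Y.pr_cells X.pr_append Y.pr_append del: prodw.simps append.simps(2)\<close>)
  then show ?thesis
    using psi_lbar[OF assms] by (simp add: X.mult_incl_phr[OF assms] Y.mult_incl_phr[OF assms])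
qed

text \<open>Unfolding \<open>psi_step\<close> leaves one idempotent per tail of the word.
  Interchange slides the inner one past the first letter's \<psi>, and \<open>lbar_first\<close>
  absorbs it into the outer one.\<close>

lemma psi_xichain:
  assumes xs: "\<And>i. i \<le> n \<Longrightarrow> xs ! i = \<psi> [i]"
  shows "X.inc J \<Longrightarrow> J \<noteq> [] \<Longrightarrow> \<psi> J = vcmp L (wl L v (lbar L X J)) (xichain L X Y v xs J)"
proof (induction J rule: induct_list012)
  case (2 i)
  then have i: "i \<le> n" by (simp add: X.inc_Cons)
  then have "vcmp L (wl L v (lbar L X [i])) (\<psi> [i]) = \<psi> [i]"
    using psi_cell[OF 2(1)] psi_tgt[OF 2(1)] v
    by (simp add: lbar_def wl_def X.hcmp_i2 X.ws_hom X.tgt1_ws X.vcmp_i2_left)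
  then show ?case using xs[OF i] by simp
next
  case (3 i j w)
  let ?w = "j # w" let ?J = "i # ?w" let ?c = "xichain L X Y v xs ?w"
  have w: "X.inc ?w" "X.inc [i]" "i \<le> n" "set ?w \<subseteq> {..n}" "set ?J \<subseteq> {..n}"
    using 3(3) by (auto simp: X.inc_Cons X.inc_def)
  note c = xichain_cell[OF xs w(4), THEN conjunct1] xichain_cell[OF xs w(4), THEN conjunct2, THEN conjunct1]
    xichain_cell[OF xs w(4), THEN conjunct2, THEN conjunct2]
  note l = X.ok_cell[OF X.ok_lbar[OF w(1)]] X.ok_cell[OF X.ok_lbar[OF 3(3)]]
  have p: "\<psi> [i] \<in> cell L" "src2 L (\<psi> [i]) = cmp1 L (ws Y i) v" "tgt2 L (\<psi> [i]) = cmp1 L v (ws X i)"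
    using psi_cell[OF w(2)] psi_src[OF w(2)] psi_tgt[OF w(2)] by simp_all
  note s = X.ws_hom[OF w(3)] Y.ws_hom[OF w(3)] X.src1_ws[OF w(3)] Y.src1_ws[OF w(3)] X.tgt1_ws[OF w(3)] Y.tgt1_ws[OF w(3)]
    X.pr_cells[OF w(4)] Y.pr_cells[OF w(4)]
  have prJ: "prodw L X ?J = cmp1 L (ws X i) (prodw L X ?w)" by simp
  note [simp] = c l p s v X.cells wl_def wr_def
  note [simp del] = prodw.simps xichain.simps lbar_def
  let ?v = "i2 L v" and ?l = "lbar L X ?w" and ?L = "lbar L X ?J" and ?s = "i2 L (prodw L X ?w)"
    and ?y = "i2 L (ws Y i)" and ?x = "i2 L (ws X i)"
  have iv: "vcmp L ?v ?v = ?v" by (simp add: X.vcmp_i2_left)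
  have "\<psi> ?J = vcmp L (hcmp L ?v ?L) (vcmp L (hcmp L (\<psi> [i]) ?s) (hcmp L ?y (vcmp L (hcmp L ?v ?l) ?c)))"
    using psi_step[OF 3(3)] 3(2)[OF w(1)] by simp
  also have "hcmp L ?y (vcmp L (hcmp L ?v ?l) ?c) = vcmp L (hcmp L (hcmp L ?y ?v) ?l) (hcmp L ?y ?c)"
    using X.exchange[of ?y ?y "hcmp L ?v ?l" ?c] by (simp add: X.vcmp_i2_left X.hcmp_assoc)
  also have "vcmp L (hcmp L (\<psi> [i]) ?s) \<dots> = vcmp L (vcmp L (hcmp L (\<psi> [i]) ?s) (hcmp L (hcmp L ?y ?v) ?l)) (hcmp L ?y ?c)"
    by (simp add: X.vcmp_assoc X.cmp1_assoc)
  also have "vcmp L (hcmp L (\<psi> [i]) ?s) (hcmp L (hcmp L ?y ?v) ?l) = hcmp L (\<psi> [i]) ?l"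
    using X.exchange[of "\<psi> [i]" "hcmp L ?y ?v" ?s ?l] by (simp add: X.vcmp_i2_left X.vcmp_i2_right X.hcmp_i2)
  also have "\<dots> = vcmp L (hcmp L ?v (hcmp L ?x ?l)) (hcmp L (\<psi> [i]) ?s)"
    using X.exchange[of "hcmp L ?v ?x" "\<psi> [i]" ?l ?s]
    by (simp add: X.vcmp_i2_left X.vcmp_i2_right X.hcmp_i2 X.hcmp_assoc[symmetric])
  also have "vcmp L (hcmp L ?v ?L) (vcmp L \<dots> (hcmp L ?y ?c)) =
     vcmp L (vcmp L (hcmp L ?v ?L) (hcmp L ?v (hcmp L ?x ?l))) (vcmp L (hcmp L (\<psi> [i]) ?s) (hcmp L ?y ?c))"
    by (simp add: X.vcmp_assoc X.cmp1_assoc prJ)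
  also have "vcmp L (hcmp L ?v ?L) (hcmp L ?v (hcmp L ?x ?l)) = hcmp L ?v ?L"
    using X.exchange[of ?v ?v ?L "hcmp L ?x ?l"] iv X.lbar_first[OF 3(3)] by (simp add: prJ)
  also have "vcmp L (hcmp L (\<psi> [i]) ?s) (hcmp L ?y ?c) = xichain L X Y v xs ?J"
    by (simp add: xichain.simps wrw_def wlw_def xs[OF w(3)] prodw.simps)
  finally show ?case by simp
qed simp

text \<open>Both sides equal \<psi> of the two-letter word after the law of \<open>Y\<close>: one by
  \<open>mult_transport\<close> for the inclusions in the swapped order, whose product is \<lambda>
  by \<open>mult_phr_swap\<close>, the other by \<open>psi_step\<close>.\<close>

lemma psi_pair:
  assumes "x < y" "y \<le> n"
  shows "vcmp L (wl L v (wlam X x y)) (vcmp L (wr L (\<psi> [y]) (ws X x)) (wl L (ws Y y) (\<psi> [x]))) =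
    vcmp L (wl L v (lbar L X [x,y])) (vcmp L (wr L (\<psi> [x]) (ws X y)) (vcmp L (wl L (ws Y x) (\<psi> [y])) (wr L (wlam Y x y) v)))"
proof -
  let ?J = "[x,y]"
  have J: "X.inc ?J" "X.inc ([] @ x # [y])" "X.inc ([x] @ y # [])" "X.inc [x]" "X.inc [y]"
    using assms by (auto simp: X.inc_def)
  have val: "set ?J \<subseteq> {..n}" "set [x] \<subseteq> {..n}" "set [y] \<subseteq> {..n}" "x \<le> n"
    using assms by auto
  have pr4: "prodw L X [x,y,x,y] = cmp1 L (prodw L X ?J) (prodw L X ?J)"
    "prodw L Y [x,y,x,y] = cmp1 L (prodw L Y ?J) (prodw L Y ?J)"
    using X.pr_append[OF val(1) val(1)] Y.pr_append[OF val(1) val(1)] by (simp_all del: prodw.simps)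
  note oks = X.ok_cell[OF X.ok_lbar[OF J(1)]] Y.ok_cell[OF Y.ok_lbar[OF J(1)]]
    X.ok_cell[OF X.ok_mult[OF J(1) list.distinct(2)]] Y.ok_cell[OF Y.ok_mult[OF J(1) list.distinct(2)]]
    X.ok_cell[OF X.ok_phr[OF J(2)]] Y.ok_cell[OF Y.ok_phr[OF J(2)]]
    X.ok_cell[OF X.ok_phr[OF J(3)]] Y.ok_cell[OF Y.ok_phr[OF J(3)]]
  note psis = psi_cell[OF J(1)] psi_src[OF J(1)] psi_tgt[OF J(1)] psi_cell[OF J(4)] psi_src[OF J(4)] psi_tgt[OF J(4)]
    psi_cell[OF J(5)] psi_src[OF J(5)] psi_tgt[OF J(5)]
  have "vcmp L (\<psi> ?J) (wr L (vcmp L (mult_raw L Y ?J) (hcmp L (Y.phr [] x [y]) (Y.phr [x] y []))) v) =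
    vcmp L (wl L v (vcmp L (mult_raw L X ?J) (hcmp L (X.phr [] x [y]) (X.phr [x] y []))))
      (vcmp L (wr L (\<psi> [y]) (prodw L X [x])) (wl L (prodw L Y [y]) (\<psi> [x])))"
  proof (rule X.mult_transport[where t = "prodw L X ?J" and t' = "prodw L Y ?J" and x = "prodw L X [y]"
        and A = "wA X" and B = "wA Y" and y' = "prodw L Y [x]" and l = "lbar L X ?J" and l' = "lbar L Y ?J"])
    show "vcmp L (\<psi> ?J) (wr L (mult_raw L Y ?J) v) =
      vcmp L (wl L v (mult_raw L X ?J)) (vcmp L (hcmp L (\<psi> ?J) (lbar L X ?J)) (hcmp L (lbar L Y ?J) (\<psi> ?J)))"
      by (rule psi_mult[OF J(1)]) simp
    show "vcmp L (lbar L X ?J) (X.phr [x] y []) = X.phr [x] y []"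
      using X.lbar_phr[OF J(3)] by simp
    show "vcmp L (lbar L Y ?J) (Y.phr [] x [y]) = Y.phr [] x [y]"
      using Y.lbar_phr[OF J(2)] by simp
    show "vcmp L (\<psi> ?J) (wr L (Y.phr [] x [y]) v) = vcmp L (wl L v (X.phr [] x [y])) (\<psi> [y])"
      using psi_phr[OF J(2)] by simp
    show "vcmp L (\<psi> ?J) (wr L (Y.phr [x] y []) v) = vcmp L (wl L v (X.phr [x] y [])) (\<psi> [x])"
      using psi_phr[OF J(3)] by simp
  qed (use oks psis val v in \<open>simp_all add: X.pr_cells Y.pr_cells pr4 del: prodw.simps\<close>)
  then have "vcmp L (wl L v (wlam X x y)) (vcmp L (wr L (\<psi> [y]) (ws X x)) (wl L (ws Y y) (\<psi> [x]))) =
    vcmp L (\<psi> ?J) (wr L (wlam Y x y) v)"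
    using X.mult_phr_swap[OF assms] Y.mult_phr_swap[OF assms] by simp
  also have "\<dots> = vcmp L (vcmp L (wl L v (lbar L X ?J)) (vcmp L (wr L (\<psi> [x]) (ws X y)) (wl L (ws Y x) (\<psi> [y]))))
      (wr L (wlam Y x y) v)"
    using psi_step[OF J(1)] by simp
  also have "\<dots> = vcmp L (wl L v (lbar L X [x,y])) (vcmp L (wr L (\<psi> [x]) (ws X y)) (vcmp L (wl L (ws Y x) (\<psi> [y])) (wr L (wlam Y x y) v)))"
  proof -
    note s = X.ws_hom[OF val(4)] Y.ws_hom[OF val(4)] X.src1_ws[OF val(4)] Y.src1_ws[OF val(4)] X.tgt1_ws[OF val(4)] Y.tgt1_ws[OF val(4)]
      X.ws_hom[OF assms(2)] Y.ws_hom[OF assms(2)] X.src1_ws[OF assms(2)] Y.src1_ws[OF assms(2)] X.tgt1_ws[OF assms(2)] Y.tgt1_ws[OF assms(2)]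
    note c = X.ok_cell[OF X.ok_lbar[OF J(1)]] Y.ok_cell[OF Y.ok_lam[OF assms]] psis
    show ?thesis
      using s c v by (simp add: wl_def wr_def X.cells X.vcmp_assoc X.cmp1_assoc)
  qed
  finally show ?thesis .
qed

end

section \<open>The cube in the closure\<close>

lemma lic_sel [simp]:
  "fst (vcmp (lic K) a b) = vcmp K (fst a) (fst b)"
  "fst (hcmp (lic K) a b) = hcmp K (fst a) (fst b)"
  "fst (i2 (lic K) f) = snd f"
  "fst (i1 (lic K) A) = i1 K A"
  "snd (i1 (lic K) A) = i2 K (i1 K A)"
  "fst (cmp1 (lic K) f g) = cmp1 K (fst f) (fst g)"
  "snd (cmp1 (lic K) f g) = hcmp K (snd f) (snd g)"
  "fst (src2 (lic K) a) = src2 K (fst (snd a))"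
  "snd (src2 (lic K) a) = fst (snd a)"
  "fst (tgt2 (lic K) a) = src2 K (snd (snd a))"
  "snd (tgt2 (lic K) a) = snd (snd a)"
  "fst (wl (lic K) f a) = hcmp K (snd f) (fst a)"
  "fst (wr (lic K) a f) = hcmp K (fst a) (snd f)"
  by (simp_all add: lic_def wl_def wr_def split: prod.splits)

lemma lic_cell: "a \<in> cell (lic K) \<longleftrightarrow> idem K (fst (snd a)) \<and> idem K (snd (snd a)) \<and> fst a \<in> cell K \<and>
    src2 K (fst a) = src2 K (fst (snd a)) \<and> tgt2 K (fst a) = src2 K (snd (snd a)) \<and>
    vcmp K (snd (snd a)) (fst a) = fst a \<and> vcmp K (fst a) (fst (snd a)) = fst a"
  by (auto simp: lic_def)

lemma lic_hom: "f \<in> hom (lic K) \<longleftrightarrow> fst f \<in> hom K \<and> idem K (snd f) \<and> src2 K (snd f) = fst f"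
  by (auto simp: lic_def)

lemma lic_1: "src1 (lic K) f = src1 K (fst f)" "tgt1 (lic K) f = tgt1 K (fst f)"
  by (simp_all add: lic_def split: prod.splits)

text \<open>Reduces equations in the closure to equations in \<open>K\<close>, which do not depend
  on the idempotents recorded at the ends.\<close>

lemma lic_eqI:
  assumes "src2 (lic K) a = src2 (lic K) b" "tgt2 (lic K) a = tgt2 (lic K) b" "fst a = fst b"
  shows "a = b"
  using assms lic_sel(9)[of K a] lic_sel(9)[of K b] lic_sel(11)[of K a] lic_sel(11)[of K b]
  by (simp add: prod_eq_iff)

context wdl_obj
begin

lemma mult_raw_single: "i \<le> n \<Longrightarrow> mult_raw L X [i] = wmu X i"
proof -
  assume i: "i \<le> n"
  then have inc: "inc [i]" by (simp add: inc_def)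
  have "P [i] = Id [i]"
    using e_first[OF inc] Id_right[OF ty_Id, of "[i]"] i by (simp add: P_def)
  moreover have "Act [i] [i] = mu i"
    using W_Nil[OF ty_mu[OF i]] Id_right[OF ty_mu[OF i]] by (simp add: W_Id)
  ultimately show ?thesis
    using ce_mult[OF inc] Id_left[OF ty_mu[OF i]] by simp
qed

lemma unit_raw_single: "i \<le> n \<Longrightarrow> unit_raw L X [i] = weta X i"
  using ok_eta[of i]
  by (simp add: unit_raw_def lbar_def ok_def wlw_def wl_def hcmp_i2 ws_hom wA_ob src1_ws cells
      cmp1_i1_right vcmp_i2_left)

lemma lbar_single: "lbar L X [i] = i2 L (ws X i)"
  by (simp add: lbar_def)

end

locale wdl_lic = K: two_cat K + wdl_obj "lic K" n X
  for K :: "('o,'a,'b) cat2" and n :: nat and X :: "('o,'a,'b) lobj"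
begin

lemma vert_inc:
  assumes "inc J"
  shows "vert K X (set J) = (wA X, (fst (pr J), fst (lbar (lic K) X J)),
    (fst (mult_raw (lic K) X J), hcmp K (fst (lbar (lic K) X J)) (fst (lbar (lic K) X J)), fst (lbar (lic K) X J)),
    (fst (unit_raw (lic K) X J), i2 K (i1 K (wA X)), fst (lbar (lic K) X J)))"
  using assms sorted_list_of_set.idem_if_sorted_distinct[of J]
  by (simp add: vert_def Let_def inc_def strict_sorted_iff)

lemma vert_single: "i \<le> n \<Longrightarrow> vert K X {i} = mndi X i"
proof -
  assume i: "i \<le> n"
  then have inc: "inc [i]" by (simp add: inc_def)
  have m: "src2 (lic K) (wmu X i) = cmp1 (lic K) (ws X i) (ws X i)" "tgt2 (lic K) (wmu X i) = ws X i"
    and u: "src2 (lic K) (weta X i) = i1 (lic K) (wA X)" "tgt2 (lic K) (weta X i) = ws X i"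
    using ok_mu[OF i] ok_eta[OF i] by (simp_all add: ok_def)
  show ?thesis
    using vert_inc[OF inc] arg_cong[OF m(1), of snd] arg_cong[OF m(2), of snd]
      arg_cong[OF u(1), of snd] arg_cong[OF u(2), of snd]
    by (simp add: mult_raw_single[OF i] unit_raw_single[OF i] lbar_single mndi_def prod_eq_iff)
qed

lemma phi_phr:
  assumes "inc (I @ i # I')"
  shows "fst (phi K X (set (I @ I')) i) = fst (phr I i I')"
proof -
  have s: "sorted_wrt (<) (I @ I')" "sorted_wrt (<) (I @ i # I')" using assms by (auto simp: inc_def sorted_wrt_append)
  have "sorted_list_of_set (set (I @ I')) = I @ I'" "sorted_list_of_set (set (I @ i # I')) = I @ i # I'"
    using s by (simp_all only: sorted_list_of_set.idem_if_sorted_distinct strict_sorted_iff)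
  moreover have "filter (\<lambda>j. j < i) (I @ I') = I" "filter (\<lambda>j. i < j) (I @ I') = I'"
    using s by (auto simp: sorted_wrt_append filter_id_conv filter_empty_conv)
  ultimately show ?thesis
    by (simp add: phi_def Let_def phr_def)
qed

end

section \<open>Faithfulness and fullness\<close>

locale wdl_lic_pair = X: wdl_lic K n X + Y: wdl_lic K n Y
  for K :: "('o,'a,'b) cat2" and n :: nat and X Y :: "('o,'a,'b) lobj"
begin

abbreviation L where "L \<equiv> lic K"

text \<open>For one letter \<open>lbar\<close> is an identity, so nothing of the original component
  is lost; the singletons of the cube recover the whole 1-cell.\<close>

lemma E1_single:
  assumes F: "wdln1 L n X Y F" and i: "i \<le> n"
  shows "E1 K X Y F {i} = (fst F, snd F ! i)"
proof -
  obtain v xs where Fv: "F = (v, xs)" by (cases F)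
  have "mnd1 L (mndi X i) (mndi Y i) (v, xs ! i)" using F i Fv by (auto simp: wdln1_def)
  then have v: "v \<in> hom L" "src1 L v = wA X" and p: "xs ! i \<in> cell L"
    "src2 L (xs ! i) = cmp1 L (ws Y i) v" "tgt2 L (xs ! i) = cmp1 L v (ws X i)"
    by (auto simp: mndi_def)
  have "vcmp L (wl L v (lbar L X [i])) (xs ! i) = xs ! i"
    using v p i by (simp add: X.lbar_single wl_def X.hcmp_i2 X.ws_hom X.tgt1_ws X.vcmp_i2_left)
  from arg_cong[OF this, of fst]
  have "vcmp K (hcmp K (snd v) (snd (ws X i))) (fst (xs ! i)) = fst (xs ! i)"
    by (simp add: X.lbar_single)
  moreover have "snd (src2 L (xs ! i)) = hcmp K (snd (ws Y i)) (snd v)"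
    "snd (tgt2 L (xs ! i)) = hcmp K (snd v) (snd (ws X i))" using p by simp_all
  ultimately show ?thesis
    unfolding Fv by (simp add: E1_def xiI_def X.lbar_single Y.lbar_single prod_eq_iff)
qed

lemma E1_inj:
  assumes F: "wdln1 L n X Y F" and G: "wdln1 L n X Y G"
    and eq: "\<forall>I. I \<subseteq> {..n} \<longrightarrow> E1 K X Y F I = E1 K X Y G I"
  shows "F = G"
proof -
  have i: "(fst F, snd F ! i) = (fst G, snd G ! i)" if "i \<le> n" for i
    using eq[rule_format, of "{i}"] E1_single[OF F that] E1_single[OF G that] that by simp
  have "length (snd F) = n + 1" "length (snd G) = n + 1"
    using F G by (auto simp: wdln1_def)
  with i have "snd F = snd G"
    by (intro nth_equalityI) simp_all
  then show ?thesis using i[of 0] by (simp add: prod_eq_iff)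
qed

text \<open>The edges have identity 1-cells, hence the edge condition forces the family to be
  constant. Its value is tested at the singletons, whose vertices are the original monads.\<close>

lemma E2_surj:
  assumes F: "wdln1 L n X Y F" and G: "wdln1 L n X Y G"
    and W: "cube2 K n X Y (E1 K X Y F) (E1 K X Y G) W"
  shows "\<exists>w. wdln2 L n X Y F G w \<and> (\<forall>I. I \<subseteq> {..n} \<longrightarrow> E2 w I = W I)"
proof -
  obtain v xs where F': "F = (v, xs)" by (cases F)
  obtain v' ys where G': "G = (v', ys)" by (cases G)
  note FG = F' G'
  have v: "src1 L v = wA X" "tgt1 L v = wA Y" using F FG by (auto simp: wdln1_def)
  have c: "W I \<in> cell L" "src2 L (W I) = v" if "I \<subseteq> {..n}" for I
  proof -
    have "mnd2 L (vert K X I) (vert K Y I) (E1 K X Y F I) (E1 K X Y G I) (W I)"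
      using W that by (simp add: cube2_def)
    then show "W I \<in> cell L" "src2 L (W I) = v"
      by (cases "vert K X I"; cases "vert K Y I"; simp add: E1_def FG)+
  qed
  have step: "W (insert i I) = W I" if "I \<subseteq> {..n}" "i \<le> n" "i \<notin> I" for I i
  proof -
    have "hcmp L (i2 L (i1 L (wA Y))) (W (insert i I)) = hcmp L (W I) (i2 L (i1 L (wA X)))"
      using W that by (simp add: cube2_def)
    then show ?thesis
      using c[OF that(1)] c[of "insert i I"] that v by (simp add: X.hcmp_i1_left X.hcmp_i1_right)
  qed
  have const: "W I = W {}" if "I \<subseteq> {..n}" for I
    using finite_subset[OF that finite_atMost] that
    by (induction I rule: finite_induct) (auto simp: step)
  have "mnd2 L (mndi X i) (mndi Y i) (v, xs ! i) (v', ys ! i) (W {})" if "i \<le> n" for i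
  proof -
    have "mnd2 L (vert K X {i}) (vert K Y {i}) (E1 K X Y F {i}) (E1 K X Y G {i}) (W {i})"
      using W that by (simp add: cube2_def)
    then show ?thesis
      using const[of "{i}"] that E1_single[OF F that] E1_single[OF G that] FG
      by (simp add: X.vert_single Y.vert_single)
  qed
  then have "wdln2 L n X Y F G (W {})" by (simp add: wdln2_def FG)
  moreover have "E2 (W {}) I = W I" if "I \<subseteq> {..n}" for I
    using const[OF that] by (simp add: E2_def)
  ultimately show ?thesis by blast
qed

text \<open>The preimage consists of the common 1-cell \<open>v\<close> and the components at the
  singletons. It is a 1-cell by \<open>psi_pair\<close>, and \<open>psi_xichain\<close> recovers the
  components at nonempty sets from it.\<close>

lemma E1_surj:
  assumes u: "cube1 K n X Y u"
  shows "\<exists>F. wdln1 L n X Y F \<and> (\<forall>I. I \<subseteq> {..n} \<longrightarrow> E1 K X Y F I = u I)"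
proof -
  define v where "v = fst (u {})"
  define q where "q J = fst (snd (u (set J)))" for J
  \<comment> \<open>The underlying 2-cell is kept, but its ends are declared to be the plain
    products instead of the vertex 1-cells. This is legitimate because \<open>lbar\<close> is fixed
    by the idempotents of the plain products.\<close>
  define \<psi> where "\<psi> J = (q J, hcmp K (snd (prodw L Y J)) (snd v), hcmp K (snd v) (snd (prodw L X J)))" for J
  have m: "mnd1 L (vert K X I) (vert K Y I) (u I)" if "I \<subseteq> {..n}" for I
    using u that by (simp add: cube1_def)
  have edge: "mnd_comp L (edge K Y I i) (u (insert i I)) = mnd_comp L (u I) (edge K X I i)"
    if "I \<subseteq> {..n}" "i \<le> n" "i \<notin> I" for I i
    using u that by (simp add: cube1_def)
  have hom: "fst (u I) \<in> hom L \<and> src1 L (fst (u I)) = wA X \<and> tgt1 L (fst (u I)) = wA Y" if "I \<subseteq> {..n}" for I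
    using m[OF that] by (cases "u I") (auto simp: vert_def Let_def)
  have step: "fst (u (insert i I)) = fst (u I)" if "I \<subseteq> {..n}" "i \<le> n" "i \<notin> I" for I i
  proof -
    have "cmp1 L (i1 L (wA Y)) (fst (u (insert i I))) = cmp1 L (fst (u I)) (i1 L (wA X))"
      using edge[OF that] by (cases "u I"; cases "u (insert i I)") (simp add: edge_def)
    then show ?thesis
      using hom[OF that(1)] hom[of "insert i I"] that by (simp add: X.cmp1_i1_left X.cmp1_i1_right del: lic_sel)
  qed
  have const: "fst (u I) = v" if "I \<subseteq> {..n}" for I
    using finite_subset[OF that finite_atMost] that
    by (induction I rule: finite_induct) (auto simp: step v_def)
  have v: "v \<in> hom L" "src1 L v = wA X" "tgt1 L v = wA Y" using hom[of "{}"] by (simp_all add: v_def)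
  have vK: "snd v \<in> cell K" "src2 K (snd v) = fst v" "tgt2 K (snd v) = fst v" "vcmp K (snd v) (snd v) = snd v"
    "fst v \<in> hom K" "src1 K (fst v) = wA X" "tgt1 K (fst v) = wA Y"
    using v by (auto simp: lic_hom lic_1 X.K.idem_iff)
  have uJ: "u (set J) = (v, q J, hcmp K (fst (lbar L Y J)) (snd v), hcmp K (snd v) (fst (lbar L X J)))"
    and pJ: "snd (u (set J)) \<in> cell L"
    and multJ: "vcmp K (q J) (hcmp K (fst (mult_raw L Y J)) (snd v)) =
      vcmp K (hcmp K (snd v) (fst (mult_raw L X J)))
        (vcmp K (hcmp K (q J) (fst (lbar L X J))) (hcmp K (fst (lbar L Y J)) (q J)))"
    and unitJ: "vcmp K (q J) (hcmp K (fst (unit_raw L Y J)) (snd v)) = hcmp K (snd v) (fst (unit_raw L X J))"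
    if J: "X.inc J" for J
  proof -
    have I: "set J \<subseteq> {..n}" using J by (simp add: X.inc_def)
    obtain p where p: "u (set J) = (v, p)" using const[OF I] by (cases "u (set J)") auto
    note mJ = m[OF I, unfolded p X.vert_inc[OF J] Y.vert_inc[OF J] mnd1.simps]
    then have "src2 L p = cmp1 L (fst (prodw L Y J), fst (lbar L Y J)) v"
      "tgt2 L p = cmp1 L v (fst (prodw L X J), fst (lbar L X J))" by blast+
    from arg_cong[OF this(1), of snd] arg_cong[OF this(2), of snd]
    show "u (set J) = (v, q J, hcmp K (fst (lbar L Y J)) (snd v), hcmp K (snd v) (fst (lbar L X J)))"
      using p by (simp add: q_def prod_eq_iff)
    show "snd (u (set J)) \<in> cell L" using mJ p by simp
    have q: "fst p = q J" by (simp add: q_def p)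
    show "vcmp K (q J) (hcmp K (fst (mult_raw L Y J)) (snd v)) =
      vcmp K (hcmp K (snd v) (fst (mult_raw L X J)))
        (vcmp K (hcmp K (q J) (fst (lbar L X J))) (hcmp K (fst (lbar L Y J)) (q J)))"
      using mJ[THEN conjunct2, THEN conjunct2, THEN conjunct2, THEN conjunct2, THEN conjunct2, THEN conjunct2,
          THEN conjunct1, THEN arg_cong, of fst] q by simp
    show "vcmp K (q J) (hcmp K (fst (unit_raw L Y J)) (snd v)) = hcmp K (snd v) (fst (unit_raw L X J))"
      using mJ[THEN conjunct2, THEN conjunct2, THEN conjunct2, THEN conjunct2, THEN conjunct2, THEN conjunct2,
          THEN conjunct2, THEN arg_cong, of fst] q by simp
  qed
  have lbX: "fst (lbar L X J) \<in> cell K" "src2 K (fst (lbar L X J)) = fst (prodw L X J)"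
    "tgt2 K (fst (lbar L X J)) = fst (prodw L X J)" "vcmp K (snd (prodw L X J)) (fst (lbar L X J)) = fst (lbar L X J)"
    "vcmp K (fst (lbar L X J)) (snd (prodw L X J)) = fst (lbar L X J)"
    and prX: "snd (prodw L X J) \<in> cell K" "src2 K (snd (prodw L X J)) = fst (prodw L X J)"
    "tgt2 K (snd (prodw L X J)) = fst (prodw L X J)" "src1 K (fst (prodw L X J)) = wA X" "tgt1 K (fst (prodw L X J)) = wA X"
    "fst (prodw L X J) \<in> hom K"
    and lbY: "fst (lbar L Y J) \<in> cell K" "src2 K (fst (lbar L Y J)) = fst (prodw L Y J)"
    "tgt2 K (fst (lbar L Y J)) = fst (prodw L Y J)" "vcmp K (snd (prodw L Y J)) (fst (lbar L Y J)) = fst (lbar L Y J)"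
    "vcmp K (fst (lbar L Y J)) (snd (prodw L Y J)) = fst (lbar L Y J)"
    and prY: "snd (prodw L Y J) \<in> cell K" "src2 K (snd (prodw L Y J)) = fst (prodw L Y J)"
    "tgt2 K (snd (prodw L Y J)) = fst (prodw L Y J)" "src1 K (fst (prodw L Y J)) = wA Y" "tgt1 K (fst (prodw L Y J)) = wA Y"
    "fst (prodw L Y J) \<in> hom K"
    if J: "X.inc J" for J
  proof -
    note J' = X.ok_cell[OF X.ok_lbar[OF J]] Y.ok_cell[OF Y.ok_lbar[OF J]]
    have I: "set J \<subseteq> {..n}" using J by (simp add: X.inc_def)
    note h = X.pr_cells[OF I] Y.pr_cells[OF I]
    have x: "snd (snd (lbar L X J)) = snd (prodw L X J)" "fst (snd (lbar L X J)) = snd (prodw L X J)"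
      "snd (snd (lbar L Y J)) = snd (prodw L Y J)" "fst (snd (lbar L Y J)) = snd (prodw L Y J)"
      using J' lic_sel(9,11) by metis+
    have c: "lbar L X J \<in> cell L" "lbar L Y J \<in> cell L" using J' by auto
    note c' = c[unfolded lic_cell x X.K.idem_iff]
    note h' = h[unfolded lic_hom lic_1 X.K.idem_iff]
    show "fst (lbar L X J) \<in> cell K" "src2 K (fst (lbar L X J)) = fst (prodw L X J)"
      "tgt2 K (fst (lbar L X J)) = fst (prodw L X J)" "vcmp K (snd (prodw L X J)) (fst (lbar L X J)) = fst (lbar L X J)"
      "vcmp K (fst (lbar L X J)) (snd (prodw L X J)) = fst (lbar L X J)"
      "snd (prodw L X J) \<in> cell K" "src2 K (snd (prodw L X J)) = fst (prodw L X J)"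
      "tgt2 K (snd (prodw L X J)) = fst (prodw L X J)" "src1 K (fst (prodw L X J)) = wA X"
      "tgt1 K (fst (prodw L X J)) = wA X" "fst (prodw L X J) \<in> hom K"
      "fst (lbar L Y J) \<in> cell K" "src2 K (fst (lbar L Y J)) = fst (prodw L Y J)"
      "tgt2 K (fst (lbar L Y J)) = fst (prodw L Y J)" "vcmp K (snd (prodw L Y J)) (fst (lbar L Y J)) = fst (lbar L Y J)"
      "vcmp K (fst (lbar L Y J)) (snd (prodw L Y J)) = fst (lbar L Y J)"
      "snd (prodw L Y J) \<in> cell K" "src2 K (snd (prodw L Y J)) = fst (prodw L Y J)"
      "tgt2 K (snd (prodw L Y J)) = fst (prodw L Y J)" "src1 K (fst (prodw L Y J)) = wA Y"
      "tgt1 K (fst (prodw L Y J)) = wA Y" "fst (prodw L Y J) \<in> hom K"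
      using c' h' by simp_all
  qed
  have qK: "q J \<in> cell K" "src2 K (q J) = cmp1 K (fst (prodw L Y J)) (fst v)"
    "tgt2 K (q J) = cmp1 K (fst v) (fst (prodw L X J))"
    "vcmp K (hcmp K (snd v) (fst (lbar L X J))) (q J) = q J"
    "vcmp K (q J) (hcmp K (fst (lbar L Y J)) (snd v)) = q J" if J: "X.inc J" for J
    using pJ[OF J] lbX[OF J] prX[OF J] lbY[OF J] prY[OF J] vK
    by (simp_all add: uJ[OF J] lic_cell X.K.cells)
  have psi: "\<psi> J \<in> cell L" "src2 L (\<psi> J) = cmp1 L (prodw L Y J) v" "tgt2 L (\<psi> J) = cmp1 L v (prodw L X J)"
    if J: "X.inc J" for J
  proof -
    note [simp] = lbX[OF J] prX[OF J] lbY[OF J] prY[OF J] vK qK(1-3)[OF J] X.K.cells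
    have I: "set J \<subseteq> {..n}" using J by (simp add: X.inc_def)
    have h: "cmp1 L (prodw L Y J) v \<in> hom L" "cmp1 L v (prodw L X J) \<in> hom L"
      using v X.pr_cells[OF I] Y.pr_cells[OF I] by (simp_all add: X.cmp1_hom)
    have l: "vcmp K (hcmp K (snd v) (snd (prodw L X J))) (hcmp K (snd v) (fst (lbar L X J))) = hcmp K (snd v) (fst (lbar L X J))"
      by (simp add: X.K.exchange[symmetric])
    have r: "vcmp K (hcmp K (fst (lbar L Y J)) (snd v)) (hcmp K (snd (prodw L Y J)) (snd v)) = hcmp K (fst (lbar L Y J)) (snd v)"
      by (simp add: X.K.exchange[symmetric])
    have "vcmp K (hcmp K (snd v) (snd (prodw L X J))) (q J) =
        vcmp K (vcmp K (hcmp K (snd v) (snd (prodw L X J))) (hcmp K (snd v) (fst (lbar L X J)))) (q J)"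
      using qK(4)[OF J] by (simp add: X.K.vcmp_assoc)
    then have 1: "vcmp K (hcmp K (snd v) (snd (prodw L X J))) (q J) = q J"
      using l qK(4)[OF J] by simp
    have "vcmp K (q J) (hcmp K (snd (prodw L Y J)) (snd v)) =
        vcmp K (vcmp K (q J) (hcmp K (fst (lbar L Y J)) (snd v))) (hcmp K (snd (prodw L Y J)) (snd v))"
      using qK(5)[OF J] by simp
    also have "\<dots> = vcmp K (q J) (vcmp K (hcmp K (fst (lbar L Y J)) (snd v)) (hcmp K (snd (prodw L Y J)) (snd v)))"
      by (simp add: X.K.vcmp_assoc)
    finally have 2: "vcmp K (q J) (hcmp K (snd (prodw L Y J)) (snd v)) = q J"
      using r qK(5)[OF J] by simp
    show "\<psi> J \<in> cell L"
      using 1 2 h[unfolded lic_hom] by (simp add: lic_cell \<psi>_def)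
    show "src2 L (\<psi> J) = cmp1 L (prodw L Y J) v" "tgt2 L (\<psi> J) = cmp1 L v (prodw L X J)"
      by (simp_all add: \<psi>_def prod_eq_iff)
  qed
  have fst_psi [simp]: "fst (\<psi> J) = q J" for J by (simp add: \<psi>_def)
  interpret M: wdl_mor L n X Y v \<psi>
  proof
    show "v \<in> hom L" "src1 L v = wA X" "tgt1 L v = wA Y" by (fact v)+
    fix J assume J: "X.inc J"
    show c: "\<psi> J \<in> cell L" "src2 L (\<psi> J) = cmp1 L (prodw L Y J) v" "tgt2 L (\<psi> J) = cmp1 L v (prodw L X J)"
      by (fact psi[OF J])+
    have I: "set J \<subseteq> {..n}" using J by (simp add: X.inc_def)
    note h = X.pr_cells[OF I] Y.pr_cells[OF I] v c X.ok_cell[OF X.ok_lbar[OF J]] Y.ok_cell[OF Y.ok_lbar[OF J]]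
    show "vcmp L (\<psi> J) (wr L (lbar L Y J) v) = \<psi> J"
    proof (rule lic_eqI[where K = K])
      show "fst (vcmp L (\<psi> J) (wr L (lbar L Y J) v)) = fst (\<psi> J)"
        using qK(5)[OF J] by simp
    qed (use h in \<open>simp_all add: wr_def X.cells\<close>)
    assume ne: "J \<noteq> []"
    show "vcmp L (\<psi> J) (wr L (mult_raw L Y J) v) =
      vcmp L (wl L v (mult_raw L X J)) (vcmp L (hcmp L (\<psi> J) (lbar L X J)) (hcmp L (lbar L Y J) (\<psi> J)))"
    proof (rule lic_eqI[where K = K])
      show "fst (vcmp L (\<psi> J) (wr L (mult_raw L Y J) v)) =
        fst (vcmp L (wl L v (mult_raw L X J)) (vcmp L (hcmp L (\<psi> J) (lbar L X J)) (hcmp L (lbar L Y J) (\<psi> J))))"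
        using multJ[OF J] by simp
    qed (use h X.ok_cell[OF X.ok_mult[OF J ne]] Y.ok_cell[OF Y.ok_mult[OF J ne]] I in
        \<open>simp_all add: wr_def wl_def X.cells X.cmp1_assoc X.pr_append Y.pr_append\<close>)
  next
    fix I i I' assume J: "X.inc (I @ i # I')"
    let ?J = "I @ i # I'"
    have I: "X.inc (I @ I')" "i \<le> n" "i \<notin> set (I @ I')" "set (I @ I') \<subseteq> {..n}" "set ?J \<subseteq> {..n}"
      using J by (auto simp: X.inc_def sorted_wrt_append)
    have ins: "insert i (set (I @ I')) = set ?J" by auto
    note h = X.pr_cells[OF I(4)] X.pr_cells[OF I(5)] Y.pr_cells[OF I(4)] Y.pr_cells[OF I(5)] v psi[OF J] psi[OF I(1)]
      X.ok_cell[OF X.ok_phr[OF J]] Y.ok_cell[OF Y.ok_phr[OF J]]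
    show "vcmp L (\<psi> ?J) (wr L (Y.phr I i I') v) = vcmp L (wl L v (X.phr I i I')) (\<psi> (I @ I'))"
    proof (rule lic_eqI[where K = K])
      have "vcmp K (hcmp K (i2 K (i1 K (wA Y))) (q ?J)) (hcmp K (fst (Y.phr I i I')) (snd v)) =
        vcmp K (hcmp K (snd v) (fst (X.phr I i I'))) (hcmp K (q (I @ I')) (i2 K (i1 K (wA X))))"
        using edge[OF I(4,2,3), THEN arg_cong, of "\<lambda>x. fst (snd x)"]
        unfolding ins uJ[OF J] uJ[OF I(1)] edge_def mnd_comp.simps
        by (simp add: X.phi_phr[OF J, simplified] Y.phi_phr[OF J, simplified])
      then show "fst (vcmp L (\<psi> ?J) (wr L (Y.phr I i I') v)) = fst (vcmp L (wl L v (X.phr I i I')) (\<psi> (I @ I')))"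
        using qK(1-3)[OF J] qK(1-3)[OF I(1)] vK prX[OF J] prX[OF I(1)] prY[OF J] prY[OF I(1)]
        by (simp add: X.K.hcmp_i1_left X.K.hcmp_i1_right X.K.cells)
    qed (use h in \<open>simp_all add: wr_def wl_def X.cells\<close>)
  qed
  let ?xs = "map (\<lambda>i. \<psi> [i]) [0..<n + 1]"
  have xs: "?xs ! i = \<psi> [i]" if "i \<le> n" for i
    using that nth_map[of i "[0..<n + 1]"] by (simp del: upt_Suc)
  have single: "u {i} = (v, \<psi> [i])" if "i \<le> n" for i
  proof -
    have "X.inc [i]" using that by (simp add: X.inc_def)
    from uJ[OF this] show ?thesis by (simp add: \<psi>_def X.lbar_single Y.lbar_single)
  qed
  have mnd: "mnd1 L (mndi X i) (mndi Y i) (v, \<psi> [i])" if "i \<le> n" for i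
    using m[of "{i}"] that by (simp add: single X.vert_single Y.vert_single)
  have "wdl1 L (mndi X j) (mndi X i) (wlam X i j) (mndi Y j) (mndi Y i) (wlam Y i j) v (\<psi> [j]) (\<psi> [i])"
    if "i < j" "j \<le> n" for i j
    using mnd[of i] mnd[of j] that M.psi_pair[OF that] by (simp add: mndi_def lbar_def)
  then have "wdln1 L n X Y (v, ?xs)"
    using mnd v by (auto simp: wdln1_def xs simp del: map_append upt_Suc)
  moreover have "E1 K X Y (v, ?xs) I = u I" if I: "I \<subseteq> {..n}" for I
  proof -
    define J where "J = sorted_list_of_set I"
    have fin: "finite I" using I finite_subset by blast
    have J: "X.inc J" "set J = I" using I fin by (auto simp: X.inc_def J_def)
    have "fst (if J = [] then i2 L v else vcmp L (wl L v (lbar L X J)) (xichain L X Y v ?xs J)) = q J"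
    proof (cases "J = []")
      case True
      \<comment> \<open>At the empty word the monad is trivial, so the unit condition itself
        determines the component: it must be the identity 2-cell of \<open>v\<close>.\<close>
      have "vcmp K (q []) (snd v) = snd v" "vcmp K (q []) (snd v) = q []"
        using unitJ[of "[]"] qK(5)[of "[]"] vK by (simp_all add: unit_raw_def lbar_def X.inc_def X.K.hcmp_i1_left X.K.hcmp_i1_right)
      then show ?thesis using True by simp
    next
      case False
      show ?thesis
        by (simp only: False if_False M.psi_xichain[OF xs J(1) False, symmetric] fst_psi)
    qed
    then show ?thesis
      unfolding E1_def xiI_def J_def[symmetric] using uJ[OF J(1)] J(2)
      by (simp only: Let_def prod.case fst_conv)
  qed
  ultimately show ?thesis by blast
qed

end

theorem theorem4p6:
  fixes K :: "('o,'a,'b) cat2" and n :: nat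
  assumes "two_category K"
  shows
   "(\<forall>X Y F G. wdln0 (lic K) n X \<and> wdln0 (lic K) n Y \<and>
        wdln1 (lic K) n X Y F \<and> wdln1 (lic K) n X Y G \<and>
        (\<forall>I. I \<subseteq> {..n} \<longrightarrow> E1 K X Y F I = E1 K X Y G I) \<longrightarrow> F = G) \<and>
    (\<forall>X Y F G w w'. wdln0 (lic K) n X \<and> wdln0 (lic K) n Y \<and>
        wdln1 (lic K) n X Y F \<and> wdln1 (lic K) n X Y G \<and>
        wdln2 (lic K) n X Y F G w \<and> wdln2 (lic K) n X Y F G w' \<and>
        (\<forall>I. I \<subseteq> {..n} \<longrightarrow> E2 w I = E2 w' I) \<longrightarrow> w = w') \<and>
    (\<forall>X Y u. wdln0 (lic K) n X \<and> wdln0 (lic K) n Y \<and> cube1 K n X Y u \<longrightarrow>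
        (\<exists>F. wdln1 (lic K) n X Y F \<and> (\<forall>I. I \<subseteq> {..n} \<longrightarrow> E1 K X Y F I = u I))) \<and>
    (\<forall>X Y F G W. wdln0 (lic K) n X \<and> wdln0 (lic K) n Y \<and>
        wdln1 (lic K) n X Y F \<and> wdln1 (lic K) n X Y G \<and>
        cube2 K n X Y (E1 K X Y F) (E1 K X Y G) W \<longrightarrow>
        (\<exists>w. wdln2 (lic K) n X Y F G w \<and> (\<forall>I. I \<subseteq> {..n} \<longrightarrow> E2 w I = W I)))"
proof -
  have P: "wdl_lic_pair K n X Y" if "wdln0 (lic K) n X" "wdln0 (lic K) n Y" for X Y
  proof -
    interpret two_cat K using assms by unfold_locales
    show ?thesis using that two_category_lic by unfold_locales
  qed
  show ?thesis
  proof (intro conjI allI impI; elim conjE)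
    fix X Y :: "('o,'a,'b) lobj" and F G
    assume XY: "wdln0 (lic K) n X" "wdln0 (lic K) n Y"
      and FG: "wdln1 (lic K) n X Y F" "wdln1 (lic K) n X Y G"
    interpret wdl_lic_pair K n X Y by (rule P[OF XY])
    show "F = G" if "\<forall>I. I \<subseteq> {..n} \<longrightarrow> E1 K X Y F I = E1 K X Y G I"
      by (rule E1_inj[OF FG that])
    show "\<exists>w. wdln2 (lic K) n X Y F G w \<and> (\<forall>I. I \<subseteq> {..n} \<longrightarrow> E2 w I = W I)"
      if "cube2 K n X Y (E1 K X Y F) (E1 K X Y G) W" for W
      by (rule E2_surj[OF FG that])
  next
    fix X Y :: "('o,'a,'b) lobj" and u
    assume XY: "wdln0 (lic K) n X" "wdln0 (lic K) n Y" and u: "cube1 K n X Y u"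
    interpret wdl_lic_pair K n X Y by (rule P[OF XY])
    show "\<exists>F. wdln1 (lic K) n X Y F \<and> (\<forall>I. I \<subseteq> {..n} \<longrightarrow> E1 K X Y F I = u I)"
      by (rule E1_surj[OF u])
  next
    fix w w' :: "'b \<times> 'b \<times> 'b"
    assume "\<forall>I. I \<subseteq> {..n} \<longrightarrow> E2 w I = E2 w' I"
    from this[rule_format, of "{}"] show "w = w'" by (simp add: E2_def)
  qed
qed

end
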